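(* Let $\mathbf{P}\subseteq\mathbb{N}$. The following conditions are equivalent: (1) Problem 1 for $\mathbf{P}$ is computable. (2) Problem 2 for $\mathbf{P}$ is computable. (3) Problem 3 for $\mathbf{P}$ is computable. (4) The monadic theory of $\langle\mathbb{N},<,\mathbf{P}\rangle$ (the set of MLO sentences true in it) is decidable. (5) For every MLO formula $\psi(X,Y,P)$, either there is a recursive C-operator $F$ such that $\langle\mathbb{N},<\rangle\models\forall X\,\psi(X,F(X),\mathbf{P})$, or there is a recursive SC-operator $G$ such that $\langle\mathbb{N},<\rangle\models\forall Y\,\neg\psi(G(Y),Y,\mathbf{P})$; moreover, it is decidable (given $\psi$) which of these cases holds, and a description (program) of the corresponding operator is computable from $\psi$.
   Context: MLO (monadic logic of order) is monadic second-order logic over the binary relation symbol $<$ and unary predicate symbols, interpreted in structures $\langle\mathbb{N},<,\mathbf{P}_1,\dots\rangle$ with the usual order; first-order variables range over $\mathbb{N}$ and set variables over subsets of $\mathbb{N}$. A subset of $\mathbb{N}$ is identified with its characteristic $\omega$-string over $\{0,1\}$. An operator is a map $F:\Sigma_1^\omega\to\Sigma_2^\omega$ ($\Sigma_i$ finite alphabets); an operator of two arguments such as $F(X,P)$ is regarded as an operator on $\omega$-strings over the product alphabet. $F$ is causal (a C-operator) if for all $t\in\mathbb{N}$, whenever $X,X'$ coincide on positions $[0,t]$, $F(X),F(X')$ coincide on $[0,t]$; it is strongly causal (an SC-operator) if whenever $X,X'$ coincide on $[0,t)$, $F(X),F(X')$ coincide on $[0,t]$. A causal operator $F$ is recursive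 if the function sending each finite string $a_0\dots a_n$ to the $n$-th letter of $F(a_0\dots a_n w)$ (which does not depend on the $\omega$-string $w$) is computable. Problems (input: an MLO formula $\psi(X,Y,P)$; "Problem $k$ for $\mathbf{P}$ is computable" means there is an algorithm solving it for all inputs): Problem 1: decide whether there is a C-operator $Y=F(X,P)$ with $\langle\mathbb{N},<\rangle\models\forall X\,\psi(X,F(X,\mathbf{P}),\mathbf{P})$, and if there is such a recursive operator, construct (a program for) it. Problem 2: decide whether there is a recursive C-operator $Y=F(X,P)$ with $\langle\mathbb{N},<\rangle\models\forall X\,\psi(X,F(X,\mathbf{P}),\mathbf{P})$, and if so construct it. Problem 3: decide whether there is a recursive C-operator $Y=F(X)$ with $\langle\mathbb{N},<\rangle\models\forall X\,\psi(X,F(X),\mathbf{P})$, and if so construct it. *)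

theory Defs
  imports Main "HOL-Library.Omega_Words_Fun" "HOL-Library.Nat_Bijection"
begin

section \<open>Partial recursive functions\<close>

datatype recf =
    Zero
  | Succ
  | Proj nat
  | Comp recf "recf list"
  | PrimRec recf recf
  | Mu recf

text \<open>Kleene's schemes on argument lists; \<open>None\<close> means that the value is undefined. In \<open>Mu\<close> all
  values below the least zero must be defined.\<close>

fun run :: "recf \<Rightarrow> nat list \<Rightarrow> nat option" where
  "run Zero xs = Some 0"
| "run Succ xs = (case xs of [x] \<Rightarrow> Some (Suc x) | _ \<Rightarrow> None)"
| "run (Proj i) xs = (if i < length xs then Some (xs ! i) else None)"
| "run (Comp f gs) xs = Option.bind (those (map (\<lambda>g. run g xs) gs)) (run f)"
| "run (PrimRec f g) xs =
     (case xs of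
        [] \<Rightarrow> None
      | n # ys \<Rightarrow> rec_nat (run f ys) (\<lambda>k r. Option.bind r (\<lambda>y. run g (k # y # ys))) n)"
| "run (Mu f) xs =
     (if \<exists>n. run f (n # xs) = Some 0 \<and> (\<forall>m<n. run f (m # xs) \<noteq> None)
      then Some (LEAST n. run f (n # xs) = Some 0) else None)"

fun recf_code :: "recf \<Rightarrow> nat" where
  "recf_code Zero = prod_encode (0, 0)"
| "recf_code Succ = prod_encode (1, 0)"
| "recf_code (Proj i) = prod_encode (2, i)"
| "recf_code (Comp f gs) =
     prod_encode (3, prod_encode (recf_code f, list_encode (map recf_code gs)))"
| "recf_code (PrimRec f g) = prod_encode (4, prod_encode (recf_code f, recf_code g))"
| "recf_code (Mu f) = prod_encode (5, recf_code f)"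

lemma recf_code_inject: "recf_code p = recf_code q \<Longrightarrow> p = q"
proof (induction p arbitrary: q rule: recf_code.induct)
  case (4 f gs)
  then obtain f' gs' where q: "q = Comp f' gs'" by (cases q) auto
  with 4 have "map recf_code gs = map recf_code gs'"
    by (simp add: list_encode_eq)
  then have "gs = gs'"
    by (rule list.inj_map_strong[rotated]) (use "4.IH"(2) in blast)
  with 4 q show ?case by auto
qed (case_tac q; auto)+


section \<open>Monadic logic of order with one unary predicate symbol\<close>

text \<open>The first argument of \<open>Mem\<close>, and the variable in \<open>Less\<close>, \<open>Eq\<close>, \<open>Pred\<close> and \<open>Ex1\<close>, is a
  first-order variable; the second argument of \<open>Mem\<close> and the variable in \<open>Ex2\<close> is a set variable.
  \<open>Pred\<close> is the unary predicate symbol.\<close>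

datatype mlo =
    Less nat nat
  | Eq nat nat
  | Mem nat nat
  | Pred nat
  | Neg mlo
  | And mlo mlo
  | Ex1 nat mlo
  | Ex2 nat mlo

primrec sat :: "nat set \<Rightarrow> (nat \<Rightarrow> nat) \<Rightarrow> (nat \<Rightarrow> nat set) \<Rightarrow> mlo \<Rightarrow> bool" where
  "sat P u V (Less x y) = (u x < u y)"
| "sat P u V (Eq x y) = (u x = u y)"
| "sat P u V (Mem x Z) = (u x \<in> V Z)"
| "sat P u V (Pred x) = (u x \<in> P)"
| "sat P u V (Neg \<phi>) = (\<not> sat P u V \<phi>)"
| "sat P u V (And \<phi> \<psi>) = (sat P u V \<phi> \<and> sat P u V \<psi>)"
| "sat P u V (Ex1 x \<phi>) = (\<exists>n. sat P (u(x := n)) V \<phi>)"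
| "sat P u V (Ex2 Z \<phi>) = (\<exists>A. sat P u (V(Z := A)) \<phi>)"

primrec free1 :: "mlo \<Rightarrow> nat set" where
  "free1 (Less x y) = {x, y}"
| "free1 (Eq x y) = {x, y}"
| "free1 (Mem x Z) = {x}"
| "free1 (Pred x) = {x}"
| "free1 (Neg \<phi>) = free1 \<phi>"
| "free1 (And \<phi> \<psi>) = free1 \<phi> \<union> free1 \<psi>"
| "free1 (Ex1 x \<phi>) = free1 \<phi> - {x}"
| "free1 (Ex2 Z \<phi>) = free1 \<phi>"

primrec free2 :: "mlo \<Rightarrow> nat set" where
  "free2 (Less x y) = {}"
| "free2 (Eq x y) = {}"
| "free2 (Mem x Z) = {Z}"
| "free2 (Pred x) = {}"
| "free2 (Neg \<phi>) = free2 \<phi>"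
| "free2 (And \<phi> \<psi>) = free2 \<phi> \<union> free2 \<psi>"
| "free2 (Ex1 x \<phi>) = free2 \<phi>"
| "free2 (Ex2 Z \<phi>) = free2 \<phi> - {Z}"

primrec mlo_code :: "mlo \<Rightarrow> nat" where
  "mlo_code (Less x y) = 8 * prod_encode (x, y)"
| "mlo_code (Eq x y) = 8 * prod_encode (x, y) + 1"
| "mlo_code (Mem x Z) = 8 * prod_encode (x, Z) + 2"
| "mlo_code (Pred x) = 8 * x + 3"
| "mlo_code (Neg \<phi>) = 8 * mlo_code \<phi> + 4"
| "mlo_code (And \<phi> \<psi>) = 8 * prod_encode (mlo_code \<phi>, mlo_code \<psi>) + 5"
| "mlo_code (Ex1 x \<phi>) = 8 * prod_encode (x, mlo_code \<phi>) + 6"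
| "mlo_code (Ex2 Z \<phi>) = 8 * prod_encode (Z, mlo_code \<phi>) + 7"

lemma mlo_code_inject: "mlo_code \<phi> = mlo_code \<psi> \<Longrightarrow> \<phi> = \<psi>"
  by (induction \<phi> arbitrary: \<psi>; case_tac \<psi>; simp; (presburger | fastforce)?)

text \<open>The assignment below is irrelevant: a sentence has no free variables.\<close>

definition monadic_theory :: "nat set \<Rightarrow> mlo set" where
  "monadic_theory P =
     {\<phi>. free1 \<phi> = {} \<and> free2 \<phi> = {} \<and> sat P (\<lambda>_. 0) (\<lambda>_. {}) \<phi>}"

text \<open>The formulas \<open>\<psi>(X, Y, P)\<close>: the set variables 0 and 1 play the roles of \<open>X\<close> and \<open>Y\<close>.\<close>

definition specs :: "mlo set" where
  "specs = {\<psi>. free1 \<psi> = {} \<and> free2 \<psi> \<subseteq> {0, 1}}"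

definition holds :: "mlo \<Rightarrow> nat set \<Rightarrow> nat set \<Rightarrow> nat set \<Rightarrow> bool" where
  "holds \<psi> X Y P = sat P (\<lambda>_. 0) ((\<lambda>_. {})(0 := X, 1 := Y)) \<psi>"


section \<open>Operators on \<open>\<omega>\<close>-strings\<close>

definition causal :: "('a word \<Rightarrow> 'b word) \<Rightarrow> bool" where
  "causal F \<longleftrightarrow>
     (\<forall>t X X'. (\<forall>i\<in>{0..t}. X i = X' i) \<longrightarrow> (\<forall>i\<in>{0..t}. F X i = F X' i))"

definition strongly_causal :: "('a word \<Rightarrow> 'b word) \<Rightarrow> bool" where
  "strongly_causal F \<longleftrightarrow>
     (\<forall>t X X'. (\<forall>i\<in>{0..<t}. X i = X' i) \<longrightarrow> (\<forall>i\<in>{0..t}. F X i = F X' i))"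

text \<open>The parameter \<open>c\<close> codes the letters of the input alphabet by numbers.\<close>

definition program_for :: "('a \<Rightarrow> nat) \<Rightarrow> recf \<Rightarrow> ('a word \<Rightarrow> bool word) \<Rightarrow> bool" where
  "program_for c p F \<longleftrightarrow>
     (\<forall>a w. a \<noteq> [] \<longrightarrow>
        run p [list_encode (map c a)] = Some (of_bool (F (a \<frown> w) (length a - 1))))"

definition recursive_op :: "('a \<Rightarrow> nat) \<Rightarrow> ('a word \<Rightarrow> bool word) \<Rightarrow> bool" where
  "recursive_op c F \<longleftrightarrow> (\<exists>p. program_for c p F)"

definition code1 :: "bool \<Rightarrow> nat" where
  "code1 b = of_bool b"

definition code2 :: "bool \<times> bool \<Rightarrow> nat" where
  "code2 = (\<lambda>(b, b'). prod_encode (of_bool b, of_bool b'))"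

definition char_word :: "nat set \<Rightarrow> bool word" where
  "char_word A = (\<lambda>n. n \<in> A)"

definition apply1 :: "(bool word \<Rightarrow> bool word) \<Rightarrow> nat set \<Rightarrow> nat set" where
  "apply1 F X = {n. F (char_word X) n}"

definition apply2 :: "((bool \<times> bool) word \<Rightarrow> bool word) \<Rightarrow> nat set \<Rightarrow> nat set \<Rightarrow> nat set" where
  "apply2 F X P = {n. F (\<lambda>i. (char_word X i, char_word P i)) n}"


section \<open>Synthesis problems\<close>

definition decidable_on :: "mlo set \<Rightarrow> (mlo \<Rightarrow> bool) \<Rightarrow> bool" where
  "decidable_on D Q \<longleftrightarrow> (\<exists>d. \<forall>\<psi>\<in>D. run d [mlo_code \<psi>] = Some (of_bool (Q \<psi>)))"

text \<open>One algorithm turns every \<open>\<psi> \<in> D\<close> for which some recursive operator \<open>F\<close> satisfies \<open>R \<psi> F\<close>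
  into a program for such an operator. Nothing is required of it on other inputs.\<close>

definition constructible_on ::
  "mlo set \<Rightarrow> ('a \<Rightarrow> nat) \<Rightarrow> (mlo \<Rightarrow> ('a word \<Rightarrow> bool word) \<Rightarrow> bool) \<Rightarrow> bool" where
  "constructible_on D c R \<longleftrightarrow>
     (\<exists>e. \<forall>\<psi>\<in>D. (\<exists>F. recursive_op c F \<and> R \<psi> F) \<longrightarrow>
        (\<exists>p F. run e [mlo_code \<psi>] = Some (recf_code p) \<and> program_for c p F \<and> R \<psi> F))"

definition solves2 :: "nat set \<Rightarrow> mlo \<Rightarrow> ((bool \<times> bool) word \<Rightarrow> bool word) \<Rightarrow> bool" where
  "solves2 P \<psi> F \<longleftrightarrow> causal F \<and> (\<forall>X. holds \<psi> X (apply2 F X P) P)"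

definition solves1 :: "nat set \<Rightarrow> mlo \<Rightarrow> (bool word \<Rightarrow> bool word) \<Rightarrow> bool" where
  "solves1 P \<psi> F \<longleftrightarrow> causal F \<and> (\<forall>X. holds \<psi> X (apply1 F X) P)"

definition refutes1 :: "nat set \<Rightarrow> mlo \<Rightarrow> (bool word \<Rightarrow> bool word) \<Rightarrow> bool" where
  "refutes1 P \<psi> G \<longleftrightarrow> strongly_causal G \<and> (\<forall>Y. \<not> holds \<psi> (apply1 G Y) Y P)"

definition problem1_computable :: "nat set \<Rightarrow> bool" where
  "problem1_computable P \<longleftrightarrow>
     decidable_on specs (\<lambda>\<psi>. \<exists>F. solves2 P \<psi> F) \<and>
     constructible_on specs code2 (solves2 P)"

definition problem2_computable :: "nat set \<Rightarrow> bool" where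
  "problem2_computable P \<longleftrightarrow>
     decidable_on specs (\<lambda>\<psi>. \<exists>F. recursive_op code2 F \<and> solves2 P \<psi> F) \<and>
     constructible_on specs code2 (solves2 P)"

definition problem3_computable :: "nat set \<Rightarrow> bool" where
  "problem3_computable P \<longleftrightarrow>
     decidable_on specs (\<lambda>\<psi>. \<exists>F. recursive_op code1 F \<and> solves1 P \<psi> F) \<and>
     constructible_on specs code1 (solves1 P)"

definition monadic_theory_decidable :: "nat set \<Rightarrow> bool" where
  "monadic_theory_decidable P \<longleftrightarrow> decidable_on UNIV (\<lambda>\<phi>. \<phi> \<in> monadic_theory P)"

definition effectively_determined :: "nat set \<Rightarrow> bool" where
  "effectively_determined P \<longleftrightarrow>
     (\<forall>\<psi>\<in>specs. (\<exists>F. recursive_op code1 F \<and> solves1 P \<psi> F) \<or>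
                (\<exists>G. recursive_op code1 G \<and> refutes1 P \<psi> G)) \<and>
     decidable_on specs (\<lambda>\<psi>. \<exists>F. recursive_op code1 F \<and> solves1 P \<psi> F) \<and>
     decidable_on specs (\<lambda>\<psi>. \<exists>G. recursive_op code1 G \<and> refutes1 P \<psi> G) \<and>
     constructible_on specs code1 (solves1 P) \<and>
     constructible_on specs code1 (refutes1 P)"

end

theory Submission
  imports Defs "HOL-Library.Countable" "HOL-Library.Ramsey"
begin

text \<open>A formula \<open>\<psi>(X, Y, P)\<close> is recognized by a congruence of finite index on words, hence by a
  deterministic parity automaton. Ramsey's theorem cuts \<open>P\<close> into segments that all induce the same
  finite parity game between the player choosing \<open>X\<close> and the player choosing \<open>Y\<close>, and the cut points
  can be chosen definable in \<open>\<langle>\<nat>, <, P\<rangle>\<close>. Positional determinacy of the finite game therefore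
  gives one of the players a winning strategy that is defined by a formula
  \<open>\<beta>(n, X \<inter> [0, n], P)\<close>.

  That \<open>\<beta>\<close> defines a winning strategy is itself an \<open>MLO\<close> sentence. If the monadic theory is
  decidable, a winning \<open>\<beta>\<close> is found by search, and a program for its strategy decides one sentence
  for each finite input. The two players cannot both win, because a causal and a strongly causal
  operator have a common fixpoint. Conversely, a sentence is a specification, and it is true iff a
  constant operator solves it.\<close>


section \<open>Recognition by finite congruences\<close>

text \<open>The parameter P may be undecidable and hidden from the operator, which must still be
  recursive. For fixed P the game of \<psi> is played on an infinite arena, where positional
  determinacy alone gives no formula. Equivalent segments leave a finite arena: a strategy becomes a
  finite table together with the knowledge of the cuts and of the value of the rest of the current
  segment. The latter looks into the future of P, which a formula over the whole structure may do.
  Ramsey's theorem gives no formula for its set; it is replaced by cuts chosen greedily among the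
  positions that merge with a fixed r0, where merging means that the segments from both positions to
  some common end have equal values. Merging of positions also drives the determinization. The
  construction of \<beta> is not effective; it only shows that the search ends. A winning strategy
  for X excludes even operators F(X, P) that read the parameter, and this is why Problems 1, 2 and 3
  get the same solvable instances when the theory is decidable.\<close>

definition fin_cong :: "('a list \<Rightarrow> 'b) \<Rightarrow> bool" where
  "fin_cong h \<longleftrightarrow> finite (range h) \<and>
     (\<forall>u u' v v'. h u = h u' \<longrightarrow> h v = h v' \<longrightarrow> h (u @ v) = h (u' @ v'))"

lemma fin_congD: "fin_cong h \<Longrightarrow> h u = h u' \<Longrightarrow> h v = h v' \<Longrightarrow> h (u @ v) = h (u' @ v')"
  unfolding fin_cong_def by blast

lemma fin_cong_finite: "fin_cong h \<Longrightarrow> finite (range h)"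
  unfolding fin_cong_def by blast

lemma fin_congI:
  assumes "finite (range h)"
    "\<And>u u' v v'. h u = h u' \<Longrightarrow> h v = h v' \<Longrightarrow> h (u @ v) = h (u' @ v')"
  shows "fin_cong h"
  unfolding fin_cong_def using assms by blast

text \<open>Values are recoded as numbers, so that \<open>recognizes\<close> can use the single
  value type \<open>nat\<close> for all formulas while the constructions below produce booleans,
  tuples and sets.\<close>

lemma fin_cong_inj:
  assumes "fin_cong h" "inj_on f (range h)"
  shows "fin_cong (\<lambda>u. f (h u))"
proof -
  have eq: "f (h u) = f (h v) \<longleftrightarrow> h u = h v" for u v
    using assms(2) by (auto simp: inj_on_def)
  show ?thesis
  proof (rule fin_congI)
    show "finite (range (\<lambda>u. f (h u)))"
      using finite_imageI[OF fin_cong_finite[OF assms(1)], of f] by (simp add: image_image)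
  qed (use fin_congD[OF assms(1)] eq in blast)
qed

lemma fin_cong_Pair:
  assumes "fin_cong h" "fin_cong g"
  shows "fin_cong (\<lambda>u. (h u, g u))"
proof (rule fin_congI)
  have "range (\<lambda>u. (h u, g u)) \<subseteq> range h \<times> range g" by auto
  then show "finite (range (\<lambda>u. (h u, g u)))"
    using assms by (auto intro: finite_subset[OF _ finite_cartesian_product] fin_cong_finite)
qed (use fin_congD[OF assms(1)] fin_congD[OF assms(2)] in blast)

definition cuts :: "(nat \<Rightarrow> nat) \<Rightarrow> bool" where
  "cuts c \<longleftrightarrow> strict_mono c \<and> c 0 = 0"

lemma cuts_segment:
  assumes "cuts c"
  shows "\<exists>!i. c i \<le> n \<and> n < c (Suc i)"
proof -
  have sm: "strict_mono c" and c0: "c 0 = 0" using assms by (auto simp: cuts_def)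
  define i where "i = (GREATEST i. c i \<le> n)"
  have b: "\<forall>i. c i \<le> n \<longrightarrow> i \<le> n" using strict_mono_imp_increasing[OF sm] le_trans by blast
  have "c i \<le> n" unfolding i_def by (rule GreatestI_nat[of "\<lambda>i. c i \<le> n" 0]) (use b c0 in auto)
  moreover have "n < c (Suc i)"
  proof (rule ccontr)
    assume "\<not> n < c (Suc i)"
    then have "Suc i \<le> i" unfolding i_def
      by (intro Greatest_le_nat[where b=n]) (use b in auto)
    then show False by simp
  qed
  moreover have "j = i" if "c j \<le> n" "n < c (Suc j)" for j
  proof (rule ccontr)
    assume "j \<noteq> i"
    then consider "Suc j \<le> i" | "Suc i \<le> j" by linarith
    then show False
    proof cases
      case 1 then have "c (Suc j) \<le> c i" using sm by (simp add: strict_mono_less_eq)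
      with \<open>c i \<le> n\<close> that show False by simp
    next
      case 2 then have "c (Suc i) \<le> c j" using sm by (simp add: strict_mono_less_eq)
      with \<open>n < c (Suc i)\<close> that show False by simp
    qed
  qed
  ultimately show ?thesis by blast
qed

text \<open>Lets a set witness be chosen segment by segment in \<open>recognizable_Ex2\<close>: each
  position belongs to exactly one segment, from which its letter is read.\<close>

lemma glue_segments:
  assumes "cuts c" "\<And>i. length (v i) = c (Suc i) - c i"
  shows "\<exists>w. \<forall>i. map w [c i..<c (Suc i)] = v i"
proof -
  define s where "s n = (THE i. c i \<le> n \<and> n < c (Suc i))" for n
  have s: "s n = i" if "c i \<le> n" "n < c (Suc i)" for n i
    unfolding s_def using cuts_segment[OF assms(1), of n] that by (intro the1_equality) auto
  define w where "w n = v (s n) ! (n - c (s n))" for n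
  have "map w [c i..<c (Suc i)] = v i" for i
    by (rule nth_equalityI) (auto simp: assms(2) w_def s[of i] simp del: upt_Suc)
  then show ?thesis by blast
qed

lemma upt_append: "i \<le> j \<Longrightarrow> j \<le> k \<Longrightarrow> [i..<j] @ [j..<k] = [i..<k]"
  by (metis le_Suc_ex upt_add_eq_append)

lemma map_upt_eq_append:
  assumes "map w [i..<k] = v1 @ v2"
  shows "v1 = map w [i..<i + length v1]" "v2 = map w [i + length v1..<k]"
proof -
  have len: "length (v1 @ v2) = k - i" using assms[symmetric] by simp
  have "v1 = take (length v1) (map w [i..<k])" "v2 = drop (length v1) (map w [i..<k])"
    using assms by simp_all
  moreover have "take (length v1) (map w [i..<k]) = map w [i..<i + length v1]"
    using len by (intro nth_equalityI) auto
  moreover have "drop (length v1) (map w [i..<k]) = map w [i + length v1..<k]"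
    by (simp add: drop_map)
  ultimately show "v1 = map w [i..<i + length v1]" "v2 = map w [i + length v1..<k]"
    by simp_all
qed

text \<open>The two words may be cut at different places and into segments of different lengths;
  only the sequences of values are compared. Segments are nonempty because \<open>cuts\<close> is
  strictly increasing.\<close>

definition factor_eq ::
  "('a list \<Rightarrow> 'b) \<Rightarrow> 'a word \<Rightarrow> (nat \<Rightarrow> nat) \<Rightarrow> 'a word \<Rightarrow> (nat \<Rightarrow> nat) \<Rightarrow> bool" where
  "factor_eq h w c w' c' \<longleftrightarrow> cuts c \<and> cuts c' \<and>
     (\<forall>i. h (map w [c i..<c (Suc i)]) = h (map w' [c' i..<c' (Suc i)]))"

lemma factor_eq_sym: "factor_eq h w c w' c' \<Longrightarrow> factor_eq h w' c' w c"
  by (auto simp: factor_eq_def)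

type_synonym track_letter = "nat set \<times> nat set \<times> bool"

text \<open>Only the tracks of free variables matter; the others are arbitrary, so that words can be
  passed unchanged to subformulas.\<close>

definition codes ::
  "mlo \<Rightarrow> track_letter word \<Rightarrow> (nat \<Rightarrow> nat) \<Rightarrow> (nat \<Rightarrow> nat set) \<Rightarrow> nat set \<Rightarrow> bool" where
  "codes \<phi> w u V P \<longleftrightarrow> (\<forall>n. (\<forall>x\<in>free1 \<phi>. x \<in> fst (w n) \<longleftrightarrow> u x = n) \<and>
     (\<forall>Z\<in>free2 \<phi>. Z \<in> fst (snd (w n)) \<longleftrightarrow> n \<in> V Z) \<and> (snd (snd (w n)) \<longleftrightarrow> n \<in> P))"

text \<open>Saturation in the sense of Buchi: truth depends only on the sequence of values along a
  factorization. One implication suffices, since \<open>factor_eq\<close> is symmetric. Closure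
  under negation is then immediate, and Ramsey's theorem enters at the determinization.\<close>

definition recognizes :: "(track_letter list \<Rightarrow> nat) \<Rightarrow> mlo \<Rightarrow> bool" where
  "recognizes h \<phi> \<longleftrightarrow> (\<forall>w u V P c w' u' V' P' c'. codes \<phi> w u V P \<longrightarrow> codes \<phi> w' u' V' P' \<longrightarrow>
      factor_eq h w c w' c' \<longrightarrow> sat P u V \<phi> \<longrightarrow> sat P' u' V' \<phi>)"

lemma recognizable_inj:
  fixes f :: "'b \<Rightarrow> nat"
  assumes "fin_cong h" "inj_on f (range h)"
    "\<And>w u V P c w' u' V' P' c'. codes \<phi> w u V P \<Longrightarrow> codes \<phi> w' u' V' P' \<Longrightarrow>
      factor_eq h w c w' c' \<Longrightarrow> sat P u V \<phi> \<Longrightarrow> sat P' u' V' \<phi>"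
  shows "\<exists>h'. fin_cong h' \<and> recognizes h' \<phi>"
proof (intro exI conjI)
  show "fin_cong (\<lambda>u. f (h u))" by (rule fin_cong_inj[OF assms(1,2)])
  have "f (h u) = f (h v) \<longleftrightarrow> h u = h v" for u v
    using assms(2) by (auto simp: inj_on_def)
  then have "factor_eq h w c w' c'" if "factor_eq (\<lambda>u. f (h u)) w c w' c'" for w c w' c'
    using that by (auto simp: factor_eq_def)
  then show "recognizes (\<lambda>u. f (h u)) \<phi>"
    unfolding recognizes_def using assms(3) by blast
qed

text \<open>Covers the atomic formulas which say that a single position carries certain tracks; the
  congruence records whether a letter with property \<open>p\<close> occurs.\<close>

lemma recognizable_occurs:
  assumes "\<And>w u V P. codes \<phi> w u V P \<Longrightarrow> sat P u V \<phi> \<longleftrightarrow> (\<exists>n. p (w n))"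
  shows "\<exists>h. fin_cong h \<and> recognizes h \<phi>"
proof -
  define h where "h u = (\<exists>a\<in>set u. p a)" for u :: "track_letter list"
  have fc: "fin_cong h" by (rule fin_congI) (auto simp: h_def)
  show ?thesis
  proof (rule recognizable_inj[OF fc inj_on_subset[OF inj_to_nat subset_UNIV]])
  fix w :: "track_letter word" and u V P c and w' :: "track_letter word" and  u' V' P' c'
  assume "codes \<phi> w u V P" "codes \<phi> w' u' V' P'" and fe: "factor_eq h w c w' c'" and "sat P u V \<phi>"
  then obtain n where "p (w n)" using assms by blast
  obtain i where "c i \<le> n" "n < c (Suc i)" using fe cuts_segment[of c n] by (auto simp: factor_eq_def)
  then have "h (map w [c i..<c (Suc i)])" using \<open>p (w n)\<close> by (auto simp: h_def)
  then have "h (map w' [c' i..<c' (Suc i)])" using fe by (auto simp: factor_eq_def)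
  then have "\<exists>n. p (w' n)" by (auto simp: h_def)
  then show "sat P' u' V' \<phi>" using assms[OF \<open>codes \<phi> w' u' V' P'\<close>] by blast
  qed
qed

text \<open>The marks of x and y lie either in different segments, where the order of the segments
  decides, or in the same one, where \<open>o2\<close> remembers an x strictly before a y. This
  composes: an x before a y in \<open>u @ v\<close> lies with it in \<open>u\<close>, with it in
  \<open>v\<close>, or in \<open>u\<close> with the y in \<open>v\<close>.\<close>

lemma recognizable_Less: "\<exists>h. fin_cong h \<and> recognizes h (Less x y)"
proof -
  define o1 where "o1 z u = (\<exists>a\<in>set u. z \<in> fst a)" for z and u :: "track_letter list"
  define o2 where "o2 u = (\<exists>v1 v2. u = v1 @ v2 \<and> o1 x v1 \<and> o1 y v2)" for u
  define h where "h u = (o1 x u, o1 y u, o2 u)" for u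
  have o1: "o1 z (u @ v) \<longleftrightarrow> o1 z u \<or> o1 z v" for z u v by (auto simp: o1_def)
  have o2: "o2 (u @ v) \<longleftrightarrow> o2 u \<or> o2 v \<or> (o1 x u \<and> o1 y v)" for u v
  proof
    assume "o2 (u @ v)"
    then obtain v1 v2 where *: "u @ v = v1 @ v2" "o1 x v1" "o1 y v2" unfolding o2_def by blast
    then show "o2 u \<or> o2 v \<or> (o1 x u \<and> o1 y v)"
      unfolding append_eq_append_conv2 by (auto simp: o1 o2_def)
  next
    assume "o2 u \<or> o2 v \<or> (o1 x u \<and> o1 y v)"
    then show "o2 (u @ v)"
    proof (elim disjE)
      assume "o2 u"
      then obtain v1 v2 where "u = v1 @ v2" "o1 x v1" "o1 y v2" by (auto simp: o2_def)
      then have "u @ v = v1 @ (v2 @ v)" "o1 x v1" "o1 y (v2 @ v)" by (auto simp: o1)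
      then show ?thesis unfolding o2_def by blast
    next
      assume "o2 v"
      then obtain v1 v2 where "v = v1 @ v2" "o1 x v1" "o1 y v2" by (auto simp: o2_def)
      then have "u @ v = (u @ v1) @ v2" "o1 x (u @ v1)" "o1 y v2" by (auto simp: o1)
      then show ?thesis unfolding o2_def by blast
    qed (auto simp: o2_def)
  qed
  have fc: "fin_cong h" by (rule fin_congI) (auto simp: h_def o1 o2)
  show ?thesis
  proof (rule recognizable_inj[OF fc inj_on_subset[OF inj_to_nat subset_UNIV]])
  fix w :: "track_letter word" and u V P c and w' :: "track_letter word" and  u' V' P' c'
  assume C: "codes (Less x y) w u V P" and C': "codes (Less x y) w' u' V' P'"
    and fe: "factor_eq h w c w' c'" and "sat P u V (Less x y)"
  then have less: "u x < u y" by simp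
  have c: "cuts c" and c': "cuts c'" using fe by (auto simp: factor_eq_def)
  have W: "x \<in> fst (w n) \<longleftrightarrow> u x = n" "y \<in> fst (w n) \<longleftrightarrow> u y = n"
     "x \<in> fst (w' n) \<longleftrightarrow> u' x = n" "y \<in> fst (w' n) \<longleftrightarrow> u' y = n" for n
    using C C' by (auto simp: codes_def)
  obtain i where i: "c i \<le> u x" "u x < c (Suc i)" using cuts_segment[OF c, of "u x"] by blast
  obtain j where j: "c j \<le> u y" "u y < c (Suc j)" using cuts_segment[OF c, of "u y"] by blast
  have sm: "strict_mono c" "strict_mono c'" using c c' by (auto simp: cuts_def)
  have "i \<le> j"
  proof (rule ccontr)
    assume "\<not> i \<le> j"
    then have "c (Suc j) \<le> c i" using sm by (simp add: strict_mono_less_eq)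
    then show False using less i j by simp
  qed
  show "sat P' u' V' (Less x y)"
  proof (cases "i = j")
    case True
    \<comment> \<open>The split right after \<open>u x\<close> leaves the mark of x on the left and,
      as \<open>u x < u y\<close>, the mark of y on the right.\<close>
    have "map w [c i..<c (Suc i)] = map w [c i..<Suc (u x)] @ map w [Suc (u x)..<c (Suc i)]"
      using i by (simp add: upt_append flip: map_append del: upt_Suc)
    moreover have "o1 x (map w [c i..<Suc (u x)])" using i W by (auto simp: o1_def)
    moreover have "o1 y (map w [Suc (u x)..<c (Suc i)])" using j True less W by (auto simp: o1_def)
    ultimately have "o2 (map w [c i..<c (Suc i)])" unfolding o2_def by blast
    then have "o2 (map w' [c' i..<c' (Suc i)])" using fe by (auto simp: factor_eq_def h_def)
    then obtain v1 v2 where v: "map w' [c' i..<c' (Suc i)] = v1 @ v2" "o1 x v1" "o1 y v2"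
      by (auto simp: o2_def)
    let ?n = "length v1"
    have "v1 = map w' [c' i..<c' i + ?n]" "v2 = map w' [c' i + ?n..<c' (Suc i)]"
      using map_upt_eq_append[OF v(1)] by simp_all
    then have "o1 x (map w' [c' i..<c' i + ?n])" "o1 y (map w' [c' i + ?n..<c' (Suc i)])"
      using v(2,3) by metis+
    then have "u' x < c' i + ?n" "c' i + ?n \<le> u' y" using W
      by (auto simp: o1_def simp del: upt_Suc)
    then show ?thesis by simp
  next
    case False
    with \<open>i \<le> j\<close> have "Suc i \<le> j" by simp
    have "o1 x (map w [c i..<c (Suc i)])" "o1 y (map w [c j..<c (Suc j)])"
      using i j W by (auto simp: o1_def)
    then have "o1 x (map w' [c' i..<c' (Suc i)])" "o1 y (map w' [c' j..<c' (Suc j)])"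
      using fe by (auto simp: factor_eq_def h_def)
    then have "u' x < c' (Suc i)" "c' j \<le> u' y" using W by (auto simp: o1_def)
    moreover have "c' (Suc i) \<le> c' j" using sm(2) \<open>Suc i \<le> j\<close> by (simp add: strict_mono_less_eq)
    ultimately show ?thesis by simp
  qed
  qed
qed

lemma recognizes_swap:
  assumes "recognizes h \<phi>" "codes \<phi> w u V P" "codes \<phi> w' u' V' P'" "factor_eq h w c w' c'"
  shows "sat P u V \<phi> \<longleftrightarrow> sat P' u' V' \<phi>"
  using assms factor_eq_sym unfolding recognizes_def by blast

lemma codes_Neg: "codes (Neg \<phi>) = codes \<phi>"
  by (simp add: codes_def fun_eq_iff)

lemma recognizable_Neg: "recognizes h \<phi> \<Longrightarrow> recognizes h (Neg \<phi>)"
  using recognizes_swap unfolding recognizes_def[of h "Neg \<phi>"] codes_Neg by (metis sat.simps(5))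

lemma recognizable_And:
  assumes "fin_cong h" "recognizes h \<phi>" "fin_cong g" "recognizes g \<psi>"
  shows "\<exists>h'. fin_cong h' \<and> recognizes h' (And \<phi> \<psi>)"
proof (rule recognizable_inj[OF fin_cong_Pair[OF assms(1,3)] inj_on_subset[OF inj_to_nat subset_UNIV]])
  fix w :: "track_letter word" and u V P c and w' :: "track_letter word" and  u' V' P' c'
  assume *: "codes (And \<phi> \<psi>) w u V P" "codes (And \<phi> \<psi>) w' u' V' P'"
    "factor_eq (\<lambda>u. (h u, g u)) w c w' c'" "sat P u V (And \<phi> \<psi>)"
  then have "codes \<phi> w u V P" "codes \<phi> w' u' V' P'" "codes \<psi> w u V P" "codes \<psi> w' u' V' P'"
    "factor_eq h w c w' c'" "factor_eq g w c w' c'"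
    by (auto simp: codes_def factor_eq_def)
  then show "sat P' u' V' (And \<phi> \<psi>)" using * assms(2,4) unfolding recognizes_def by fastforce
qed

definition set_variant :: "nat \<Rightarrow> track_letter list \<Rightarrow> track_letter list \<Rightarrow> bool" where
  "set_variant Z u v \<longleftrightarrow> list_all2 (\<lambda>a b. fst b = fst a \<and> snd (snd b) = snd (snd a) \<and>
     fst (snd b) - {Z} = fst (snd a) - {Z}) u v"

lemma set_variant_append: "set_variant Z (u @ u') x \<longleftrightarrow>
    (\<exists>v v'. x = v @ v' \<and> set_variant Z u v \<and> set_variant Z u' v')"
  unfolding set_variant_def by (blast dest: list_all2_append1[THEN iffD1] intro: list_all2_appendI)

text \<open>Powerset construction: the value of a word is the set of \<open>h\<close>-values of all
  its relabellings on track Z. It is a congruence because the relabellings of a concatenation are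
  the concatenations of relabellings. A witness set for one word is transported to the other by
  choosing in each segment a relabelling with the same \<open>h\<close>-value.\<close>

lemma recognizable_Ex2:
  assumes "fin_cong h" "recognizes h \<phi>"
  shows "\<exists>h'. fin_cong h' \<and> recognizes h' (Ex2 Z \<phi>)"
proof -
  define g where "g u = {h v | v. set_variant Z u v}" for u
  have gr: "range g \<subseteq> Pow (range h)" by (auto simp: g_def)
  have app: "g (u @ u') = {h (v @ v') | v v'. set_variant Z u v \<and> set_variant Z u' v'}" for u u'
    unfolding g_def set_variant_append by blast
  have fc: "fin_cong g"
  proof (rule fin_congI)
    show "finite (range g)" using gr fin_cong_finite[OF assms(1)] by (simp add: finite_subset)
    have *: "g (u @ v) \<subseteq> g (u' @ v')" if "g u = g u'" "g v = g v'" for u u' v v'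
    proof
      fix x assume "x \<in> g (u @ v)"
      then obtain a b where x: "x = h (a @ b)" "set_variant Z u a" "set_variant Z v b"
        unfolding app by blast
      then have "h a \<in> g u" "h b \<in> g v" by (auto simp: g_def)
      then have "h a \<in> g u'" "h b \<in> g v'" using that by simp_all
      then obtain a' b' where "h a = h a'" "h b = h b'" "set_variant Z u' a'" "set_variant Z v' b'"
        by (auto simp: g_def)
      then show "x \<in> g (u' @ v')" unfolding app using x fin_congD[OF assms(1)] by blast
    qed
    show "g (u @ v) = g (u' @ v')" if "g u = g u'" "g v = g v'" for u u' v v'
      using *[OF that] *[OF that[symmetric]] by blast
  qed
  have inj: "inj_on set_encode (range g)"
    by (rule inj_on_subset[OF inj_on_set_encode])
      (use gr fin_cong_finite[OF assms(1)] in \<open>auto intro: finite_subset\<close>)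
  show ?thesis
  proof (rule recognizable_inj[OF fc inj])
    fix w :: "track_letter word" and u V P c and w' :: "track_letter word" and  u' V' P' c'
    assume C: "codes (Ex2 Z \<phi>) w u V P" and C': "codes (Ex2 Z \<phi>) w' u' V' P'"
      and fe: "factor_eq g w c w' c'" and s: "sat P u V (Ex2 Z \<phi>)"
    then obtain A where A: "sat P u (V(Z := A)) \<phi>" by auto
    \<comment> \<open>The word \<open>w\<close> with A written on track Z, whose content in
      \<open>w\<close> is arbitrary because Z is not free in \<open>Ex2 Z \<phi>\<close>.\<close>
    define w1 where "w1 n = (fst (w n), (if n \<in> A then insert Z (fst (snd (w n)))
        else fst (snd (w n)) - {Z}), snd (snd (w n)))" for n
    have c1: "codes \<phi> w1 u (V(Z := A)) P" using C by (auto simp: codes_def w1_def)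
    have c: "cuts c" "cuts c'" using fe by (auto simp: factor_eq_def)
    have "\<exists>v. set_variant Z (map w' [c' i..<c' (Suc i)]) v \<and> h v = h (map w1 [c i..<c (Suc i)])" for i
    proof -
      have "set_variant Z (map w [c i..<c (Suc i)]) (map w1 [c i..<c (Suc i)])"
        by (auto simp: set_variant_def list_all2_conv_all_nth w1_def simp del: upt_Suc)
      then have "h (map w1 [c i..<c (Suc i)]) \<in> g (map w [c i..<c (Suc i)])" by (auto simp: g_def)
      then have "h (map w1 [c i..<c (Suc i)]) \<in> g (map w' [c' i..<c' (Suc i)])"
        using fe by (simp add: factor_eq_def)
      then show ?thesis unfolding g_def by force
    qed
    then obtain v where v: "\<And>i. set_variant Z (map w' [c' i..<c' (Suc i)]) (v i)"
       "\<And>i. h (v i) = h (map w1 [c i..<c (Suc i)])" by metis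
    have "length (v i) = c' (Suc i) - c' i" for i
      using v(1)[of i] by (auto simp: set_variant_def dest: list_all2_lengthD)
    from glue_segments[of c' v, OF c(2) this]
    obtain w1' where w1': "\<And>i. map w1' [c' i..<c' (Suc i)] = v i" by blast
    define A' where "A' = {n. Z \<in> fst (snd (w1' n))}"
    have "fst (w1' n) = fst (w' n) \<and> snd (snd (w1' n)) = snd (snd (w' n)) \<and>
        fst (snd (w1' n)) - {Z} = fst (snd (w' n)) - {Z}" for n
    proof -
      obtain i where i: "c' i \<le> n" "n < c' (Suc i)" using cuts_segment[OF c(2)] by blast
      have "set_variant Z (map w' [c' i..<c' (Suc i)]) (map w1' [c' i..<c' (Suc i)])"
        using v(1)[of i] w1'[of i] by simp
      then show ?thesis unfolding set_variant_def list_all2_conv_all_nth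
        using i by (auto simp del: upt_Suc dest!: spec[of _ "n - c' i"])
    qed
    then have "codes \<phi> w1' u' (V'(Z := A')) P'" using C' unfolding codes_def A'_def
      by (simp; blast)
    moreover have "factor_eq h w1 c w1' c'" using c by (simp add: factor_eq_def w1' v(2) del: upt_Suc)
    ultimately have "sat P' u' (V'(Z := A')) \<phi>" using assms(2) c1 A unfolding recognizes_def by blast
    then show "sat P' u' V' (Ex2 Z \<phi>)" by auto
  qed
qed

definition drop_track :: "nat \<Rightarrow> track_letter \<Rightarrow> track_letter" where
  "drop_track x a = (fst a - {x}, snd a)"

definition add_track :: "nat \<Rightarrow> track_letter \<Rightarrow> track_letter" where
  "add_track x a = (insert x (fst a), snd a)"

definition point_variant :: "nat \<Rightarrow> track_letter list \<Rightarrow> track_letter list \<Rightarrow> bool" where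
  "point_variant x u v \<longleftrightarrow> (\<exists>u1 a u2. u = u1 @ a # u2 \<and>
     v = map (drop_track x) u1 @ add_track x a # map (drop_track x) u2)"

lemma point_variant_append:
  "point_variant x (u @ u') v \<longleftrightarrow>
     (\<exists>v1. point_variant x u v1 \<and> v = v1 @ map (drop_track x) u') \<or>
     (\<exists>v2. point_variant x u' v2 \<and> v = map (drop_track x) u @ v2)"  (is "?L \<longleftrightarrow> ?A \<or> ?B")
proof
  assume ?L
  then obtain u1 a u2 where *: "u @ u' = u1 @ a # u2"
    "v = map (drop_track x) u1 @ add_track x a # map (drop_track x) u2"
    unfolding point_variant_def by blast
  then consider us where "u = u1 @ us" "us @ u' = a # u2" | us where "u @ us = u1" "u' = us @ a # u2"
    unfolding append_eq_append_conv2 by blast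
  then show "?A \<or> ?B"
  proof cases
    case 1
    show ?thesis
    proof (cases us)
      case Nil
      then have "?B" using 1 * unfolding point_variant_def by (intro exI[of _ "add_track x a # map (drop_track x) u2"])  fastforce
      then show ?thesis ..
    next
      case (Cons b us')
      then have "?A" using 1 * unfolding point_variant_def
        by (intro exI[of _ "map (drop_track x) u1 @ add_track x a # map (drop_track x) us'"]) fastforce
      then show ?thesis ..
    qed
  next
    case 2
    then have "?B" using * unfolding point_variant_def
      by (intro exI[of _ "map (drop_track x) us @ add_track x a # map (drop_track x) u2"]) fastforce
    then show ?thesis ..
  qed
next
  assume "?A \<or> ?B"
  then show ?L
  proof
    assume ?A
    then obtain v1 u1 a u2 where "v = v1 @ map (drop_track x) u'" "u = u1 @ a # u2"
      "v1 = map (drop_track x) u1 @ add_track x a # map (drop_track x) u2"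
      unfolding point_variant_def by blast
    then show ?thesis unfolding point_variant_def
      by (intro exI[of _ u1] exI[of _ a] exI[of _ "u2 @ u'"]) simp
  next
    assume ?B
    then obtain v2 u1 a u2 where "v = map (drop_track x) u @ v2" "u' = u1 @ a # u2"
      "v2 = map (drop_track x) u1 @ add_track x a # map (drop_track x) u2"
      unfolding point_variant_def by blast
    then show ?thesis unfolding point_variant_def
      by (intro exI[of _ "u @ u1"] exI[of _ a] exI[of _ u2]) simp
  qed
qed

text \<open>Exactly one segment contains the witness. The value therefore has two components:
  \<open>h0\<close> for a segment without the mark, and the set \<open>h1\<close> of possible values
  of a segment that carries it once. They compose according to whether the mark lies in the left or
  in the right factor.\<close>

lemma recognizable_Ex1:
  assumes "fin_cong h" "recognizes h \<phi>"
  shows "\<exists>h'. fin_cong h' \<and> recognizes h' (Ex1 x \<phi>)"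
proof -
  define h0 where "h0 u = h (map (drop_track x) u)" for u
  define h1 where "h1 u = {h v | v. point_variant x u v}" for u
  define g where "g u = (h0 u, h1 u)" for u
  have h1r: "range h1 \<subseteq> Pow (range h)" by (auto simp: h1_def)
  have h0r: "range h0 \<subseteq> range h" by (auto simp: h0_def)
  have fc: "fin_cong g"
  proof (rule fin_congI)
    have "range g \<subseteq> range h \<times> Pow (range h)" using h1r h0r by (auto simp: g_def)
    then show "finite (range g)"
      by (rule finite_subset) (simp add: fin_cong_finite[OF assms(1)])
    have *: "h1 (u @ v) \<subseteq> h1 (u' @ v')" if "g u = g u'" "g v = g v'" for u u' v v'
    proof
      fix y assume "y \<in> h1 (u @ v)"
      then consider (1) a where "y = h (a @ map (drop_track x) v)" "point_variant x u a"
        | (2) b where "y = h (map (drop_track x) u @ b)" "point_variant x v b"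
        unfolding h1_def point_variant_append by blast
      then show "y \<in> h1 (u' @ v')"
      proof cases
        case 1
        then have "h a \<in> h1 u" by (auto simp: h1_def)
        then have "h a \<in> h1 u'" using that by (simp add: g_def)
        then obtain a' where "h a = h a'" "point_variant x u' a'" by (auto simp: h1_def)
        moreover have "h (map (drop_track x) v) = h (map (drop_track x) v')"
          using that by (simp add: g_def h0_def)
        ultimately show ?thesis using 1 fin_congD[OF assms(1)]
          unfolding h1_def point_variant_append by blast
      next
        case 2
        then have "h b \<in> h1 v" by (auto simp: h1_def)
        then have "h b \<in> h1 v'" using that by (simp add: g_def)
        then obtain b' where "h b = h b'" "point_variant x v' b'" by (auto simp: h1_def)
        moreover have "h (map (drop_track x) u) = h (map (drop_track x) u')"
          using that by (simp add: g_def h0_def)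
        ultimately show ?thesis using 2 fin_congD[OF assms(1)]
          unfolding h1_def point_variant_append by blast
      qed
    qed
    show "g (u @ v) = g (u' @ v')" if "g u = g u'" "g v = g v'" for u u' v v'
    proof -
      have "h0 (u @ v) = h0 (u' @ v')"
        using that fin_congD[OF assms(1), of "map (drop_track x) u" "map (drop_track x) u'"]
        by (simp add: g_def h0_def)
      moreover have "h1 (u @ v) = h1 (u' @ v')"
        using *[OF that] *[OF that[symmetric]] by (rule subset_antisym)
      ultimately show ?thesis unfolding g_def by (rule arg_cong2)
    qed
  qed
  define f where "f = (\<lambda>(m, M). prod_encode (m, set_encode M))"
  have inj: "inj_on f (range g)"
  proof (rule inj_onI)
    fix p q assume "p \<in> range g" "q \<in> range g" "f p = f q"
    moreover have "finite (h1 u)" for u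
      using h1r fin_cong_finite[OF assms(1)] finite_subset[of "h1 u" "range h"] by blast
    ultimately show "p = q" by (auto simp: f_def g_def set_encode_eq)
  qed
  show ?thesis
  proof (rule recognizable_inj[OF fc inj])
    fix w :: "track_letter word" and u V P c and w' :: "track_letter word" and  u' V' P' c'
    assume C: "codes (Ex1 x \<phi>) w u V P" and C': "codes (Ex1 x \<phi>) w' u' V' P'"
      and fe: "factor_eq g w c w' c'" and s: "sat P u V (Ex1 x \<phi>)"
    then obtain n where n: "sat P (u(x := n)) V \<phi>" by auto
    define w1 where "w1 m = (if m = n then add_track x (w m) else drop_track x (w m))" for m
    have c1: "codes \<phi> w1 (u(x := n)) V P" using C
      by (auto simp: codes_def w1_def add_track_def drop_track_def)
    have c: "cuts c" "cuts c'" using fe by (auto simp: factor_eq_def)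
    obtain k where k: "c k \<le> n" "n < c (Suc k)" using cuts_segment[OF c(1)] by blast
    have segn: "map w1 [c i..<c (Suc i)] = map (drop_track x) (map w [c i..<c (Suc i)])" if "i \<noteq> k" for i
    proof -
      have "\<not> (c i \<le> n \<and> n < c (Suc i))" using that k cuts_segment[OF c(1), of n] by blast
      then show ?thesis by (auto simp: w1_def simp del: upt_Suc)
    qed
    have "[c k..<c (Suc k)] = [c k..<n] @ n # [Suc n..<c (Suc k)]"
      using k by (metis less_imp_le_nat upt_append upt_conv_Cons)
    then have "point_variant x (map w [c k..<c (Suc k)]) (map w1 [c k..<c (Suc k)])"
      unfolding point_variant_def
      by (intro exI[of _ "map w [c k..<n]"] exI[of _ "w n"] exI[of _ "map w [Suc n..<c (Suc k)]"])
        (simp add: w1_def)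
    then have "h (map w1 [c k..<c (Suc k)]) \<in> h1 (map w [c k..<c (Suc k)])" by (auto simp: h1_def)
    then have "h (map w1 [c k..<c (Suc k)]) \<in> h1 (map w' [c' k..<c' (Suc k)])"
      using fe by (simp add: factor_eq_def g_def)
    then obtain vk where vk: "point_variant x (map w' [c' k..<c' (Suc k)]) vk"
      "h vk = h (map w1 [c k..<c (Suc k)])" by (auto simp: h1_def)
    then obtain u1 a u2 where ua: "map w' [c' k..<c' (Suc k)] = u1 @ a # u2"
      "vk = map (drop_track x) u1 @ add_track x a # map (drop_track x) u2"
      unfolding point_variant_def by blast
    \<comment> \<open>The variant \<open>vk\<close> shows where the second word has to carry the
      mark within its k-th segment.\<close>
    define n' where "n' = c' k + length u1"
    have "length (map w' [c' k..<c' (Suc k)]) = length (u1 @ a # u2)" using ua(1) by (rule arg_cong)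
    then have n': "c' k \<le> n'" "n' < c' (Suc k)" by (auto simp: n'_def)
    define w1' where "w1' m = (if m = n' then add_track x (w' m) else drop_track x (w' m))" for m
    have c1': "codes \<phi> w1' (u'(x := n')) V' P'" using C'
      by (auto simp: codes_def w1'_def add_track_def drop_track_def)
    have segn': "map w1' [c' i..<c' (Suc i)] = map (drop_track x) (map w' [c' i..<c' (Suc i)])" if "i \<noteq> k" for i
    proof -
      have "\<not> (c' i \<le> n' \<and> n' < c' (Suc i))" using that n' cuts_segment[OF c(2), of n'] by blast
      then show ?thesis by (auto simp: w1'_def simp del: upt_Suc)
    qed
    have spl: "[c' k..<c' (Suc k)] = [c' k..<n'] @ n' # [Suc n'..<c' (Suc k)]"
      using n' by (metis less_imp_le_nat upt_append upt_conv_Cons)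
    then have "map w' [c' k..<n'] @ w' n' # map w' [Suc n'..<c' (Suc k)] = u1 @ a # u2"
      using ua(1) by (simp del: upt_Suc)
    moreover have "length (map w' [c' k..<n']) = length u1" by (simp add: n'_def)
    ultimately have "map w' [c' k..<n'] = u1" "w' n' = a" "map w' [Suc n'..<c' (Suc k)] = u2"
      by simp_all
    then have "map w1' [c' k..<c' (Suc k)] = vk"
      unfolding spl ua(2) by (auto simp: w1'_def)
    then have "h (map w1' [c' k..<c' (Suc k)]) = h (map w1 [c k..<c (Suc k)])" using vk(2) by simp
    moreover have "h (map w1' [c' i..<c' (Suc i)]) = h (map w1 [c i..<c (Suc i)])" if "i \<noteq> k" for i
      using fe that unfolding segn[OF that] segn'[OF that] by (simp add: factor_eq_def g_def h0_def del: map_map)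
    ultimately have "factor_eq h w1 c w1' c'" using c unfolding factor_eq_def by metis
    then have "sat P' (u'(x := n')) V' \<phi>" using assms(2) c1 c1' n unfolding recognizes_def by blast
    then show "sat P' u' V' (Ex1 x \<phi>)" by auto
  qed
qed

theorem recognizable: "\<exists>h. fin_cong h \<and> recognizes h \<phi>"
proof (induction \<phi>)
  case (Less x y)
  show ?case by (rule recognizable_Less)
next
  case (Eq x y)
  show ?case
  proof (rule recognizable_occurs[where p = "\<lambda>a. x \<in> fst a \<and> y \<in> fst a"])
    fix w u V P
    assume "codes (Eq x y) w u V P"
    then have "x \<in> fst (w n) \<longleftrightarrow> u x = n" "y \<in> fst (w n) \<longleftrightarrow> u y = n" for n
      by (auto simp: codes_def)
    then show "sat P u V (Eq x y) \<longleftrightarrow> (\<exists>n. x \<in> fst (w n) \<and> y \<in> fst (w n))" by auto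
  qed
next
  case (Mem x Z)
  show ?case
  proof (rule recognizable_occurs[where p = "\<lambda>a. x \<in> fst a \<and> Z \<in> fst (snd a)"])
    fix w u V P
    assume "codes (Mem x Z) w u V P"
    then have "x \<in> fst (w n) \<longleftrightarrow> u x = n" "Z \<in> fst (snd (w n)) \<longleftrightarrow> n \<in> V Z" for n
      by (auto simp: codes_def)
    then show "sat P u V (Mem x Z) \<longleftrightarrow> (\<exists>n. x \<in> fst (w n) \<and> Z \<in> fst (snd (w n)))" by auto
  qed
next
  case (Pred x)
  show ?case
  proof (rule recognizable_occurs[where p = "\<lambda>a. x \<in> fst a \<and> snd (snd a)"])
    fix w u V P
    assume "codes (Pred x) w u V P"
    then have "x \<in> fst (w n) \<longleftrightarrow> u x = n" "snd (snd (w n)) \<longleftrightarrow> n \<in> P" for n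
      by (auto simp: codes_def)
    then show "sat P u V (Pred x) \<longleftrightarrow> (\<exists>n. x \<in> fst (w n) \<and> snd (snd (w n)))" by auto
  qed
next
  case (Neg \<phi>)
  then show ?case using recognizable_Neg by blast
next
  case (And \<phi> \<psi>)
  then show ?case using recognizable_And by blast
next
  case (Ex1 x \<phi>)
  then show ?case using recognizable_Ex1 by blast
next
  case (Ex2 Z \<phi>)
  then show ?case using recognizable_Ex2 by blast
qed


section \<open>Determinization\<close>

text \<open>The min-odd parity condition and its dual. A sequence in which no value recurs is neither
  \<open>good\<close> nor \<open>bad\<close>.\<close>

definition good :: "(nat \<Rightarrow> nat) \<Rightarrow> bool" where
  "good \<kappa> \<longleftrightarrow> (\<exists>k. odd k \<and> (\<exists>\<^sub>\<infinity>n. \<kappa> n = k) \<and> (\<forall>\<^sub>\<infinity>n. k \<le> \<kappa> n))"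

definition bad :: "(nat \<Rightarrow> nat) \<Rightarrow> bool" where
  "bad \<kappa> \<longleftrightarrow> (\<exists>k. even k \<and> (\<exists>\<^sub>\<infinity>n. \<kappa> n = k) \<and> (\<forall>\<^sub>\<infinity>n. k \<le> \<kappa> n))"

lemma not_good_and_bad: "good \<kappa> \<Longrightarrow> \<not> bad \<kappa>"
  unfolding good_def bad_def
proof clarify
  fix k l assume *: "odd k" "\<exists>\<^sub>\<infinity>n. \<kappa> n = k" "\<forall>\<^sub>\<infinity>n. k \<le> \<kappa> n" "even l" "\<exists>\<^sub>\<infinity>n. \<kappa> n = l" "\<forall>\<^sub>\<infinity>n. l \<le> \<kappa> n"
  have "\<exists>\<^sub>\<infinity>n. \<kappa> n = k \<and> l \<le> \<kappa> n" "\<exists>\<^sub>\<infinity>n. \<kappa> n = l \<and> k \<le> \<kappa> n"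
    using * by (auto intro: INFM_conjI MOST_INFM)
  then have "k = l" by (auto dest!: INFM_EX)
  with * show False by simp
qed

text \<open>The limit is the least recurring value: it exists by boundedness, and each of the
  finitely many smaller values stops occurring.\<close>

lemma limit_priority:
  fixes \<kappa> :: "nat \<Rightarrow> nat"
  assumes "\<And>n. \<kappa> n \<le> b"
  obtains k where "\<exists>\<^sub>\<infinity>n. \<kappa> n = k" "\<forall>\<^sub>\<infinity>n. k \<le> \<kappa> n"
proof -
  have ex: "\<exists>k. \<exists>\<^sub>\<infinity>n. \<kappa> n = k"
  proof (rule ccontr)
    assume "\<not> ?thesis"
    then have "\<forall>\<^sub>\<infinity>n. \<forall>k\<in>{..b}. \<kappa> n \<noteq> k"
      by (subst eventually_ball_finite_distrib) (auto simp: not_INFM)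
    then have "\<exists>\<^sub>\<infinity>n. \<forall>k\<in>{..b}. \<kappa> n \<noteq> k" by (rule MOST_INFM[rotated]) simp
    then show False using assms by (auto dest!: INFM_EX)
  qed
  define k where "k = (LEAST k. \<exists>\<^sub>\<infinity>n. \<kappa> n = k)"
  have inf: "\<exists>\<^sub>\<infinity>n. \<kappa> n = k" unfolding k_def by (rule LeastI_ex[OF ex])
  have "\<forall>\<^sub>\<infinity>n. \<kappa> n \<noteq> j" if "j < k" for j
    using not_less_Least[OF that[unfolded k_def]] unfolding not_INFM .
  then have "\<forall>\<^sub>\<infinity>n. \<forall>j\<in>{..<k}. \<kappa> n \<noteq> j"
    by (subst eventually_ball_finite_distrib) simp_all
  then have "\<forall>\<^sub>\<infinity>n. k \<le> \<kappa> n" by (rule eventually_mono) (force simp: not_less[symmetric])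
  then show ?thesis using that inf by blast
qed

lemma good_or_bad: "(\<And>n. \<kappa> n \<le> (b :: nat)) \<Longrightarrow> good \<kappa> \<or> bad \<kappa>"
  unfolding good_def bad_def by (metis limit_priority)

section \<open>Merging classes of suffixes as data of a deterministic automaton\<close>

context
  fixes h :: "'a list \<Rightarrow> 'b" and acc :: "'b \<Rightarrow> 'b \<Rightarrow> bool"
begin

text \<open>Two positions of a finite word are merged when the suffixes starting there have the same
  image under \<open>h\<close>; \<open>reps\<close> are the least positions of the merging classes.\<close>

definition reps :: "'a list \<Rightarrow> nat set" where
  "reps u = {i. i < length u \<and> (\<forall>j<i. h (drop j u) \<noteq> h (drop i u))}"

definition seg :: "'a list \<Rightarrow> nat \<Rightarrow> nat \<Rightarrow> 'a list" where
  "seg u i j = take (j - i) (drop i u)"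

text \<open>The candidates are the old representatives and the new position \<open>length u\<close>;
  a new position that merges at once dies in the step in which it is born.\<close>

definition dies :: "'a list \<Rightarrow> 'a \<Rightarrow> nat \<Rightarrow> bool" where
  "dies u a i \<longleftrightarrow> i \<in> insert (length u) (reps u) \<and> i \<notin> reps (u @ [a])"

definition absorbs :: "'a list \<Rightarrow> 'a \<Rightarrow> nat \<Rightarrow> nat \<Rightarrow> bool" where
  "absorbs u a i j \<longleftrightarrow> i \<in> reps (u @ [a]) \<and> dies u a j \<and> i < j \<and>
     h (drop j (u @ [a])) = h (drop i (u @ [a]))"

definition idx :: "'a list \<Rightarrow> nat \<Rightarrow> nat" where
  "idx u i = card (reps u \<inter> {..<i})"

text \<open>Older positions have smaller rank \<open>idx\<close> and hence dominate. A death at rank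
  p emits the even priority 2p, since it shifts the ranks above it; an absorption at rank p whose
  prefix and segment values satisfy \<open>acc\<close> emits 2p + 1. Ranks are at most
  \<open>card (range h)\<close>, so the even default exceeds all of these, and a run in which
  nothing more happens is bad.\<close>

definition prio :: "'a list \<Rightarrow> 'a \<Rightarrow> nat" where
  "prio u a = Min (insert (2 * card (range h) + 2)
     ({2 * idx u i | i. dies u a i} \<union>
      {2 * idx u i + 1 | i. \<exists>j. absorbs u a i j \<and> acc (h (take i u)) (h (seg u i j))}))"

text \<open>Only values are stored, in the order of the representatives, and no positions; as there
  are boundedly many representatives, finitely many states result. Prefix and segment values serve
  \<open>acc\<close>, suffix values serve the merging.\<close>

definition state :: "'a list \<Rightarrow> ('b \<times> 'b \<times> 'b list) list" where
  "state u = (let xs = sorted_list_of_set (reps u) in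
     map (\<lambda>i. (h (take i u), h (drop i u), map (\<lambda>j. h (seg u i j)) xs)) xs)"

lemma finite_reps: "finite (reps u)"
  by (rule finite_subset[of _ "{..<length u}"]) (auto simp: reps_def)

lemma inj_on_reps: "inj_on (\<lambda>i. h (drop i u)) (reps u)"
  by (rule inj_onI) (metis (mono_tags, lifting) linorder_neqE_nat mem_Collect_eq reps_def)

lemma card_reps: "finite (range h) \<Longrightarrow> card (reps u) \<le> card (range h)"
  using card_image[OF inj_on_reps] card_mono[of "range h" "(\<lambda>i. h (drop i u)) ` reps u"] by auto

lemma finite_state:
  assumes "finite (range h)"
  shows "finite (range state)"
proof -
  let ?r = "range h" 
  let ?L = "{xs. set xs \<subseteq> ?r \<and> length xs \<le> card ?r}"
  let ?M = "{xs. set xs \<subseteq> ?r \<times> ?r \<times> ?L \<and> length xs \<le> card ?r}"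
  have "finite ?M" using assms by (intro finite_lists_length_le finite_cartesian_product)
  moreover have "state u \<in> ?M" for u
    using card_reps[OF assms, of u] by (auto simp: state_def Let_def finite_reps)
  ultimately show ?thesis by (meson finite_subset image_subsetI)
qed

text \<open>Candidates listed by rank. The next step is rephrased in terms of ranks, because ranks,
  unlike positions, can be read off the state.\<close>

definition cands :: "'a list \<Rightarrow> nat list" where
  "cands u = sorted_list_of_set (reps u) @ [length u]"

definition keeps :: "'a list \<Rightarrow> 'a \<Rightarrow> nat set" where
  "keeps u a = {p. p < length (cands u) \<and>
     (\<forall>q<p. h (drop (cands u ! q) (u @ [a])) \<noteq> h (drop (cands u ! p) (u @ [a])))}"

lemma set_cands: "set (cands u) = insert (length u) (reps u)"
  by (auto simp: cands_def finite_reps)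

lemma sorted_cands: "sorted_wrt (<) (cands u)"
  by (auto simp: cands_def sorted_wrt_append finite_reps reps_def)

lemma cands_le: "p < length (cands u) \<Longrightarrow> cands u ! p \<le> length u"
  using nth_mem[of p "cands u"] unfolding set_cands by (auto simp: reps_def)

lemma cands_less: "p < q \<Longrightarrow> q < length (cands u) \<Longrightarrow> cands u ! p < cands u ! q"
  using sorted_wrt_nth_less[OF sorted_cands] .

lemma cands_less_iff:
  "p < length (cands u) \<Longrightarrow> q < length (cands u) \<Longrightarrow> cands u ! p < cands u ! q \<longleftrightarrow> p < q"
  using cands_less[of p q] cands_less[of q p] by (metis less_asym' less_irrefl linorder_neqE_nat)

end

lemma fin_cong_drop:
  assumes "fin_cong h" "h (drop i u) = h (drop j u)" "i \<le> length u" "j \<le> length u"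
  shows "h (drop i (u @ v)) = h (drop j (u @ v))"
  using fin_congD[OF assms(1,2) refl, of v] assms(3,4) by simp

context
  fixes h :: "'a list \<Rightarrow> 'b" and acc :: "'b \<Rightarrow> 'b \<Rightarrow> bool"
  assumes fc: "fin_cong h"
begin

lemma ex_rep:
  assumes "i \<le> length u"
  shows "\<exists>j\<le>i. j \<in> insert (length u) (reps h u) \<and> (j = i \<or> h (drop j u) = h (drop i u))"
proof (cases "i = length u")
  case False
  define j where "j = (LEAST j. h (drop j u) = h (drop i u))"
  have "h (drop j u) = h (drop i u)" unfolding j_def by (rule LeastI[of _ i]) simp
  moreover have "j \<le> i" unfolding j_def by (rule Least_le) simp
  moreover have "h (drop l u) \<noteq> h (drop i u)" if "l < j" for l
    using that not_less_Least unfolding j_def by blast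
  ultimately show ?thesis using assms False by (intro exI[of _ j]) (auto simp: reps_def)
qed auto

text \<open>Merging is permanent under appending letters. Hence a position that is not a candidate
  cannot become a representative, and merging with any earlier position can be tested on candidates
  alone.\<close>

lemma reps_snoc:
  "reps h (u @ [a]) = {i \<in> insert (length u) (reps h u). \<forall>j\<in>insert (length u) (reps h u).
     j < i \<longrightarrow> h (drop j (u @ [a])) \<noteq> h (drop i (u @ [a]))}" (is "?L = ?R")
proof (intro set_eqI iffI)
  fix i assume i: "i \<in> ?L"
  have "i \<in> insert (length u) (reps h u)"
  proof (rule ccontr)
    assume n: "i \<notin> insert (length u) (reps h u)"
    then have "i < length u" using i by (auto simp: reps_def)
    then obtain j where "j < i" "h (drop j u) = h (drop i u)" using n by (auto simp: reps_def)
    then have "h (drop j (u @ [a])) = h (drop i (u @ [a]))"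
      using \<open>i < length u\<close> by (intro fin_cong_drop[OF fc]) simp_all
    then show False using i \<open>j < i\<close> by (auto simp: reps_def)
  qed
  then show "i \<in> ?R" using i by (auto simp: reps_def)
next
  fix i assume i: "i \<in> ?R"
  have "h (drop j (u @ [a])) \<noteq> h (drop i (u @ [a]))" if "j < i" for j
  proof -
    have il: "i \<le> length u" using i by (auto simp: reps_def)
    with that obtain j' where j': "j' \<le> j" "j' \<in> insert (length u) (reps h u)"
        "j' = j \<or> h (drop j' u) = h (drop j u)" using ex_rep[of j u] by auto
    then have "h (drop j' (u @ [a])) = h (drop j (u @ [a]))"
      using il that fin_cong_drop[OF fc, of j' u j "[a]"] by (elim disjE) simp_all
    moreover have "h (drop j' (u @ [a])) \<noteq> h (drop i (u @ [a]))" using i j' that by auto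
    ultimately show ?thesis by simp
  qed
  then show "i \<in> ?L" using i by (auto simp: reps_def)
qed

lemma in_reps_snoc:
  assumes "p < length (cands h u)"
  shows "cands h u ! p \<in> reps h (u @ [a]) \<longleftrightarrow> p \<in> keeps h u a"
proof -
  have "(\<forall>j\<in>set (cands h u). j < cands h u ! p \<longrightarrow> f j) \<longleftrightarrow> (\<forall>q<p. f (cands h u ! q))" for f
    using assms by (auto simp: all_set_conv_all_nth cands_less_iff)
  then show ?thesis using assms unfolding reps_snoc keeps_def set_cands[symmetric] by simp
qed

lemma sorted_reps_snoc:
  "sorted_list_of_set (reps h (u @ [a])) =
     map ((!) (cands h u)) (filter (\<lambda>p. p \<in> keeps h u a) [0..<length (cands h u)])"
proof (rule strict_sorted_equal)
  let ?ps = "filter (\<lambda>p. p \<in> keeps h u a) [0..<length (cands h u)]"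
  show "sorted_wrt (<) (map ((!) (cands h u)) ?ps)"
    unfolding sorted_wrt_map
    by (rule sorted_wrt_mono_rel[where P = "(<)"]) (auto simp: cands_less intro: sorted_wrt_filter)
  have "set (map ((!) (cands h u)) ?ps) = reps h (u @ [a])"
  proof (intro set_eqI iffI)
    fix i assume "i \<in> set (map ((!) (cands h u)) ?ps)"
    then show "i \<in> reps h (u @ [a])" by (auto simp: in_reps_snoc)
  next
    fix i assume i: "i \<in> reps h (u @ [a])"
    then have "i \<in> set (cands h u)" unfolding set_cands reps_snoc by blast
    then obtain p where "p < length (cands h u)" "i = cands h u ! p" by (auto simp: in_set_conv_nth)
    then show "i \<in> set (map ((!) (cands h u)) ?ps)" using i by (auto simp: in_reps_snoc)
  qed
  then show "set (sorted_list_of_set (reps h (u @ [a]))) = set (map ((!) (cands h u)) ?ps)"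
    by (simp add: finite_reps)
qed (simp add: finite_reps)

lemma idx_cands:
  assumes "p < length (cands h u)"
  shows "idx h u (cands h u ! p) = p"
proof -
  have "reps h u \<inter> {..<cands h u ! p} = (!) (cands h u) ` {..<p}"
  proof (intro set_eqI iffI)
    fix i assume i: "i \<in> reps h u \<inter> {..<cands h u ! p}"
    then have "i \<in> set (cands h u)" unfolding set_cands by blast
    then obtain q where q: "q < length (cands h u)" "i = cands h u ! q" by (auto simp: in_set_conv_nth)
    then have "q < p" using i assms cands_less_iff[of q h u p] by auto
    then show "i \<in> (!) (cands h u) ` {..<p}" using q by auto
  next
    fix i assume "i \<in> (!) (cands h u) ` {..<p}"
    then obtain q where q: "q < p" "i = cands h u ! q" by auto
    then have "i < cands h u ! p" using cands_less assms by blast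
    moreover have "i \<in> insert (length u) (reps h u)" using q assms nth_mem[of q "cands h u"] set_cands by fastforce
    ultimately show "i \<in> reps h u \<inter> {..<cands h u ! p}" using cands_le[OF assms] by auto
  qed
  moreover have "inj_on ((!) (cands h u)) {..<p}"
    using assms cands_less[of _ _ h u] by (intro linorder_inj_onI') fastforce
  ultimately show ?thesis by (simp add: idx_def card_image)
qed

lemma dies_iff: "dies h u a i \<longleftrightarrow> (\<exists>p<length (cands h u). i = cands h u ! p \<and> p \<notin> keeps h u a)"
  unfolding dies_def set_cands[symmetric] using in_reps_snoc by (metis in_set_conv_nth)

lemma prio_index:
  "prio h acc u a = Min (insert (2 * card (range h) + 2)
     ({2 * p | p. p < length (cands h u) \<and> p \<notin> keeps h u a} \<union>
      {2 * p + 1 | p. p \<in> keeps h u a \<and> (\<exists>q < length (cands h u). q \<notin> keeps h u a \<and> p < q \<and>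
         h (drop (cands h u ! q) (u @ [a])) = h (drop (cands h u ! p) (u @ [a])) \<and>
         acc (h (take (cands h u ! p) u)) (h (seg u (cands h u ! p) (cands h u ! q))))}))"
proof -
  have 1: "{2 * idx h u i | i. dies h u a i} = {2 * p | p. p < length (cands h u) \<and> p \<notin> keeps h u a}"
    unfolding dies_iff using idx_cands by force
  have ab: "absorbs h u a i j \<longleftrightarrow> (\<exists>p q. i = cands h u ! p \<and> j = cands h u ! q \<and> p \<in> keeps h u a \<and>
      q < length (cands h u) \<and> q \<notin> keeps h u a \<and> p < q \<and>
      h (drop (cands h u ! q) (u @ [a])) = h (drop (cands h u ! p) (u @ [a])))" for i j
  proof
    assume A: "absorbs h u a i j"
    then have "i \<in> set (cands h u)" unfolding absorbs_def reps_snoc set_cands by blast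
    then obtain p where p: "p < length (cands h u)" "i = cands h u ! p" by (auto simp: in_set_conv_nth)
    then have "p \<in> keeps h u a" using A in_reps_snoc by (auto simp: absorbs_def)
    moreover obtain q where q: "q < length (cands h u)" "j = cands h u ! q" "q \<notin> keeps h u a"
      using A by (auto simp: absorbs_def dies_iff)
    moreover have "p < q" using A p q by (auto simp: absorbs_def cands_less_iff)
    ultimately show "\<exists>p q. i = cands h u ! p \<and> j = cands h u ! q \<and> p \<in> keeps h u a \<and>
      q < length (cands h u) \<and> q \<notin> keeps h u a \<and> p < q \<and>
      h (drop (cands h u ! q) (u @ [a])) = h (drop (cands h u ! p) (u @ [a]))"
      using A p by (intro exI[of _ p] exI[of _ q]) (auto simp: absorbs_def)
  next
    assume "\<exists>p q. i = cands h u ! p \<and> j = cands h u ! q \<and> p \<in> keeps h u a \<and>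
      q < length (cands h u) \<and> q \<notin> keeps h u a \<and> p < q \<and>
      h (drop (cands h u ! q) (u @ [a])) = h (drop (cands h u ! p) (u @ [a]))"
    then obtain p q where *: "i = cands h u ! p" "j = cands h u ! q" "p \<in> keeps h u a"
      "q < length (cands h u)" "q \<notin> keeps h u a" "p < q"
      "h (drop (cands h u ! q) (u @ [a])) = h (drop (cands h u ! p) (u @ [a]))" by blast
    then show "absorbs h u a i j" unfolding absorbs_def dies_iff
      using in_reps_snoc[of p u a] cands_less[of p q h u] by auto
  qed
  have 2: "{2 * idx h u i + 1 | i. \<exists>j. absorbs h u a i j \<and> acc (h (take i u)) (h (seg u i j))} =
    {2 * p + 1 | p. p \<in> keeps h u a \<and> (\<exists>q < length (cands h u). q \<notin> keeps h u a \<and> p < q \<and>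
         h (drop (cands h u ! q) (u @ [a])) = h (drop (cands h u ! p) (u @ [a])) \<and>
         acc (h (take (cands h u ! p) u)) (h (seg u (cands h u ! p) (cands h u ! q))))}"
    (is "?A = ?B")
  proof (intro set_eqI iffI)
    fix n assume "n \<in> ?A"
    then obtain p q where "n = 2 * idx h u (cands h u ! p) + 1" "p \<in> keeps h u a" "q < length (cands h u)"
      "q \<notin> keeps h u a" "p < q" "h (drop (cands h u ! q) (u @ [a])) = h (drop (cands h u ! p) (u @ [a]))"
      "acc (h (take (cands h u ! p) u)) (h (seg u (cands h u ! p) (cands h u ! q)))"
      unfolding ab by blast
    moreover then have "idx h u (cands h u ! p) = p" by (intro idx_cands) simp
    ultimately show "n \<in> ?B" by auto
  next
    fix n assume "n \<in> ?B"
    then obtain p q where *: "n = 2 * p + 1" "p \<in> keeps h u a" "q < length (cands h u)"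
      "q \<notin> keeps h u a" "p < q" "h (drop (cands h u ! q) (u @ [a])) = h (drop (cands h u ! p) (u @ [a]))"
      "acc (h (take (cands h u ! p) u)) (h (seg u (cands h u ! p) (cands h u ! q)))"
      by blast
    then have "idx h u (cands h u ! p) = p" by (intro idx_cands) simp
    moreover have "absorbs h u a (cands h u ! p) (cands h u ! q)"
      unfolding ab using * by blast
    ultimately show "n \<in> ?A" using *(1,7) by (intro CollectI exI[of _ "cands h u ! p"]) auto
  qed
  show ?thesis unfolding prio_def 1 2 ..
qed

lemma state_data:
  assumes "state h u = state h v"
  shows "length (cands h u) = length (cands h v)"
    "\<And>p. p < length (cands h u) \<Longrightarrow> h (take (cands h u ! p) u) = h (take (cands h v ! p) v)"
    "\<And>p. p < length (cands h u) \<Longrightarrow> 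
       h (drop (cands h u ! p) (u @ [a])) = h (drop (cands h v ! p) (v @ [a]))"
    "\<And>p q. p < length (cands h u) \<Longrightarrow> q < length (cands h u) \<Longrightarrow>
       h (seg u (cands h u ! p) (cands h u ! q)) = h (seg v (cands h v ! p) (cands h v ! q))"
proof -
  define xs where "xs = sorted_list_of_set (reps h u)"
  define ys where "ys = sorted_list_of_set (reps h v)"
  let ?n = "length xs"
  have st: "map (\<lambda>i. (h (take i u), h (drop i u), map (\<lambda>j. h (seg u i j)) xs)) xs =
     map (\<lambda>i. (h (take i v), h (drop i v), map (\<lambda>j. h (seg v i j)) ys)) ys"
    using assms by (simp add: state_def Let_def xs_def ys_def)
  from arg_cong[OF st, of length] have len: "length ys = ?n" by simp
  have row: "h (take (xs ! p) u) = h (take (ys ! p) v) \<and> h (drop (xs ! p) u) = h (drop (ys ! p) v) \<and>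
     map (\<lambda>j. h (seg u (xs ! p) j)) xs = map (\<lambda>j. h (seg v (ys ! p) j)) ys" if "p < ?n" for p
    using arg_cong[OF st, of "\<lambda>l. l ! p"] that len by simp
  have ent: "h (seg u (xs ! p) (xs ! q)) = h (seg v (ys ! p) (ys ! q))" if "p < ?n" "q < ?n" for p q
  proof -
    have "map (\<lambda>j. h (seg u (xs ! p) j)) xs ! q = map (\<lambda>j. h (seg v (ys ! p) j)) ys ! q"
      using row[OF that(1)] by simp
    then show ?thesis using that len by simp
  qed
  have cu: "cands h u = xs @ [length u]" and cv: "cands h v = ys @ [length v]"
    by (simp_all add: cands_def xs_def ys_def)
  have lc: "length (cands h u) = length (cands h v)" by (simp add: cu cv len)
  \<comment> \<open>\<open>h u\<close> is needed as the prefix value of the new candidate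
    \<open>length u\<close> but is not stored as such: it is the suffix value of position 0, the
    first representative of any nonempty word.\<close>
  have huv: "h u = h v"
  proof (cases "u = []")
    case True
    then have "xs = []" by (simp add: xs_def reps_def)
    then have "reps h v = {}" using len by (simp add: ys_def finite_reps)
    then have "v = []" by (cases v) (auto simp: reps_def)
    then show ?thesis using True by simp
  next
    case False
    then have z: "0 \<in> reps h u" by (simp add: reps_def)
    then have "xs \<noteq> []" by (auto simp: xs_def finite_reps)
    then have "ys \<noteq> []" using len by auto
    then have "v \<noteq> []" by (auto simp: ys_def reps_def)
    then have z': "0 \<in> reps h v" by (simp add: reps_def)
    have "sorted_list_of_set A ! 0 = 0" if "0 \<in> A" "finite A" for A :: "nat set"
    proof -
      have "A \<noteq> {}" "Min A = 0" using that Min_le[of A 0] by auto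
      then show ?thesis using that(2) sorted_list_of_set_nonempty[of A] by simp
    qed
    then have "xs ! 0 = 0" "ys ! 0 = 0"
      using z z' finite_reps unfolding xs_def ys_def by blast+
    then show ?thesis using row[of 0] \<open>xs \<noteq> []\<close> by simp
  qed
  have c2: "h (take (cands h u ! p) u) = h (take (cands h v ! p) v)" if "p < length (cands h u)" for p
    using that row[of p] huv len by (cases "p = ?n") (auto simp: cu cv nth_append)
  have c3: "h (drop (cands h u ! p) (u @ [a])) = h (drop (cands h v ! p) (v @ [a]))"
    if "p < length (cands h u)" for p
  proof (cases "p = ?n")
    case False
    then have p: "p < ?n" using that by (simp add: cu)
    then have "xs ! p \<in> set xs" "ys ! p \<in> set ys" using len by auto
    then have "xs ! p \<le> length u" "ys ! p \<le> length v" by (auto simp: xs_def ys_def finite_reps reps_def)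
    then show ?thesis using p len row[OF p] fin_congD[OF fc _ refl, of "drop (xs ! p) u" "drop (ys ! p) v" "[a]"]
      by (simp add: cu cv nth_append)
  qed (use len in \<open>simp add: cu cv nth_append\<close>)
  have c4: "h (seg u (cands h u ! p) (cands h u ! q)) = h (seg v (cands h v ! p) (cands h v ! q))"
    if "p < length (cands h u)" "q < length (cands h u)" for p q
  proof (cases "q \<le> p")
    \<comment> \<open>Here both segments are empty, by truncated subtraction in
      \<open>seg\<close>.\<close>
    case True
    then have "cands h u ! q \<le> cands h u ! p" "cands h v ! q \<le> cands h v ! p"
      using that lc cands_less[of q p h u] cands_less[of q p h v] by (cases "q = p"; simp)+
    then show ?thesis by (simp add: seg_def)
  next
    case False
    then have p: "p < ?n" using that by (simp add: cu)
    show ?thesis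
    proof (cases "q = ?n")
      case True
      then show ?thesis using p len row[OF p] by (simp add: cu cv nth_append seg_def)
    next
      case False
      then show ?thesis using that p len ent by (simp add: cu cv nth_append)
    qed
  qed
  show "length (cands h u) = length (cands h v)" by (rule lc)
  show "\<And>p. p < length (cands h u) \<Longrightarrow> h (take (cands h u ! p) u) = h (take (cands h v ! p) v)"
    by (rule c2)
  show "\<And>p. p < length (cands h u) \<Longrightarrow>
       h (drop (cands h u ! p) (u @ [a])) = h (drop (cands h v ! p) (v @ [a]))" by (rule c3)
  show "\<And>p q. p < length (cands h u) \<Longrightarrow> q < length (cands h u) \<Longrightarrow>
       h (seg u (cands h u ! p) (cands h u ! q)) = h (seg v (cands h v ! p) (cands h v ! q))" by (rule c4)
qed

lemma seg_snoc: "j \<le> length u \<Longrightarrow> seg (u @ [a]) i j = seg u i j"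
  by (cases "i \<le> length u") (auto simp: seg_def)

lemma state_step:
  assumes "state h u = state h v"
  shows "state h (u @ [a]) = state h (v @ [a])" "prio h acc u a = prio h acc v a"
proof -
  note d = state_data[OF assms]
  have k: "keeps h u a = keeps h v a"
  proof (rule set_eqI)
    fix p
    show "p \<in> keeps h u a \<longleftrightarrow> p \<in> keeps h v a"
    proof (cases "p < length (cands h u)")
      case True
      then have "(\<forall>q<p. h (drop (cands h u ! q) (u @ [a])) \<noteq> h (drop (cands h u ! p) (u @ [a]))) \<longleftrightarrow>
          (\<forall>q<p. h (drop (cands h v ! q) (v @ [a])) \<noteq> h (drop (cands h v ! p) (v @ [a])))"
        by (simp add: d(3) del: drop_append)
      then show ?thesis using True d(1) by (simp add: keeps_def)
    qed (use d(1) in \<open>simp add: keeps_def\<close>)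
  qed
  let ?ps = "filter (\<lambda>p. p \<in> keeps h u a) [0..<length (cands h u)]"
  have xs: "sorted_list_of_set (reps h (u @ [a])) = map ((!) (cands h u)) ?ps"
     "sorted_list_of_set (reps h (v @ [a])) = map ((!) (cands h v)) ?ps"
    by (simp_all add: sorted_reps_snoc d(1) k)
  have "h (take (cands h u ! p) (u @ [a])) = h (take (cands h v ! p) (v @ [a]))"
    if "p < length (cands h u)" for p
    using d(2)[OF that] cands_le[of p h u] cands_le[of p h v] that d(1) by simp
  moreover have "h (seg (u @ [a]) (cands h u ! p) (cands h u ! q)) = h (seg (v @ [a]) (cands h v ! p) (cands h v ! q))"
    if "p < length (cands h u)" "q < length (cands h u)" for p q
    using d(4)[OF that] that d(1) by (simp add: seg_snoc cands_le)
  ultimately show "state h (u @ [a]) = state h (v @ [a])"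
    unfolding state_def Let_def xs by (auto simp: d(3) simp del: drop_append take_append)
  have c: "p < length (cands h u)" if "p \<in> keeps h u a" for p using that by (simp add: keeps_def)
  have "{2 * p + 1 | p. p \<in> keeps h u a \<and> (\<exists>q < length (cands h u). q \<notin> keeps h u a \<and> p < q \<and>
         h (drop (cands h u ! q) (u @ [a])) = h (drop (cands h u ! p) (u @ [a])) \<and>
         acc (h (take (cands h u ! p) u)) (h (seg u (cands h u ! p) (cands h u ! q))))} =
     {2 * p + 1 | p. p \<in> keeps h u a \<and> (\<exists>q < length (cands h u). q \<notin> keeps h u a \<and> p < q \<and>
         h (drop (cands h v ! q) (v @ [a])) = h (drop (cands h v ! p) (v @ [a])) \<and>
         acc (h (take (cands h v ! p) v)) (h (seg v (cands h v ! p) (cands h v ! q))))}"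
    by (intro Collect_cong ex_cong conj_cong refl) (simp_all add: c d(2,3,4) del: drop_append)
  then show "prio h acc u a = prio h acc v a"
    unfolding prio_index k[symmetric] d(1)[symmetric] by simp
qed

end


section \<open>Ramsey's theorem and correctness of the parity condition\<close>

lemma ramsey_pairs:
  fixes g :: "nat \<Rightarrow> nat \<Rightarrow> 'b"
  assumes "finite (range (\<lambda>(i, j). g i j))"
  shows "\<exists>Y t. infinite Y \<and> (\<forall>i\<in>Y. \<forall>j\<in>Y. i < j \<longrightarrow> g i j = t)"
proof -
  obtain c :: "'b \<Rightarrow> nat" and n where c: "c ` range (\<lambda>(i, j). g i j) = {i. i < n}"
    "inj_on c (range (\<lambda>(i, j). g i j))"
    using finite_imp_inj_to_nat_seg[OF assms] by blast
  define f where "f S = c (g (Min S) (Max S))" for S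
  have lt: "c (g i j) < n" for i j
  proof -
    have "c (g i j) \<in> c ` range (\<lambda>(i, j). g i j)" by (rule imageI) (auto intro: range_eqI[of _ _ "(i, j)"])
    then show ?thesis unfolding c(1) by simp
  qed
  have "\<exists>Y t. Y \<subseteq> UNIV \<and> infinite Y \<and> t < n \<and> (\<forall>x\<in>Y. \<forall>y\<in>Y. x \<noteq> y \<longrightarrow> f {x, y} = t)"
    by (rule Ramsey2) (auto simp: f_def lt)
  then obtain Y t where Y: "infinite Y" "\<forall>x\<in>Y. \<forall>y\<in>Y. x \<noteq> y \<longrightarrow> f {x, y} = t" by blast
  obtain i0 where i0: "i0 \<in> Y" using Y(1) infinite_imp_nonempty by blast
  obtain j0 where j0: "j0 \<in> Y" "i0 < j0" using Y(1) infinite_nat_iff_unbounded by blast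
  have cg: "c (g i j) = t" if "i \<in> Y" "j \<in> Y" "i < j" for i j
    using Y(2) that by (force simp: f_def)
  have "g i j = g i0 j0" if "i \<in> Y" "j \<in> Y" "i < j" for i j
    using cg[OF that] cg[OF i0 j0] by (intro inj_onD[OF c(2)]) (auto intro: range_eqI[of _ _ "(_, _)"])
  then show ?thesis using Y(1) by blast
qed

lemma INFM_ge: "(\<exists>\<^sub>\<infinity>k. P k) \<Longrightarrow> \<exists>\<^sub>\<infinity>k. (n::nat) \<le> k \<and> P k"
  unfolding INFM_nat_le by (metis le_trans nat_le_linear)

context
  fixes h :: "'a list \<Rightarrow> 'b" and L :: "'a word \<Rightarrow> bool"
  assumes fc: "fin_cong h"
    and sat: "\<And>w w' c c'. factor_eq h w c w' c' \<Longrightarrow> L w \<Longrightarrow> L w'"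
begin

text \<open>Some word of L factors as a prefix of value s followed by segments of value f for ever.
  By saturation every word with such a factorization then lies in L, so membership is a property of
  the pair of values.\<close>

definition acc :: "'b \<Rightarrow> 'b \<Rightarrow> bool" where
  "acc s f \<longleftrightarrow> (\<exists>v c. L v \<and> strict_mono c \<and> h (map v [0..<c 0]) = s \<and>
     (\<forall>i. h (map v [c i..<c (Suc i)]) = f))"

lemma acc_sound:
  assumes "acc (h (map w [0..<d 0])) f" "strict_mono d" "\<And>i. h (map w [d i..<d (Suc i)]) = f"
  shows "L w"
proof -
  obtain v c where v: "L v" "strict_mono c" "h (map v [0..<c 0]) = h (map w [0..<d 0])"
     "\<And>i. h (map v [c i..<c (Suc i)]) = f" using assms(1) unfolding acc_def by blast
  \<comment> \<open>\<open>c 0\<close> may be 0, whereas cut sequences increase strictly from 0; the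
    prefix is therefore joined with the first segment.\<close>
  define c' where "c' i = (if i = 0 then 0 else c i)" for i
  define d' where "d' i = (if i = 0 then 0 else d i)" for i
  have pos: "c i < c (Suc i)" "d i < d (Suc i)" for i using v(2) assms(2) by (auto simp: strict_mono_Suc_iff)
  have "strict_mono c'" "strict_mono d'" unfolding strict_mono_Suc_iff c'_def d'_def
    using pos le_less_trans[OF le0 pos(1)[of 0]] le_less_trans[OF le0 pos(2)[of 0]] by auto
  then have cu: "cuts c'" "cuts d'" by (auto simp: cuts_def c'_def d'_def)
  have "h (map v [c' i..<c' (Suc i)]) = h (map w [d' i..<d' (Suc i)])" for i
  proof (cases i)
    case 0
    have "[0..<c (Suc 0)] = [0..<c 0] @ [c 0..<c (Suc 0)]" "[0..<d (Suc 0)] = [0..<d 0] @ [d 0..<d (Suc 0)]"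
      using pos[of 0] by (simp_all add: upt_append del: upt_Suc)
    then show ?thesis
      using fin_congD[OF fc v(3), of "map v [c 0..<c (Suc 0)]" "map w [d 0..<d (Suc 0)]"] v(4)[of 0] assms(3)[of 0] 0
      by (simp add: c'_def d'_def del: upt_Suc)
  next
    case (Suc n)
    then show ?thesis using v(4)[of i] assms(3)[of i] by (simp add: c'_def d'_def)
  qed
  then show ?thesis using sat v(1) cu unfolding factor_eq_def by blast
qed

context
  fixes w :: "'a word"
begin

private abbreviation (input) H :: "nat \<Rightarrow> nat \<Rightarrow> 'b" where "H i j \<equiv> h (map w [i..<j])"
private abbreviation (input) pre :: "nat \<Rightarrow> 'a list" where "pre k \<equiv> map w [0..<k]"
private abbreviation (input) R :: "nat \<Rightarrow> nat set" where "R k \<equiv> reps h (pre k)"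
private abbreviation (input) Dies :: "nat \<Rightarrow> nat \<Rightarrow> bool" where "Dies k \<equiv> dies h (pre k) (w k)"
private abbreviation (input) Abs :: "nat \<Rightarrow> nat \<Rightarrow> nat \<Rightarrow> bool" where "Abs k \<equiv> absorbs h (pre k) (w k)"

text \<open>By \<open>H_ext\<close>, two positions that have merged stay merged, so this is an
  equivalence on the positions of the infinite word.\<close>

definition merge :: "nat \<Rightarrow> nat \<Rightarrow> bool" where
  "merge i j \<longleftrightarrow> (\<exists>k. i \<le> k \<and> j \<le> k \<and> H i k = H j k)"

lemma R_iff: "i \<in> R k \<longleftrightarrow> i < k \<and> (\<forall>j<i. H j k \<noteq> H i k)"
  by (auto simp: reps_def drop_map)

lemma H_ext:
  assumes "H i k = H j k" "i \<le> k" "j \<le> k" "k \<le> l"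
  shows "H i l = H j l"
proof -
  have "[i..<l] = [i..<k] @ [k..<l]" "[j..<l] = [j..<k] @ [k..<l]"
    using assms by (simp_all add: upt_append)
  then show ?thesis using fin_congD[OF fc assms(1) refl, of "map w [k..<l]"] by simp
qed

lemma R_anti:
  assumes "i \<in> R l" "i < k" "k \<le> l"
  shows "i \<in> R k"
proof -
  have "H j k \<noteq> H i k" if "j < i" for j
    using H_ext[of j k i l] that assms by (auto simp: R_iff)
  then show ?thesis using assms(2) by (simp add: R_iff)
qed

lemma Dies_iff: "Dies k i \<longleftrightarrow> (i = k \<or> i \<in> R k) \<and> i \<notin> R (Suc k)"
  by (simp add: dies_def)

lemma Abs_iff: "Abs k i j \<longleftrightarrow> i \<in> R (Suc k) \<and> Dies k j \<and> i < j \<and> H j (Suc k) = H i (Suc k)"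
proof -
  have "drop i (pre k @ [w k]) = map w [i..<Suc k]" for i
  proof -
    have "pre k @ [w k] = map w [0..<Suc k]" by simp
    then show ?thesis by (simp only: drop_map drop_upt) simp
  qed
  moreover have "pre k @ [w k] = pre (Suc k)" by simp
  ultimately show ?thesis unfolding absorbs_def by (simp del: upt_Suc)
qed

lemma Dies_le: "Dies k i \<Longrightarrow> i \<le> k"
  by (auto simp: Dies_iff R_iff)

lemma Dies_once: "Dies k i \<Longrightarrow> Dies l i \<Longrightarrow> k = l"
proof (induction k l rule: linorder_wlog)
  case (le k l)
  show ?case
  proof (rule ccontr)
    assume "k \<noteq> l"
    with le have "Suc k \<le> l" by simp
    then have "i \<in> R l" "i < Suc k" using le Dies_le[of k i] by (auto simp: Dies_iff)
    then have "i \<in> R (Suc k)" using \<open>Suc k \<le> l\<close> R_anti by blast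
    then show False using le by (simp add: Dies_iff)
  qed
qed auto

lemma merge_sym: "merge i j \<Longrightarrow> merge j i"
  unfolding merge_def by metis

lemma merge_trans: "merge i j \<Longrightarrow> merge j l \<Longrightarrow> merge i l"
proof -
  assume "merge i j" "merge j l"
  then obtain k m where *: "i \<le> k" "j \<le> k" "H i k = H j k" "j \<le> m" "l \<le> m" "H j m = H l m"
    unfolding merge_def by blast
  have "H i (max k m) = H j (max k m)" by (rule H_ext[OF *(3,1,2)]) simp
  moreover have "H j (max k m) = H l (max k m)" by (rule H_ext[OF *(6,4,5)]) simp
  ultimately show ?thesis unfolding merge_def using * by (intro exI[of _ "max k m"]) auto
qed

text \<open>The next position is chosen beyond the time at which the current one has merged with
  \<rho>. From that time on segments starting at either have the same value, so the value f seen
  from \<rho> is also seen from the current position.\<close>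

lemma merging_sequence:
  assumes "\<And>m. \<exists>j>m. H \<rho> j = f \<and> merge j \<rho>"
  obtains c where "strict_mono c" "c 0 = \<rho>" "\<And>i. H (c i) (c (Suc i)) = f"
proof -
  have "\<exists>c. \<forall>n. ((n = 0 \<longrightarrow> c n = \<rho>) \<and> merge (c n) \<rho>) \<and> (c n < c (Suc n) \<and> H (c n) (c (Suc n)) = f)"
  proof (rule dependent_nat_choice)
    show "\<exists>x. (0 = 0 \<longrightarrow> x = \<rho>) \<and> merge x \<rho>" by (auto simp: merge_def)
    fix x and n :: nat assume "(n = 0 \<longrightarrow> x = \<rho>) \<and> merge x \<rho>"
    then obtain k where k: "x \<le> k" "\<rho> \<le> k" "H x k = H \<rho> k" by (auto simp: merge_def)
    obtain j where j: "j > k" "H \<rho> j = f" "merge j \<rho>" using assms by blast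
    then have "H x j = f" using H_ext[OF k(3,1,2), of j] by simp
    then show "\<exists>y. ((Suc n = 0 \<longrightarrow> y = \<rho>) \<and> merge y \<rho>) \<and> (x < y \<and> H x y = f)"
      using j k by (intro exI[of _ j]) auto
  qed
  then obtain c where c: "\<And>n. ((n = 0 \<longrightarrow> c n = \<rho>) \<and> merge (c n) \<rho>) \<and> (c n < c (Suc n) \<and> H (c n) (c (Suc n)) = f)"
    by blast
  then have "strict_mono c" by (simp add: strict_mono_Suc_iff)
  with c that show ?thesis by blast
qed

text \<open>Each position dies at most once, so infinitely many absorptions by \<rho> involve
  arbitrarily late positions, all of which have merged with \<rho>.\<close>

lemma absorbing_sequence:
  assumes "\<exists>\<^sub>\<infinity>k. \<exists>j. Abs k \<rho> j \<and> H \<rho> j = f"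
  obtains c where "strict_mono c" "c 0 = \<rho>" "\<And>i. H (c i) (c (Suc i)) = f"
proof (rule merging_sequence)
  fix m
  have "finite {k. Dies k j}" for j
  proof (cases "\<exists>k. Dies k j")
    case True
    then obtain k where "Dies k j" by blast
    then have "{k. Dies k j} = {k}" using Dies_once by blast
    then show ?thesis by simp
  qed simp
  then have "finite (\<Union>j\<le>m. {k. Dies k j})" by simp
  then have "\<forall>\<^sub>\<infinity>k. \<not> (\<exists>j\<le>m. Dies k j)" 
    by (auto simp: eventually_cofinite elim!: finite_subset[rotated])
  with assms have "\<exists>\<^sub>\<infinity>k. (\<exists>j. Abs k \<rho> j \<and> H \<rho> j = f) \<and> \<not> (\<exists>j\<le>m. Dies k j)"
    by (rule INFM_conjI)
  then obtain k j where k: "Abs k \<rho> j" "H \<rho> j = f" "\<not> (\<exists>j\<le>m. Dies k j)"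
    by (auto dest!: INFM_EX)
  then have "j > m" by (auto simp: Abs_iff not_le[symmetric])
  moreover have "merge j \<rho>" using k(1) Dies_le[of k j] unfolding merge_def Abs_iff
    by (intro exI[of _ "Suc k"]) auto
  ultimately show "\<exists>j>m. H \<rho> j = f \<and> merge j \<rho>" using k(2) by blast
qed (use that in blast)

lemma absorbing_value:
  assumes "\<exists>\<^sub>\<infinity>k. \<exists>j. Abs k \<rho> j \<and> T (H \<rho> j)"
  obtains f where "\<exists>\<^sub>\<infinity>k. \<exists>j. Abs k \<rho> j \<and> H \<rho> j = f" "T f"
proof -
  have "\<exists>\<^sub>\<infinity>k. \<exists>f\<in>range h. \<exists>j. Abs k \<rho> j \<and> T (H \<rho> j) \<and> H \<rho> j = f"
    using assms by (rule INFM_mono) blast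
  from frequently_bex_finite[OF fin_cong_finite[OF fc] this]
  obtain f where f: "\<exists>\<^sub>\<infinity>k. \<exists>j. Abs k \<rho> j \<and> T (H \<rho> j) \<and> H \<rho> j = f"
    by blast
  then have "T f" by (auto dest!: INFM_EX)
  moreover have "\<exists>\<^sub>\<infinity>k. \<exists>j. Abs k \<rho> j \<and> H \<rho> j = f" using f by (rule INFM_mono) blast
  ultimately show ?thesis using that by blast
qed

private abbreviation (input) prio_at :: "nat \<Rightarrow> nat" where "prio_at k \<equiv> prio h acc (pre k) (w k)"

lemma take_pre: "i \<le> k \<Longrightarrow> h (take i (pre k)) = H 0 i"
  by (simp add: take_map)

lemma seg_pre: "j \<le> k \<Longrightarrow> i \<le> j \<Longrightarrow> h (seg (pre k) i j) = H i j"
  by (simp add: seg_def take_map drop_map)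

lemma finite_prio_set: "finite (insert (2 * card (range h) + 2)
     ({2 * idx h u i | i. dies h u a i} \<union>
      {2 * idx h u i + 1 | i. \<exists>j. absorbs h u a i j \<and> acc (h (take i u)) (h (seg u i j))}))"
proof -
  have "finite {i. dies h u a i}"
    by (rule finite_subset[of _ "insert (length u) (reps h u)"]) (auto simp: dies_def finite_reps)
  moreover have "finite {i. \<exists>j. absorbs h u a i j \<and> acc (h (take i u)) (h (seg u i j))}"
    by (rule finite_subset[of _ "reps h (u @ [a])"]) (auto simp: absorbs_def finite_reps)
  ultimately show ?thesis by simp
qed

lemma prio_le: "prio h acc u a \<le> 2 * card (range h) + 2"
  unfolding prio_def by (rule Min_le[OF finite_prio_set]) simp

lemma prio_le_dies: "Dies k i \<Longrightarrow> prio_at k \<le> 2 * idx h (pre k) i"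
  unfolding prio_def by (rule Min_le[OF finite_prio_set]) blast

lemma prio_le_absorbs: "Abs k i j \<Longrightarrow> acc (H 0 i) (H i j) \<Longrightarrow> prio_at k \<le> 2 * idx h (pre k) i + 1"
  unfolding prio_def
proof (rule Min_le[OF finite_prio_set])
  assume *: "Abs k i j" "acc (H 0 i) (H i j)"
  then have "i \<le> j" "j \<le> k" using Dies_le by (auto simp: Abs_iff)
  then have "acc (h (take i (pre k))) (h (seg (pre k) i j))" using *(2) by (simp add: take_pre seg_pre)
  with *(1) show "2 * idx h (pre k) i + 1 \<in> insert (2 * card (range h) + 2)
     ({2 * idx h (pre k) i | i. Dies k i} \<union>
      {2 * idx h (pre k) i + 1 | i. \<exists>j. Abs k i j \<and> acc (h (take i (pre k))) (h (seg (pre k) i j))})" by blast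
qed

lemma prio_cases:
  obtains "prio_at k = 2 * card (range h) + 2"
  | i where "prio_at k = 2 * idx h (pre k) i" "Dies k i"
  | i j where "prio_at k = 2 * idx h (pre k) i + 1" "Abs k i j" "acc (H 0 i) (H i j)"
proof -
  have "prio_at k \<in> insert (2 * card (range h) + 2)
     ({2 * idx h (pre k) i | i. Dies k i} \<union>
      {2 * idx h (pre k) i + 1 | i. \<exists>j. Abs k i j \<and> acc (h (take i (pre k))) (h (seg (pre k) i j))})"
    unfolding prio_def by (rule Min_in[OF finite_prio_set]) simp
  then consider "prio_at k = 2 * card (range h) + 2"
    | i where "prio_at k = 2 * idx h (pre k) i" "Dies k i"
    | i j where "prio_at k = 2 * idx h (pre k) i + 1" "Abs k i j" "acc (h (take i (pre k))) (h (seg (pre k) i j))"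
    by blast
  then show ?thesis
  proof cases
    case (3 i j)
    then have "i \<le> j" "j \<le> k" using Dies_le by (auto simp: Abs_iff)
    with 3 have "acc (H 0 i) (H i j)" by (simp add: take_pre seg_pre)
    with 3 that(3) show ?thesis by blast
  qed (use that in blast)+
qed

lemma idx_mono: "i \<le> j \<Longrightarrow> idx h u i \<le> idx h u j"
  unfolding idx_def by (rule card_mono) (auto simp: finite_reps)

lemma idx_strict: "i \<in> reps h u \<Longrightarrow> i < j \<Longrightarrow> idx h u i < idx h u j"
  unfolding idx_def by (rule psubset_card_mono) (auto simp: finite_reps)

lemma idx_le: "idx h u i \<le> card (range h)"
  unfolding idx_def
  using card_mono[of "reps h u" "reps h u \<inter> {..<i}"] card_reps[OF fin_cong_finite[OF fc], of u]
  by (simp add: finite_reps)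

text \<open>From some time on nothing of rank at most p dies, so one position \<open>i1\<close>
  holds rank p for ever. All later emissions of 2p + 1 are absorptions by \<open>i1\<close>, and by
  pigeonhole one accepted value f recurs; the rest of the word from \<open>i1\<close> then factors
  into segments of value f.\<close>

lemma good_imp_L:
  assumes "good prio_at"
  shows "L w"
proof -
  obtain l where l: "odd l" "\<exists>\<^sub>\<infinity>k. prio_at k = l" "\<forall>\<^sub>\<infinity>k. l \<le> prio_at k"
    using assms unfolding good_def by blast
  from l(1) obtain p where p: "l = 2 * p + 1" by (rule oddE)
  obtain K where K: "\<And>k. k \<ge> K \<Longrightarrow> l \<le> prio_at k"
    using l(3) unfolding MOST_nat_le by blast
  have nodie: "p < idx h (pre k) i" if "Dies k i" "k \<ge> K" for k i
    using K[OF that(2)] prio_le_dies[OF that(1)] unfolding p by linarith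
  have ex: "\<exists>i j. idx h (pre k) i = p \<and> Abs k i j \<and> acc (H 0 i) (H i j)" if "prio_at k = l" for k
    using that unfolding p by (cases k rule: prio_cases) (auto, presburger+)
  obtain k1 where "k1 \<ge> K" "prio_at k1 = l" using l(2) unfolding INFM_nat_le by blast
  then obtain i1 j1 where i1: "idx h (pre k1) i1 = p" "Abs k1 i1 j1" using ex by blast
  have i1lt: "i1 < k1" using i1(2) Dies_le[of k1 j1] by (auto simp: Abs_iff)
  \<comment> \<open>Representatives up to \<open>i1\<close> have rank at most p and survive, and
    \<open>R_anti\<close> excludes new ones among these positions; hence the rank of
    \<open>i1\<close> does not change.\<close>
  have inv: "i1 \<in> R k \<and> idx h (pre k) i1 = p" if "k \<ge> k1" for k
    using that
  proof (induction k rule: dec_induct)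
    case base
    have "i1 \<in> R (Suc k1)" using i1(2) by (simp only: Abs_iff)
    then have "i1 \<in> R k1" using R_anti i1lt by (metis le_refl le_SucI)
    then show ?case using i1(1) by blast
  next
    case (step k)
    have kK: "k \<ge> K" using step \<open>k1 \<ge> K\<close> by simp
    have stay: "i \<in> R (Suc k)" if "i \<in> R k" "i \<le> i1" for i
    proof (rule ccontr)
      assume "i \<notin> R (Suc k)"
      then have "Dies k i" using that by (simp only: Dies_iff simp_thms)
      then show False using nodie[OF _ kK] idx_mono[OF that(2), of "pre k"] step.IH by (metis not_le)
    qed
    have "R (Suc k) \<inter> {..<i1} = R k \<inter> {..<i1}"
    proof (intro set_eqI iffI)
      fix i assume "i \<in> R (Suc k) \<inter> {..<i1}"
      then show "i \<in> R k \<inter> {..<i1}" using R_anti[of i "Suc k" k] i1lt step.hyps by auto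
    next
      fix i assume "i \<in> R k \<inter> {..<i1}"
      then show "i \<in> R (Suc k) \<inter> {..<i1}" using stay[of i] by auto
    qed
    then have "idx h (pre (Suc k)) i1 = idx h (pre k) i1" unfolding idx_def by (simp only:)
    then show ?case using stay[of i1] step.IH by simp
  qed
  have "\<exists>\<^sub>\<infinity>k. \<exists>j. Abs k i1 j \<and> acc (H 0 i1) (H i1 j)"
    using INFM_ge[OF l(2), of k1]
  proof (rule INFM_mono)
    fix k assume k: "k1 \<le> k \<and> prio_at k = l"
    then obtain i j where ij: "idx h (pre k) i = p" "Abs k i j" "acc (H 0 i) (H i j)" using ex by blast
    have "i < k" using ij(2) Dies_le[of k j] by (auto simp: Abs_iff)
    moreover have "i \<in> R (Suc k)" using ij(2) by (simp only: Abs_iff)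
    ultimately have "i \<in> R k" using R_anti by (metis le_refl le_SucI)
    have "i = i1"
    proof (rule ccontr)
      assume "i \<noteq> i1"
      then consider "i < i1" | "i1 < i" by linarith
      then show False
        using idx_strict[OF \<open>i \<in> R k\<close>, of i1] idx_strict[of i1 "pre k" i] inv[of k] k ij(1) by cases auto
    qed
    then show "\<exists>j. Abs k i1 j \<and> acc (H 0 i1) (H i1 j)" using ij by blast
  qed
  from absorbing_value[OF this]
  obtain f where f: "\<exists>\<^sub>\<infinity>k. \<exists>j. Abs k i1 j \<and> H i1 j = f" "acc (H 0 i1) f" by blast
  from absorbing_sequence[OF f(1)] obtain c where c: "strict_mono c" "c 0 = i1"
    "\<And>i. H (c i) (c (Suc i)) = f" by blast
  show ?thesis by (rule acc_sound[of _ c f]) (use c f(2) in \<open>simp_all\<close>)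
qed

text \<open>A Ramsey set consists of mutually merging positions. The least position \<rho> of their
  class never dies, and the representatives before it only disappear, so its rank settles at some p.
  Infinitely often \<rho> absorbs another position, and a recurring segment value is accepted
  because \<open>w\<close> itself is a witness. So priorities up to 2p + 1 recur, while even ones in
  this range stop.\<close>

lemma L_imp_good:
  assumes "L w"
  shows "good prio_at"
proof -
  have "finite (range (\<lambda>(i, j). H i j))"
    by (rule finite_subset[OF _ fin_cong_finite[OF fc]]) auto
  then obtain Y t where Yt: "infinite Y \<and> (\<forall>i\<in>Y. \<forall>j\<in>Y. i < j \<longrightarrow> H i j = t)"
    by (elim exE[OF ramsey_pairs] exE)
  then have Y: "infinite Y" "\<And>i j. i \<in> Y \<Longrightarrow> j \<in> Y \<Longrightarrow> i < j \<Longrightarrow> H i j = t"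
    by blast+
  have big: "\<exists>j\<in>Y. j > m" for m using Y(1) infinite_nat_iff_unbounded by blast
  obtain i0 where i0: "i0 \<in> Y" using big by blast
  define \<rho> where "\<rho> = (LEAST j. merge j i0)"
  have "merge i0 i0" by (auto simp: merge_def)
  then have \<rho>i0: "merge \<rho> i0" unfolding \<rho>_def by (rule LeastI)
  have least: "\<rho> \<le> j" if "merge j \<rho>" for j
    using Least_le[of "\<lambda>j. merge j i0", OF merge_trans[OF that \<rho>i0]] unfolding \<rho>_def .
  have \<rho>R: "\<rho> \<in> R k" if "\<rho> < k" for k
  proof -
    have "H j k \<noteq> H \<rho> k" if "j < \<rho>" for j
      using least[of j] that \<open>\<rho> < k\<close> unfolding merge_def by (metis less_imp_le_nat less_trans not_le)
    then show ?thesis using that by (simp add: R_iff)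
  qed
  define S where "S k = R k \<inter> {..<\<rho>}" for k
  have Sfin: "finite (S k)" for k by (simp add: S_def)
  have Santi: "S l \<subseteq> S k" if "\<rho> < k" "k \<le> l" for k l
  proof
    fix i assume "i \<in> S l"
    then show "i \<in> S k" using R_anti[of i l k] that by (auto simp: S_def)
  qed
  define p where "p = (LEAST n. \<exists>k>\<rho>. card (S k) = n)"
  have "\<exists>k>\<rho>. card (S k) = p" unfolding p_def by (rule LeastI_ex) blast
  then obtain K where K: "\<rho> < K" "card (S K) = p" by blast
  have SK: "S k = S K" if "k \<ge> K" for k
  proof (rule card_seteq[OF Sfin Santi])
    show "card (S K) \<le> card (S k)" unfolding K(2) p_def by (rule Least_le) (use that K(1) in \<open>intro exI[of _ k]; simp\<close>)
  qed (use that K(1) in auto)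
  have idx\<rho>: "idx h (pre k) \<rho> = p" if "k \<ge> K" for k
    using SK[OF that] K(2) by (simp add: idx_def S_def)
  have die: "p < idx h (pre k) i" if "Dies k i" "k \<ge> K" for k i
  proof -
    have "\<not> i < \<rho>"
    proof
      assume "i < \<rho>"
      then have "i \<in> R k" "i \<notin> R (Suc k)" using that K(1) by (auto simp: Dies_iff simp del: upt_Suc)
      then have "i \<in> S k" "i \<notin> S (Suc k)" using \<open>i < \<rho>\<close> by (auto simp: S_def simp del: upt_Suc)
      then show False using SK[of k] SK[of "Suc k"] that by auto
    qed
    moreover have "i \<noteq> \<rho>" using \<rho>R[of "Suc k"] that K(1) by (auto simp: Dies_iff simp del: upt_Suc)
    ultimately have "\<rho> < i" by simp
    then show ?thesis using idx_strict[OF \<rho>R, of k i] idx\<rho>[OF that(2)] that K(1) by simp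
  qed
  have "\<exists>\<^sub>\<infinity>k. \<exists>j. Abs k \<rho> j"
    unfolding INFM_nat_le
  proof
    fix m
    obtain j where j: "j \<in> Y" "j > Max {m, \<rho>, i0}" using big by blast
    then have jm: "j > m" "j > \<rho>" "j > i0" by auto
    obtain j2 where j2: "j2 \<in> Y" "j2 > j" using big by blast
    have "H i0 j2 = H j j2" using Y(2)[OF i0 j2(1)] Y(2)[OF j(1) j2(1)] j2 jm by simp
    then have "merge j i0" unfolding merge_def using j2 jm by (metis less_imp_le_nat less_trans)
    then have "merge j \<rho>" using merge_trans merge_sym \<rho>i0 by blast
    then obtain k where k: "j \<le> k" "\<rho> \<le> k" "H j k = H \<rho> k" unfolding merge_def by blast
    have "H j (Suc k) = H \<rho> (Suc k)" by (rule H_ext[OF k(3,1,2)]) simp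
    define P where "P k \<longleftrightarrow> j \<le> k \<and> H j (Suc k) = H \<rho> (Suc k)" for k
    \<comment> \<open>The first step at which the suffixes from \<open>j\<close> and \<rho> agree.
      Just before it \<open>j\<close> is represented by another position (by itself if it is new),
      which dies into \<rho> at this very step.\<close>
    define k0 where "k0 = (LEAST k. P k)"
    have "P k" using k(1) \<open>H j (Suc k) = H \<rho> (Suc k)\<close> by (simp only: P_def simp_thms)
    then have "P k0" unfolding k0_def by (rule LeastI)
    then have k0: "j \<le> k0" "H j (Suc k0) = H \<rho> (Suc k0)" by (simp_all only: P_def)
    have "\<exists>j1. \<rho> < j1 \<and> (j1 = k0 \<or> j1 \<in> R k0) \<and> H j1 (Suc k0) = H \<rho> (Suc k0)"
    proof (cases "k0 = j")
      case True
      then show ?thesis using jm k0 by blast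
    next
      case False
      then have jk: "j < k0" using k0 by simp
      have "\<exists>j1\<le>j. j1 \<in> insert (length (pre k0)) (R k0) \<and> (j1 = j \<or> h (drop j1 (pre k0)) = h (drop j (pre k0)))"
        using ex_rep[OF fc, of j "pre k0"] jk by simp
      then obtain j1 where j1: "j1 \<le> j" "j1 = k0 \<or> j1 \<in> R k0" "j1 = j \<or> H j1 k0 = H j k0"
        by (auto simp: drop_map)
      then have eq: "H j1 k0 = H j k0" by (elim disjE) simp_all
      have "H j1 (Suc k0) = H j (Suc k0)" by (rule H_ext[OF eq]) (use j1 jk in simp_all)
      moreover have "\<rho> < j1"
      proof (rule ccontr)
        assume "\<not> \<rho> < j1"
        moreover have "merge j1 j" unfolding merge_def using eq j1(1) jk by (intro exI[of _ k0]) auto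
        then have "\<rho> \<le> j1" using least merge_trans \<open>merge j \<rho>\<close> by blast
        ultimately have "j1 = \<rho>" by simp
        have "k0 - 1 < k0" "Suc (k0 - 1) = k0" "j \<le> k0 - 1" using jk by auto
        then have "P (k0 - 1)" using eq \<open>j1 = \<rho>\<close> by (simp only: P_def simp_thms)
        then show False using not_less_Least[of "k0 - 1" P] \<open>k0 - 1 < k0\<close> unfolding k0_def by blast
      qed
      ultimately show ?thesis using j1(2) k0(2) by (intro exI[of _ j1]) (simp only: simp_thms)
    qed
    then obtain j1 where j1: "\<rho> < j1" "j1 = k0 \<or> j1 \<in> R k0" "H j1 (Suc k0) = H \<rho> (Suc k0)" by blast
    have "j1 \<notin> R (Suc k0)"
      using j1(1,3) R_iff[of j1 "Suc k0"] by metis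
    then have "Dies k0 j1" using j1(2) by (simp only: Dies_iff simp_thms)
    moreover have "\<rho> \<in> R (Suc k0)" by (rule \<rho>R) (use k0(1) jm in simp)
    ultimately have "Abs k0 \<rho> j1" using j1 by (simp only: Abs_iff simp_thms)
    then show "\<exists>k\<ge>m. \<exists>j. Abs k \<rho> j" using k0(1) jm by (intro exI[of _ k0]) auto
  qed
  then obtain f where f: "\<exists>\<^sub>\<infinity>k. \<exists>j. Abs k \<rho> j \<and> H \<rho> j = f"
    using absorbing_value[of \<rho> "\<lambda>_. True"] by auto
  from absorbing_sequence[OF f] obtain c where c: "strict_mono c" "c 0 = \<rho>"
    "\<And>i. H (c i) (c (Suc i)) = f" by blast
  then have accf: "acc (H 0 \<rho>) f" unfolding acc_def using assms by blast
  have low: "\<exists>\<^sub>\<infinity>k. prio_at k \<le> 2 * p + 1"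
    using INFM_ge[OF f, of K]
  proof (rule INFM_mono)
    fix k assume "K \<le> k \<and> (\<exists>j. Abs k \<rho> j \<and> H \<rho> j = f)"
    then show "prio_at k \<le> 2 * p + 1" using prio_le_absorbs accf idx\<rho> by metis
  qed
  \<comment> \<open>An even recurring minimum would be at most 2p + 1; but deaths from time K on and
    the default lie above that, and absorptions give odd values.\<close>
  have "\<not> bad prio_at"
  proof
    assume "bad prio_at"
    then obtain l where l: "even l" "\<exists>\<^sub>\<infinity>k. prio_at k = l" "\<forall>\<^sub>\<infinity>k. l \<le> prio_at k"
      unfolding bad_def by blast
    have "l \<le> 2 * p + 1" using INFM_conjI[OF low l(3)] by (auto dest!: INFM_EX)
    obtain k where k: "k \<ge> K" "prio_at k = l" using l(2) unfolding INFM_nat_le by blast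
    have "p \<le> card (range h)" using idx_le[of "pre K" \<rho>] idx\<rho>[of K] by simp
    show False
    proof (cases k rule: prio_cases)
      case 1
      then show False using k \<open>l \<le> 2 * p + 1\<close> \<open>p \<le> card (range h)\<close> by simp
    next
      case (2 i)
      then show False using die[OF 2(2) k(1)] k \<open>l \<le> 2 * p + 1\<close> by simp
    next
      case (3 i j)
      then show False using k l(1) by simp
    qed
  qed
  then show ?thesis using good_or_bad[of prio_at, OF prio_le] by blast
qed

end

theorem determinization:
  "\<exists>(st :: 'a list \<Rightarrow> ('b \<times> 'b \<times> 'b list) list) pr b. finite (range st) \<and>
     (\<forall>u v a. st u = st v \<longrightarrow> st (u @ [a]) = st (v @ [a]) \<and> pr u a = pr v a) \<and>
     (\<forall>u a. pr u a \<le> b) \<and> (\<forall>w. L w \<longleftrightarrow> good (\<lambda>k. pr (map w [0..<k]) (w k)))"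
proof (intro exI conjI allI impI)
  show "finite (range (state h))" by (rule finite_state[OF fin_cong_finite[OF fc]])
  fix u v :: "'a list" and a assume s: "state h u = state h v"
  show "state h (u @ [a]) = state h (v @ [a])" by (rule state_step(1)[OF fc s])
  show "prio h acc u a = prio h acc v a" by (rule state_step(2)[OF fc s])
next
  fix u :: "'a list" and a
  show "prio h acc u a \<le> 2 * card (range h) + 2" by (rule prio_le)
next
  fix w :: "'a word"
  show "L w \<longleftrightarrow> good (\<lambda>k. prio h acc (map w [0..<k]) (w k))"
    using L_imp_good good_imp_L by blast
qed

end


section \<open>Finite parity games\<close>

lemma not_bad_and_good: "bad \<kappa> \<Longrightarrow> \<not> good \<kappa>"
  using not_good_and_bad by blast

lemma INFM_shift: "(\<exists>\<^sub>\<infinity>n. P (n + k)) \<longleftrightarrow> (\<exists>\<^sub>\<infinity>n::nat. P n)"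
  unfolding frequently_def cofinite_eq_sequentially eventually_sequentially_seg[of "\<lambda>n. \<not> P n" k] ..

lemma MOST_shift: "(\<forall>\<^sub>\<infinity>n. P (n + k)) \<longleftrightarrow> (\<forall>\<^sub>\<infinity>n::nat. P n)"
  unfolding cofinite_eq_sequentially by (rule eventually_sequentially_seg)

lemma good_shift: "good (\<lambda>n. \<kappa> (n + k)) \<longleftrightarrow> good \<kappa>"
  unfolding good_def INFM_shift[of "\<lambda>n. \<kappa> n = _"] MOST_shift[of "\<lambda>n. _ \<le> \<kappa> n"] ..

lemma bad_shift: "bad (\<lambda>n. \<kappa> (n + k)) \<longleftrightarrow> bad \<kappa>"
  unfolding bad_def INFM_shift[of "\<lambda>n. \<kappa> n = _"] MOST_shift[of "\<lambda>n. _ \<le> \<kappa> n"] ..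

text \<open>A parity game in which at vertex \<open>v\<close> the first player commits to a set \<open>U \<in> N v\<close> and the second
  player picks the next vertex in \<open>U\<close>; \<open>M\<close> is the dual family for the second player. In
  \<open>solution d T\<close> the play stops at the first vertex of priority below \<open>d\<close>, and the first player wins if
  it lies in \<open>T\<close>. Winning is expressed by \<open>G\<close> and \<open>B\<close> so that the two players can be exchanged.\<close>

definition solution ::
  "'v set \<Rightarrow> ('v \<Rightarrow> nat) \<Rightarrow> ('v \<Rightarrow> 'v set set) \<Rightarrow> ('v \<Rightarrow> 'v set set) \<Rightarrow>
   ((nat \<Rightarrow> nat) \<Rightarrow> bool) \<Rightarrow> ((nat \<Rightarrow> nat) \<Rightarrow> bool) \<Rightarrow> nat \<Rightarrow> 'v set \<Rightarrow>
   'v set \<Rightarrow> ('v \<Rightarrow> 'v set) \<Rightarrow> ('v \<Rightarrow> 'v set) \<Rightarrow> bool" where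
  "solution V c N M G B d T W \<sigma> \<tau> \<longleftrightarrow>
     W \<subseteq> V \<and>
     (\<forall>v\<in>V. c v < d \<longrightarrow> (v \<in> W \<longleftrightarrow> v \<in> T)) \<and>
     (\<forall>v\<in>W. d \<le> c v \<longrightarrow> \<sigma> v \<in> N v \<and> \<sigma> v \<subseteq> W) \<and>
     (\<forall>v\<in>V - W. d \<le> c v \<longrightarrow> \<tau> v \<in> M v \<and> \<tau> v \<subseteq> V - W) \<and>
     (\<forall>p. (\<forall>i. p i \<in> W \<and> d \<le> c (p i) \<and> p (Suc i) \<in> \<sigma> (p i)) \<longrightarrow> G (\<lambda>i. c (p i))) \<and>
     (\<forall>p. (\<forall>i. p i \<in> V - W \<and> d \<le> c (p i) \<and> p (Suc i) \<in> \<tau> (p i)) \<longrightarrow> B (\<lambda>i. c (p i)))"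

lemma solution_good:
  "solution V c N M G B d T W \<sigma> \<tau> \<Longrightarrow> \<forall>i. p i \<in> W \<and> d \<le> c (p i) \<and> p (Suc i) \<in> \<sigma> (p i) \<Longrightarrow>
     G (\<lambda>i. c (p i))"
  unfolding solution_def by (elim conjE allE[of _ p]) (rule mp)

lemma solution_bad:
  "solution V c N M G B d T W \<sigma> \<tau> \<Longrightarrow> \<forall>i. p i \<in> V - W \<and> d \<le> c (p i) \<and> p (Suc i) \<in> \<tau> (p i) \<Longrightarrow>
     B (\<lambda>i. c (p i))"
  unfolding solution_def by (elim conjE allE[of _ p]) (rule mp)

lemma solution_dual:
  assumes "solution V c N M G B d T W \<sigma> \<tau>"
  shows "solution V c M N B G d (V - T) (V - W) \<tau> \<sigma>"
proof -
  have "V - (V - W) = W" using assms by (auto simp: solution_def)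
  then show ?thesis using assms unfolding solution_def by auto
qed

text \<open>Determinacy of a single round: \<open>N v\<close> and \<open>M v\<close> hold the sets
  into which the two players can force the next vertex, and for each Z either the first can force it
  into Z or the second out of Z, but not both.\<close>

definition dual_families :: "'v set \<Rightarrow> ('v \<Rightarrow> 'v set set) \<Rightarrow> ('v \<Rightarrow> 'v set set) \<Rightarrow> bool" where
  "dual_families V N M \<longleftrightarrow> (\<forall>v\<in>V. (\<forall>Z\<subseteq>V. (\<exists>U\<in>N v. U \<subseteq> Z) \<or> (\<exists>U\<in>M v. U \<subseteq> V - Z)) \<and>
     (\<forall>U\<in>N v. \<forall>U'\<in>M v. U \<inter> U' \<noteq> {}))"

lemma dual_families_sym: "dual_families V N M \<Longrightarrow> dual_families V M N"
  unfolding dual_families_def by (metis (no_types, lifting) Diff_subset double_diff inf_commute subset_refl)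

lemma dual_families_meet:
  "dual_families V N M \<Longrightarrow> v \<in> V \<Longrightarrow> U \<in> N v \<Longrightarrow> U' \<in> M v \<Longrightarrow> \<exists>x. x \<in> U \<inter> U'"
  unfolding dual_families_def by (metis ex_in_conv)

lemma dual_families_cover:
  "dual_families V N M \<Longrightarrow> v \<in> V \<Longrightarrow> Z \<subseteq> V \<Longrightarrow> \<not> (\<exists>U\<in>N v. U \<subseteq> Z) \<Longrightarrow> \<exists>U\<in>M v. U \<subseteq> V - Z"
  unfolding dual_families_def by metis

text \<open>From a vertex in \<open>W - W'\<close> the strategies \<sigma> and \<tau>' are played
  against each other. By duality each round has a common successor, again in \<open>W - W'\<close>;
  the targets rule out stopping vertices there, so the play is infinite and won by both
  players.\<close>

lemma solution_mono:
  assumes S: "solution V c N M G B d T W \<sigma> \<tau>" and S': "solution V c N M G B d T' W' \<sigma>' \<tau>'"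
    and dual: "dual_families V N M" and excl: "\<And>\<kappa>. G \<kappa> \<Longrightarrow> \<not> B \<kappa>"
    and TT: "\<And>v. v \<in> T \<Longrightarrow> c v < d \<Longrightarrow> v \<in> T'"
  shows "W \<subseteq> W'"
proof (rule ccontr)
  assume "\<not> W \<subseteq> W'"
  then obtain v where v: "v \<in> W - W'" by blast
  have pos: "d \<le> c x" if "x \<in> W - W'" for x
    using that S S' TT unfolding solution_def by (metis DiffE not_le subsetD)
  have "\<exists>y. y \<in> W - W' \<and> y \<in> \<sigma> x \<inter> \<tau>' x" if x: "x \<in> W - W'" for x
  proof -
    have "\<sigma> x \<in> N x" "\<sigma> x \<subseteq> W" "x \<in> V" using S x pos[OF x] unfolding solution_def by blast+
    moreover have "\<tau>' x \<in> M x" "\<tau>' x \<subseteq> V - W'" using S' x pos[OF x] \<open>x \<in> V\<close> unfolding solution_def by blast+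
    moreover obtain y where "y \<in> \<sigma> x \<inter> \<tau>' x"
      using dual_families_meet[OF dual \<open>x \<in> V\<close>] calculation by blast
    ultimately show ?thesis by blast
  qed
  then have "\<exists>p. \<forall>n. (p n \<in> W - W') \<and> p (Suc n) \<in> \<sigma> (p n) \<inter> \<tau>' (p n)"
    using v by (intro dependent_nat_choice) blast+
  then obtain p where p: "\<And>n. p n \<in> W - W'" "\<And>n. p (Suc n) \<in> \<sigma> (p n) \<inter> \<tau>' (p n)" by blast
  have WV: "W \<subseteq> V" using S unfolding solution_def by blast
  have "\<forall>i. p i \<in> W \<and> d \<le> c (p i) \<and> p (Suc i) \<in> \<sigma> (p i)" using p pos by blast
  then have "G (\<lambda>i. c (p i))" by (rule solution_good[OF S])
  moreover have "\<forall>i. p i \<in> V - W' \<and> d \<le> c (p i) \<and> p (Suc i) \<in> \<tau>' (p i)"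
    using p pos WV by blast
  then have "B (\<lambda>i. c (p i))" by (rule solution_bad[OF S'])
  ultimately show False using excl by blast
qed

lemma decreasing_sets_stabilize:
  fixes Z :: "nat \<Rightarrow> 'v set"
  assumes "finite (Z 0)" "\<And>n. Z (Suc n) \<subseteq> Z n"
  shows "\<exists>n. Z (Suc n) = Z n"
proof (rule ccontr)
  assume "\<nexists>n. Z (Suc n) = Z n"
  then have strict: "Z (Suc n) \<subset> Z n" for n using assms(2) by blast
  have fin: "finite (Z n)" for n by (induction n) (use assms finite_subset in blast)+
  have "card (Z n) + n \<le> card (Z 0)" for n
  proof (induction n)
    case (Suc n)
    then show ?case using psubset_card_mono[OF fin strict, of n] by simp
  qed simp
  from this[of "Suc (card (Z 0))"] show False by simp
qed

lemma eventually_constant: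
  fixes r :: "nat \<Rightarrow> nat"
  assumes "\<And>i. r (Suc i) \<le> r i"
  shows "\<exists>K. \<forall>i\<ge>K. r i = r K"
proof -
  define m where "m = (LEAST m. \<exists>i. r i = m)"
  have "\<exists>i. r i = m" unfolding m_def by (rule LeastI_ex) blast
  then obtain K where K: "r K = m" by blast
  have "r i = r K" if "K \<le> i" for i
  proof (rule antisym)
    show "r i \<le> r K" by (rule lift_Suc_antimono_le[of r, OF assms that])
    show "r K \<le> r i" unfolding K m_def by (rule Least_le) blast
  qed
  then show ?thesis by blast
qed

text \<open>The priority d favours the first player. Its vertices become stopping vertices, and
  regions are iterated downwards from V: \<open>Z (Suc n)\<close> is the winning region when a
  d-vertex counts as won iff the next vertex can be forced into \<open>Z n\<close>. On the limit W
  the first player either sees d infinitely often or follows the subgame strategy from some point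
  on. Outside W the second player uses the stage \<open>rank\<close> at which a vertex drops out: it
  never increases and falls at every d-vertex, so d is eventually avoided.\<close>

lemma solution_step:
  assumes fin: "finite V" and dual: "dual_families V N M" and excl: "\<And>\<kappa>. G \<kappa> \<Longrightarrow> \<not> B \<kappa>"
    and shG: "\<And>\<kappa> k. G (\<lambda>i. \<kappa> (i + k)) \<Longrightarrow> G \<kappa>" and shB: "\<And>\<kappa> k. B (\<lambda>i. \<kappa> (i + k)) \<Longrightarrow> B \<kappa>"
    and fav: "\<And>\<kappa>. \<exists>\<^sub>\<infinity>i. \<kappa> i = d \<Longrightarrow> (\<And>i. d \<le> \<kappa> i) \<Longrightarrow> G \<kappa>"
    and sub: "\<And>T. \<exists>W \<sigma> \<tau>. solution V c N M G B (Suc d) T W \<sigma> \<tau>"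
  shows "\<exists>W \<sigma> \<tau>. solution V c N M G B d T W \<sigma> \<tau>"
proof -
  obtain Wf \<sigma>f \<tau>f where sol: "\<And>T. solution V c N M G B (Suc d) T (Wf T) (\<sigma>f T) (\<tau>f T)"
    using sub by metis
  define pre where "pre Z = {v \<in> V. \<exists>U\<in>N v. U \<subseteq> Z}" for Z
  define tgt where "tgt Z = {v \<in> T. c v < d} \<union> {v \<in> pre Z. c v = d}" for Z
  define Z where "Z n = ((\<lambda>Z. Wf (tgt Z)) ^^ n) V" for n
  have Z0: "Z 0 = V" and ZS: "Z (Suc n) = Wf (tgt (Z n))" for n by (simp_all add: Z_def)
  have WfV: "Wf T \<subseteq> V" for T using sol unfolding solution_def by blast
  have dec: "Z (Suc n) \<subseteq> Z n" for n
  proof (induction n)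
    case 0
    then show ?case using WfV by (simp add: Z0 ZS)
  next
    case (Suc n)
    then have "tgt (Z (Suc n)) \<subseteq> tgt (Z n)" by (auto simp: tgt_def pre_def)
    then show ?case unfolding ZS[of n] ZS[of "Suc n"]
      by (intro solution_mono[OF sol sol dual excl]) auto
  qed
  have ZV: "Z n \<subseteq> V" for n using WfV by (cases n) (simp_all add: Z0 ZS)
  obtain m where m: "Z (Suc m) = Z m" using decreasing_sets_stabilize[of Z] dec fin by (auto simp: Z0)
  define W where "W = Z m"
  have anti: "Z k \<subseteq> Z n" if "n \<le> k" for n k using lift_Suc_antimono_le[of Z, OF dec that] .
  have stab: "Z (m + k) = W" for k
    by (induction k) (use m in \<open>simp_all add: W_def ZS\<close>)
  have WZ: "W \<subseteq> Z n" for n using anti[of n "m + n"] stab[of n] by simp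
  have Wfix: "W = Wf (tgt W)" using m by (simp add: W_def ZS)
  note solW = sol[of "tgt W", folded Wfix]
  define \<sigma> where "\<sigma> v = (if c v = d then SOME U. U \<in> N v \<and> U \<subseteq> W else \<sigma>f (tgt W) v)" for v
  define rank where "rank v = (LEAST n. v \<notin> Z (Suc n))" for v
  define \<tau> where "\<tau> v = (if c v = d then SOME U. U \<in> M v \<and> U \<subseteq> V - Z (rank v)
     else \<tau>f (tgt (Z (rank v))) v)" for v
  have rank1: "v \<notin> Z (Suc (rank v))" if "v \<in> V - W" for v
    unfolding rank_def by (rule LeastI[of _ m]) (use that m W_def in auto)
  have rank2: "rank v \<le> n" if "v \<notin> Z (Suc n)" for v n
    unfolding rank_def by (rule Least_le[of "\<lambda>n. v \<notin> Z (Suc n)", OF that])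
  have \<sigma>1: "\<sigma> v \<in> N v \<and> \<sigma> v \<subseteq> W" if v: "v \<in> W" "d \<le> c v" for v
  proof (cases "c v = d")
    case True
    have "v \<in> tgt W" using solW v True WZ ZV unfolding solution_def by (metis lessI subsetD)
    then have "\<exists>U. U \<in> N v \<and> U \<subseteq> W" using True by (auto simp: tgt_def pre_def)
    from someI_ex[OF this] show ?thesis using True by (simp add: \<sigma>_def)
  next
    case False
    then show ?thesis using solW v unfolding solution_def \<sigma>_def by simp
  qed
  have \<tau>1: "\<tau> v \<in> M v \<and> \<tau> v \<subseteq> V - Z (rank v) " if v: "v \<in> V - W" "c v = d" for v
  proof -
    have "v \<notin> Wf (tgt (Z (rank v)))" using rank1[OF v(1)] by (simp add: ZS)
    then have "v \<notin> tgt (Z (rank v))" using sol[of "tgt (Z (rank v))"] v unfolding solution_def by simp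
    then have "\<not> (\<exists>U\<in>N v. U \<subseteq> Z (rank v))" using v by (auto simp: tgt_def pre_def)
    then have "\<exists>U. U \<in> M v \<and> U \<subseteq> V - Z (rank v)"
      using dual_families_cover[OF dual _ ZV] v by blast
    from someI_ex[OF this] show ?thesis using v by (simp add: \<tau>_def)
  qed
  have \<tau>2: "\<tau> v \<in> M v \<and> \<tau> v \<subseteq> V - Z (Suc (rank v))" if v: "v \<in> V - W" "d < c v" for v
    using sol[of "tgt (Z (rank v))"] rank1[OF v(1)] v unfolding solution_def \<tau>_def ZS by simp
  have "solution V c N M G B d T W \<sigma> \<tau>" unfolding solution_def
  proof (intro conjI ballI impI allI)
    show "W \<subseteq> V" using ZV by (simp add: W_def)
  next
    fix v assume v: "v \<in> V" "c v < d"
    then have "v \<in> W \<longleftrightarrow> v \<in> tgt W" using solW unfolding solution_def by simp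
    then show "v \<in> W \<longleftrightarrow> v \<in> T" using v by (auto simp: tgt_def)
  next
    fix v assume "v \<in> W" "d \<le> c v"
    then show "\<sigma> v \<in> N v" "\<sigma> v \<subseteq> W" using \<sigma>1 by blast+
  next
    fix v assume v: "v \<in> V - W" "d \<le> c v"
    show "\<tau> v \<in> M v" "\<tau> v \<subseteq> V - W"
      using \<tau>1[OF v(1)] \<tau>2[OF v(1)] v(2) WZ[of "rank v"] WZ[of "Suc (rank v)"]
      by (cases "c v = d"; force)+
  next
    fix p assume p: "\<forall>i. p i \<in> W \<and> d \<le> c (p i) \<and> p (Suc i) \<in> \<sigma> (p i)"
    show "G (\<lambda>i. c (p i))"
    proof (cases "\<exists>\<^sub>\<infinity>i. c (p i) = d")
      case True
      then show ?thesis using p by (intro fav) auto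
    next
      case False
      then obtain K where K: "\<And>i. i \<ge> K \<Longrightarrow> c (p i) \<noteq> d" by (auto simp: not_INFM MOST_nat_le)
      have "\<forall>i. p (i + K) \<in> W \<and> Suc d \<le> c (p (i + K)) \<and> p (Suc i + K) \<in> \<sigma>f (tgt W) (p (i + K))"
      proof
        fix i
        show "p (i + K) \<in> W \<and> Suc d \<le> c (p (i + K)) \<and> p (Suc i + K) \<in> \<sigma>f (tgt W) (p (i + K))"
          using p[rule_format, of "i + K"] K[of "i + K"] by (auto simp: \<sigma>_def)
      qed
      then have "G (\<lambda>i. c (p (i + K)))" by (rule solution_good[OF solW])
      then show ?thesis by (rule shG)
    qed
  next
    fix p assume p: "\<forall>i. p i \<in> V - W \<and> d \<le> c (p i) \<and> p (Suc i) \<in> \<tau> (p i)"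
    have r1: "rank (p (Suc i)) \<le> rank (p i)" for i
    proof (cases "c (p i) = d")
      case True
      then have "p (Suc i) \<notin> Z (rank (p i))" using \<tau>1 p by blast
      then show ?thesis using rank2 dec by blast
    next
      case False
      then have "d < c (p i)" using p by (metis le_neq_implies_less)
      then show ?thesis using \<tau>2 p rank2 by blast
    qed
    then obtain K where K: "\<And>i. i \<ge> K \<Longrightarrow> rank (p i) = rank (p K)"
      using eventually_constant[of "\<lambda>i. rank (p i)"] by blast
    let ?n = "rank (p K)"
    have "\<forall>i. p (i + K) \<in> V - Wf (tgt (Z ?n)) \<and> Suc d \<le> c (p (i + K)) \<and>
        p (Suc i + K) \<in> \<tau>f (tgt (Z ?n)) (p (i + K))"
    proof
      fix i
      have r: "rank (p (i + K)) = ?n" "rank (p (Suc (i + K))) = ?n" by (rule K, simp)+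
      have "c (p (i + K)) \<noteq> d"
      proof
        assume "c (p (i + K)) = d"
        then have "p (Suc (i + K)) \<in> V - Z (rank (p (i + K)))" using \<tau>1[of "p (i + K)"] p by blast
        then have *: "p (Suc (i + K)) \<in> V - Z ?n" unfolding r .
        \<comment> \<open>Rank 0 cannot occur here, as nothing lies outside
          \<open>Z 0 = V\<close>.\<close>
        then obtain k where k: "?n = Suc k" using Z0 by (cases ?n) auto
        then have "rank (p (Suc (i + K))) \<le> k" using * by (intro rank2) simp
        then show False unfolding r(2) k by simp
      qed
      then show "p (i + K) \<in> V - Wf (tgt (Z ?n)) \<and> Suc d \<le> c (p (i + K)) \<and>
        p (Suc i + K) \<in> \<tau>f (tgt (Z ?n)) (p (i + K))"
        using p[rule_format, of "i + K"] rank1[of "p (i + K)", unfolded r(1)]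
        by (auto simp: \<tau>_def r(1) simp flip: ZS)
    qed
    then have "B (\<lambda>i. c (p (i + K)))" by (rule solution_bad[OF sol])
    then show "B (\<lambda>i. c (p i))" by (rule shB)
  qed
  then show ?thesis by blast
qed

text \<open>Downward induction on d from a strict bound of the priorities, where every vertex stops
  at once, to d = 0, where none does. Odd d favours the first player; for even d the players are
  exchanged by \<open>solution_dual\<close> before and after the step.\<close>

theorem parity_determinacy:
  assumes fin: "finite V" and dual: "dual_families V N M"
  obtains W \<sigma> \<tau> where "W \<subseteq> V"
    "\<And>v. v \<in> W \<Longrightarrow> \<sigma> v \<in> N v \<and> \<sigma> v \<subseteq> W"
    "\<And>v. v \<in> V - W \<Longrightarrow> \<tau> v \<in> M v \<and> \<tau> v \<subseteq> V - W"
    "\<And>p. (\<And>i. p i \<in> W \<and> p (Suc i) \<in> \<sigma> (p i)) \<Longrightarrow> good (\<lambda>i. c (p i))"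
    "\<And>p. (\<And>i. p i \<in> V - W \<and> p (Suc i) \<in> \<tau> (p i)) \<Longrightarrow> bad (\<lambda>i. c (p i))"
proof -
  obtain b where b: "\<And>v. v \<in> V \<Longrightarrow> c v < b"
    using finite_nat_set_iff_bounded[of "c ` V"] fin by auto
  have "\<exists>W \<sigma> \<tau>. solution V c N M good bad d T W \<sigma> \<tau>" if "d \<le> b" for d T
    using that
  proof (induction d arbitrary: T rule: inc_induct)
    case base
    have "solution V c N M good bad b T (T \<inter> V) \<sigma> \<tau>" for \<sigma> \<tau>
      using b unfolding solution_def by (auto simp: not_le[symmetric])
    then show ?case by blast
  next
    case (step d)
    show ?case
    proof (cases "odd d")
      case True
      show ?thesis
        by (rule solution_step[OF fin dual not_good_and_bad _ _ _ step.IH])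
          (use True in \<open>auto simp: good_shift bad_shift good_def intro!: exI[of _ d]\<close>)
    next
      case False
      have "\<exists>W \<sigma> \<tau>. solution V c M N bad good (Suc d) T W \<sigma> \<tau>" for T
        using step.IH[of "V - T"]
      proof (elim exE)
        fix W \<sigma> \<tau> assume "solution V c N M good bad (Suc d) (V - T) W \<sigma> \<tau>"
        from solution_dual[OF this] have "solution V c M N bad good (Suc d) (V \<inter> T) (V - W) \<tau> \<sigma>"
          by (simp add: Diff_Diff_Int)
        then show ?thesis unfolding solution_def by (intro exI[of _ "V - W"] exI[of _ \<tau>] exI[of _ \<sigma>]) auto
      qed
      then have "\<exists>W \<sigma> \<tau>. solution V c M N bad good d (V - T) W \<sigma> \<tau>"
        by (rule solution_step[OF fin dual_families_sym[OF dual] not_bad_and_good, rotated 4])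
          (use False in \<open>auto simp: good_shift bad_shift bad_def intro!: exI[of _ d]\<close>)
      then obtain W \<sigma> \<tau> where "solution V c M N bad good d (V - T) W \<sigma> \<tau>" by blast
      from solution_dual[OF this] have "solution V c N M good bad d (V \<inter> T) (V - W) \<tau> \<sigma>"
        by (simp add: Diff_Diff_Int)
      then show ?thesis unfolding solution_def by (intro exI[of _ "V - W"] exI[of _ \<tau>] exI[of _ \<sigma>]) auto
    qed
  qed
  then obtain W \<sigma> \<tau> where "solution V c N M good bad 0 {} W \<sigma> \<tau>" by blast
  then show ?thesis by (intro that[of W \<sigma> \<tau>]) (auto simp: solution_def)
qed


section \<open>Definable relations\<close>

lemma finite_free: "finite (free1 \<phi>)" "finite (free2 \<phi>)"
  by (induction \<phi>) auto

lemma sat_cong: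
  "(\<And>x. x \<in> free1 \<phi> \<Longrightarrow> u x = u' x) \<Longrightarrow> (\<And>Z. Z \<in> free2 \<phi> \<Longrightarrow> V Z = V' Z) \<Longrightarrow>
    sat P u V \<phi> \<longleftrightarrow> sat P u' V' \<phi>"
proof (induction \<phi> arbitrary: u u' V V')
  case (And \<phi> \<psi>)
  have "sat P u V \<phi> \<longleftrightarrow> sat P u' V' \<phi>" by (rule And.IH(1)) (rule And.prems, simp)+
  moreover have "sat P u V \<psi> \<longleftrightarrow> sat P u' V' \<psi>" by (rule And.IH(2)) (rule And.prems, simp)+
  ultimately show ?case by simp
next
  case (Ex1 x \<phi>)
  have "sat P (u(x := n)) V \<phi> \<longleftrightarrow> sat P (u'(x := n)) V' \<phi>" for n
    by (rule Ex1.IH) (simp_all add: Ex1.prems)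
  then show ?case by simp
next
  case (Ex2 Z \<phi>)
  have "sat P u (V(Z := A)) \<phi> \<longleftrightarrow> sat P u' (V'(Z := A)) \<phi>" for A
    by (rule Ex2.IH) (simp_all add: Ex2.prems)
  then show ?case by simp
next
  case (Less x y)
  show ?case using Less.prems(1)[of x] Less.prems(1)[of y] by simp
next
  case (Eq x y)
  show ?case using Eq.prems(1)[of x] Eq.prems(1)[of y] by simp
next
  case (Mem x Z)
  show ?case using Mem.prems(1)[of x] Mem.prems(2)[of Z] by simp
next
  case (Pred x)
  show ?case using Pred.prems(1)[of x] by simp
next
  case (Neg \<phi>)
  have "sat P u V \<phi> \<longleftrightarrow> sat P u' V' \<phi>" by (rule Neg.IH) (rule Neg.prems, simp)+
  then show ?case by simp
qed

text \<open>Semantic definability for a fixed P: formulas are handled through their truth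
  conditions, so that renaming variables becomes quantification with an equation instead of a
  syntactic substitution.\<close>

definition definable :: "nat set \<Rightarrow> ((nat \<Rightarrow> nat) \<Rightarrow> (nat \<Rightarrow> nat set) \<Rightarrow> bool) \<Rightarrow> bool" where
  "definable P R \<longleftrightarrow> (\<exists>\<phi>. \<forall>u V. sat P u V \<phi> \<longleftrightarrow> R u V)"

named_theorems defin

lemma definable_less[defin]: "definable P (\<lambda>u V. u x < u y)"
  unfolding definable_def by (rule exI[of _ "Less x y"]) simp

lemma definable_eq[defin]: "definable P (\<lambda>u V. u x = u y)"
  unfolding definable_def by (rule exI[of _ "Eq x y"]) simp

lemma definable_mem[defin]: "definable P (\<lambda>u V. u x \<in> V Z)"
  unfolding definable_def by (rule exI[of _ "Mem x Z"]) simp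

lemma definable_pred[defin]: "definable P (\<lambda>u V. u x \<in> P)"
  unfolding definable_def by (rule exI[of _ "Pred x"]) simp

lemma definable_not[defin]:
  assumes "definable P R" shows "definable P (\<lambda>u V. \<not> R u V)"
proof -
  obtain \<phi> where "\<forall>u V. sat P u V \<phi> \<longleftrightarrow> R u V" using assms unfolding definable_def by blast
  then show ?thesis unfolding definable_def by (intro exI[of _ "Neg \<phi>"]) simp
qed

lemma definable_and[defin]:
  assumes "definable P R" "definable P S" shows "definable P (\<lambda>u V. R u V \<and> S u V)"
proof -
  obtain \<phi> \<psi> where "\<forall>u V. sat P u V \<phi> \<longleftrightarrow> R u V" "\<forall>u V. sat P u V \<psi> \<longleftrightarrow> S u V"
    using assms unfolding definable_def by blast
  then show ?thesis unfolding definable_def by (intro exI[of _ "And \<phi> \<psi>"]) simp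
qed

lemma definable_or[defin]:
  assumes "definable P R" "definable P S" shows "definable P (\<lambda>u V. R u V \<or> S u V)"
  using definable_not[OF definable_and[OF definable_not[OF assms(1)] definable_not[OF assms(2)]]] by simp

lemma definable_imp[defin]:
  assumes "definable P R" "definable P S" shows "definable P (\<lambda>u V. R u V \<longrightarrow> S u V)"
  using definable_or[OF definable_not[OF assms(1)] assms(2)] by simp

lemma definable_le[defin]: "definable P (\<lambda>u V. u x \<le> u y)"
  using definable_not[OF definable_less[of P y x]] by (simp add: not_less)

lemma definable_const[defin]: "definable P (\<lambda>u V. b)"
proof (cases b)
  case True
  then show ?thesis using definable_eq[of P 0 0] by simp
next
  case False
  then show ?thesis using definable_not[OF definable_eq[of P 0 0]] by simp
qed

lemma definable_ex1:
  assumes "definable P R" shows "definable P (\<lambda>u V. \<exists>n. R (u(x := n)) V)"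
proof -
  obtain \<phi> where "\<forall>u V. sat P u V \<phi> \<longleftrightarrow> R u V" using assms unfolding definable_def by blast
  then show ?thesis unfolding definable_def by (intro exI[of _ "Ex1 x \<phi>"]) simp
qed

lemma definable_all1:
  assumes "definable P R" shows "definable P (\<lambda>u V. \<forall>n. R (u(x := n)) V)"
  using definable_not[OF definable_ex1[OF definable_not[OF assms], of x]] by simp

lemma definable_subst:
  assumes "definable P R" shows "definable P (\<lambda>u V. R (u(x := u y)) V)"
proof (cases "x = y")
  case False
  have "definable P (\<lambda>u V. \<exists>n. (u(x := n)) x = (u(x := n)) y \<and> R (u(x := n)) V)"
    by (intro definable_ex1 definable_and definable_eq assms)
  then show ?thesis using False by simp
qed (use assms in simp)

lemma definable_ex2:
  assumes "definable P R" shows "definable P (\<lambda>u V. \<exists>A. R u (V(Z := A)))"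
proof -
  obtain \<phi> where "\<forall>u V. sat P u V \<phi> \<longleftrightarrow> R u V" using assms unfolding definable_def by blast
  then show ?thesis unfolding definable_def by (intro exI[of _ "Ex2 Z \<phi>"]) simp
qed

lemma definable_finite_ex:
  assumes "finite I" "\<And>i. i \<in> I \<Longrightarrow> definable P (R i)"
  shows "definable P (\<lambda>u V. \<exists>i\<in>I. R i u V)"
  using assms
proof (induction I rule: finite_induct)
  case empty
  then show ?case using definable_const[of P False] by simp
next
  case (insert i I)
  then show ?case using definable_or[of P "R i" "\<lambda>u V. \<exists>i\<in>I. R i u V"] by simp
qed

lemma definable_finite_all:
  assumes "finite I" "\<And>i. i \<in> I \<Longrightarrow> definable P (R i)"
  shows "definable P (\<lambda>u V. \<forall>i\<in>I. R i u V)"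
  using definable_not[OF definable_finite_ex[OF assms(1), of P "\<lambda>i u V. \<not> R i u V"]] 
    definable_not[OF assms(2)] by simp

lemma definable_ex2_many:
  assumes "finite I" "definable P R"
  shows "definable P (\<lambda>u V. \<exists>W. R u (\<lambda>i. if i \<in> I then W i else V i))"
  using assms(1)
proof (induction I rule: finite_induct)
  case empty
  then show ?case using assms(2) by simp
next
  case (insert j I)
  have "(\<exists>W. R u (\<lambda>i. if i \<in> insert j I then W i else V i)) \<longleftrightarrow>
     (\<exists>A W. R u (\<lambda>i. if i \<in> I then W i else (V(j := A)) i))" for u V
  proof
    assume "\<exists>W. R u (\<lambda>i. if i \<in> insert j I then W i else V i)"
    then obtain W where W: "R u (\<lambda>i. if i \<in> insert j I then W i else V i)" by blast
    have "(\<lambda>i. if i \<in> insert j I then W i else V i) = (\<lambda>i. if i \<in> I then W i else (V(j := W j)) i)"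
      by (rule ext) simp
    then show "\<exists>A W. R u (\<lambda>i. if i \<in> I then W i else (V(j := A)) i)" using W by metis
  next
    assume "\<exists>A W. R u (\<lambda>i. if i \<in> I then W i else (V(j := A)) i)"
    then obtain A W where W: "R u (\<lambda>i. if i \<in> I then W i else (V(j := A)) i)" by blast
    have "(\<lambda>i. if i \<in> I then W i else (V(j := A)) i) =
       (\<lambda>i. if i \<in> insert j I then (W(j := A)) i else V i)" by (rule ext) (use insert.hyps in auto)
    then show "\<exists>W. R u (\<lambda>i. if i \<in> insert j I then W i else V i)" using W by metis
  qed
  then show ?case using definable_ex2[OF insert.IH, of j] by simp
qed

lemma definable_all2_many:
  assumes "finite I" "definable P R"
  shows "definable P (\<lambda>u V. \<forall>W. R u (\<lambda>i. if i \<in> I then W i else V i))"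
  using definable_not[OF definable_ex2_many[OF assms(1) definable_not[OF assms(2)]]] by simp

lemma definable_suc[defin]: "definable P (\<lambda>u V. u y = Suc (u x))"
proof -
  define z where "z = Suc (x + y)"
  have z: "z \<noteq> x" "z \<noteq> y" by (auto simp: z_def)
  have "definable P (\<lambda>u V. u x < u y \<and> (\<forall>n. \<not> ((u(z := n)) x < (u(z := n)) z \<and> (u(z := n)) z < (u(z := n)) y)))"
    by (intro defin definable_all1)
  moreover have "(u x < u y \<and> (\<forall>n. \<not> ((u(z := n)) x < (u(z := n)) z \<and> (u(z := n)) z < (u(z := n)) y))) \<longleftrightarrow>
     u y = Suc (u x)" for u :: "nat \<Rightarrow> nat"
    using z by auto
  ultimately show ?thesis by simp
qed

lemma definable_number[defin]: "definable P (\<lambda>u V. u x = k)"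
proof (induction k arbitrary: x)
  case 0
  have "definable P (\<lambda>u V. \<forall>n. \<not> (u(Suc x := n)) (Suc x) < (u(Suc x := n)) x)"
    by (intro definable_all1 defin)
  moreover have "(\<forall>n. \<not> (u(Suc x := n)) (Suc x) < (u(Suc x := n)) x) \<longleftrightarrow> u x = 0" for u :: "nat \<Rightarrow> nat"
    by auto
  ultimately show ?case by simp
next
  case (Suc k)
  have "definable P (\<lambda>u V. \<exists>n. (u(Suc x := n)) x = Suc ((u(Suc x := n)) (Suc x)) \<and> (u(Suc x := n)) (Suc x) = k)"
    by (intro definable_ex1 defin Suc)
  then show ?case by simp
qed

text \<open>A run is determined, so \<open>q\<close> is reached at \<open>n\<close> iff \<open>n\<close> lies in the \<open>q\<close>-th component of every
  family of sets that contains the start and is closed under the transitions.\<close>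

lemma definable_run:
  fixes a :: "nat set \<Rightarrow> nat \<Rightarrow> 'l" and \<delta> :: "'q \<Rightarrow> 'l \<Rightarrow> 'q"
  assumes L: "finite L" "\<And>X n. a X n \<in> L"
    and a: "\<And>l. l \<in> L \<Longrightarrow> definable P (\<lambda>u V. a (V 0) (u 0) = l)"
    and Q: "finite Q" "q0 \<in> Q" "\<And>q l. q \<in> Q \<Longrightarrow> l \<in> L \<Longrightarrow> \<delta> q l \<in> Q" "q \<in> Q"
  shows "definable P (\<lambda>u V. u 0 \<le> u 1 \<and> foldl \<delta> q0 (map (a (V 0)) [u 0..<u 1]) = q)"
proof -
  obtain e :: "'q \<Rightarrow> nat" where e: "inj_on e Q" using finite_imp_inj_to_nat_seg[OF Q(1)] by blast
  \<comment> \<open>Set variable 0 holds the input X, so the states are represented by positive set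
    variables.\<close>
  define v where "v q = Suc (e q)" for q
  have v: "v p = v p' \<longleftrightarrow> p = p'" if "p \<in> Q" "p' \<in> Q" for p p'
    using e that by (auto simp: v_def inj_on_def)
  define I where "I = v ` Q"
  have I: "finite I" "0 \<notin> I" "\<And>p. p \<in> Q \<Longrightarrow> v p \<in> I" using Q(1) by (auto simp: I_def v_def)
  define C where "C u V \<longleftrightarrow> (\<forall>n. (u(2 := n)) 0 \<le> (u(2 := n)) 2 \<and> (u(2 := n)) 2 < (u(2 := n)) 1 \<longrightarrow>
     (\<forall>p\<in>Q. \<forall>l\<in>L. (u(2 := n)) 2 \<in> V (v p) \<and> a (V 0) ((u(2 := n)) 2) = l \<longrightarrow>
       (\<exists>k. (u(2 := n, 3 := k)) 3 = Suc ((u(2 := n, 3 := k)) 2) \<and> (u(2 := n, 3 := k)) 3 \<in> V (v (\<delta> p l)))))"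
    for u :: "nat \<Rightarrow> nat" and V :: "nat \<Rightarrow> nat set"
  have Ciff: "C u V \<longleftrightarrow> (\<forall>n. u 0 \<le> n \<and> n < u 1 \<longrightarrow>
     (\<forall>p\<in>Q. n \<in> V (v p) \<longrightarrow> Suc n \<in> V (v (\<delta> p (a (V 0) n)))))" for u V
    unfolding C_def using L(2) by auto
  have a2: "definable P (\<lambda>u V. a (V 0) (u 2) = l)" if "l \<in> L" for l
    using definable_subst[OF a[OF that], of 0 2] by simp
  have "definable P (\<lambda>u V. \<exists>k. (u(3 := k)) 3 = Suc ((u(3 := k)) 2) \<and> (u(3 := k)) 3 \<in> V (v (\<delta> p l)))" for p l
    by (intro definable_ex1 defin)
  then have defC: "definable P C" unfolding C_def
    by (intro definable_all1[where R = "\<lambda>u V. u 0 \<le> u 2 \<and> u 2 < u 1 \<longrightarrow>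
     (\<forall>p\<in>Q. \<forall>l\<in>L. u 2 \<in> V (v p) \<and> a (V 0) (u 2) = l \<longrightarrow>
       (\<exists>k. (u(3 := k)) 3 = Suc ((u(3 := k)) 2) \<and> (u(3 := k)) 3 \<in> V (v (\<delta> p l))))"]
       defin definable_finite_all Q(1) L(1) a2)
  have "definable P (\<lambda>u V. u 0 \<le> u 1 \<and>
     (\<forall>W. (\<lambda>u V. u 0 \<in> V (v q0) \<and> C u V \<longrightarrow> u 1 \<in> V (v q)) u (\<lambda>i. if i \<in> I then W i else V i)))"
    by (intro definable_and definable_le definable_all2_many I(1) definable_imp defC definable_mem)
  moreover have "(\<forall>W. (\<lambda>u V. u 0 \<in> V (v q0) \<and> C u V \<longrightarrow> u 1 \<in> V (v q)) u (\<lambda>i. if i \<in> I then W i else V i)) \<longleftrightarrow>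
      foldl \<delta> q0 (map (a (V 0)) [u 0..<u 1]) = q" if le: "u 0 \<le> u 1" for u V
  proof -
    define st where "st n = foldl \<delta> q0 (map (a (V 0)) [u 0..<n])" for n
    have st0: "st (u 0) = q0" by (simp add: st_def)
    have stS: "st (Suc n) = \<delta> (st n) (a (V 0) n)" if "u 0 \<le> n" for n using that by (simp add: st_def)
    have stQ: "st n \<in> Q" if "u 0 \<le> n" for n
      using that by (induction n rule: dec_induct) (auto simp: st0 stS Q L(2))
    have Cw: "C u (\<lambda>i. if i \<in> I then W i else V i) \<longleftrightarrow> (\<forall>n. u 0 \<le> n \<and> n < u 1 \<longrightarrow>
     (\<forall>p\<in>Q. n \<in> W (v p) \<longrightarrow> Suc n \<in> W (v (\<delta> p (a (V 0) n)))))" for W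
      unfolding Ciff using I(2,3) Q(3) L(2) by simp
    show ?thesis
    proof
      assume *: "\<forall>W. (\<lambda>u V. u 0 \<in> V (v q0) \<and> C u V \<longrightarrow> u 1 \<in> V (v q)) u (\<lambda>i. if i \<in> I then W i else V i)"
      \<comment> \<open>The actual run, as a closed family of sets: what belongs to all closed
        families belongs to this one.\<close>
      define W where "W i = {n. u 0 \<le> n \<and> v (st n) = i}" for i
      have "u 0 \<in> W (v q0)" by (simp add: W_def st0)
      moreover have "C u (\<lambda>i. if i \<in> I then W i else V i)"
        unfolding Cw by (auto simp: W_def v stQ stS)
      ultimately have "u 1 \<in> W (v q)"
        using *[rule_format, of W] I(3) Q(2,4) by simp
      then show "foldl \<delta> q0 (map (a (V 0)) [u 0..<u 1]) = q"
        using v[OF stQ[OF le] Q(4)] by (simp add: W_def flip: st_def)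
    next
      assume q: "foldl \<delta> q0 (map (a (V 0)) [u 0..<u 1]) = q"
      show "\<forall>W. (\<lambda>u V. u 0 \<in> V (v q0) \<and> C u V \<longrightarrow> u 1 \<in> V (v q)) u (\<lambda>i. if i \<in> I then W i else V i)"
      proof
        fix W
        have "u 1 \<in> W (v q)" if *: "u 0 \<in> W (v q0)" "C u (\<lambda>i. if i \<in> I then W i else V i)"
        proof -
          have "n \<le> u 1 \<longrightarrow> n \<in> W (v (st n))" if "u 0 \<le> n" for n
            using that
          proof (induction n rule: dec_induct)
            case base
            then show ?case using *(1) by (simp add: st0)
          next
            case (step n)
            then show ?case using *(2)[unfolded Cw] stQ[of n] by (auto simp: stS)
          qed
          then show ?thesis using le q by (auto simp: st_def)
        qed
        then show "(\<lambda>u V. u 0 \<in> V (v q0) \<and> C u V \<longrightarrow> u 1 \<in> V (v q)) u (\<lambda>i. if i \<in> I then W i else V i)"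
          using I(3) Q(2,4) by simp
      qed
    qed
  qed
  ultimately show ?thesis by (simp cong: conj_cong)
qed

text \<open>A variable on which truth does not depend is removed from the free variables by
  quantifying over it.\<close>

lemma drop_free1:
  assumes "finite A" "\<And>x. x \<in> A \<Longrightarrow> \<forall>u V n. sat P (u(x := n)) V \<phi> \<longleftrightarrow> sat P u V \<phi>"
  shows "\<exists>\<psi>. free1 \<psi> \<subseteq> free1 \<phi> - A \<and> free2 \<psi> \<subseteq> free2 \<phi> \<and> (\<forall>u V. sat P u V \<psi> \<longleftrightarrow> sat P u V \<phi>)"
  using assms
proof (induction A rule: finite_induct)
  case empty
  then show ?case by auto
next
  case (insert x A)
  then obtain \<psi> where \<psi>: "free1 \<psi> \<subseteq> free1 \<phi> - A" "free2 \<psi> \<subseteq> free2 \<phi>" "\<forall>u V. sat P u V \<psi> \<longleftrightarrow> sat P u V \<phi>"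
    by auto
  have "sat P (u(x := n)) V \<phi> \<longleftrightarrow> sat P u V \<phi>" for u V n using insert.prems[OF insertI1] by blast
  then have "\<forall>u V. sat P u V (Ex1 x \<psi>) \<longleftrightarrow> sat P u V \<phi>" using \<psi>(3) by simp
  with \<psi>(1,2) show ?case by (intro exI[of _ "Ex1 x \<psi>"]) auto
qed

lemma drop_free2:
  assumes "finite A" "\<And>Z. Z \<in> A \<Longrightarrow> \<forall>u V B. sat P u (V(Z := B)) \<phi> \<longleftrightarrow> sat P u V \<phi>"
  shows "\<exists>\<psi>. free1 \<psi> \<subseteq> free1 \<phi> \<and> free2 \<psi> \<subseteq> free2 \<phi> - A \<and> (\<forall>u V. sat P u V \<psi> \<longleftrightarrow> sat P u V \<phi>)"
  using assms
proof (induction A rule: finite_induct)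
  case empty
  then show ?case by auto
next
  case (insert Z A)
  then obtain \<psi> where \<psi>: "free1 \<psi> \<subseteq> free1 \<phi>" "free2 \<psi> \<subseteq> free2 \<phi> - A" "\<forall>u V. sat P u V \<psi> \<longleftrightarrow> sat P u V \<phi>"
    by auto
  have "sat P u (V(Z := B)) \<phi> \<longleftrightarrow> sat P u V \<phi>" for u V B using insert.prems[OF insertI1] by blast
  then have "\<forall>u V. sat P u V (Ex2 Z \<psi>) \<longleftrightarrow> sat P u V \<phi>" using \<psi>(3) by simp
  with \<psi>(1,2) show ?case by (intro exI[of _ "Ex2 Z \<psi>"]) auto
qed

lemma definable_formula:
  assumes "definable P (\<lambda>u V. D (u 0) (V 0))"
  obtains \<phi> where "free1 \<phi> \<subseteq> {0}" "free2 \<phi> \<subseteq> {0}" "\<And>u V. sat P u V \<phi> \<longleftrightarrow> D (u 0) (V 0)"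
proof -
  obtain \<phi> where \<phi>: "\<And>u V. sat P u V \<phi> \<longleftrightarrow> D (u 0) (V 0)" using assms unfolding definable_def by blast
  obtain \<psi> where \<psi>: "free1 \<psi> \<subseteq> free1 \<phi> - (free1 \<phi> - {0})" "\<And>u V. sat P u V \<psi> \<longleftrightarrow> sat P u V \<phi>"
    using drop_free1[of "free1 \<phi> - {0}" P \<phi>] by (auto simp: \<phi> finite_free)
  obtain \<chi> where \<chi>: "free1 \<chi> \<subseteq> free1 \<psi>" "free2 \<chi> \<subseteq> free2 \<psi> - (free2 \<psi> - {0})" "\<And>u V. sat P u V \<chi> \<longleftrightarrow> sat P u V \<psi>"
    using drop_free2[of "free2 \<psi> - {0}" P \<psi>] by (auto simp: \<phi> \<psi> finite_free)
  show ?thesis by (rule that[of \<chi>]) (use \<phi> \<psi> \<chi> in auto)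
qed


section \<open>Strategies along a homogeneous parameter\<close>

type_synonym move = "bool \<times> bool \<times> bool"

definition play :: "nat set \<Rightarrow> nat set \<Rightarrow> nat set \<Rightarrow> move word" where
  "play X Y P n = (n \<in> X, n \<in> Y, n \<in> P)"

text \<open>Letters of a play become tracks: none for first-order variables, set variables 0 and 1
  for X and Y. The states are the values of \<open>st\<close>; transitions go through a chosen word
  that reaches the state, and the choice does not matter because \<open>st\<close> and
  \<open>pr\<close> respect appending a letter.\<close>

theorem spec_automaton:
  assumes "\<psi> \<in> specs"
  obtains Q :: "(nat \<times> nat \<times> nat list) list set" and q0 \<delta> \<kappa> b where
    "finite Q" "q0 \<in> Q" "\<And>q a. q \<in> Q \<Longrightarrow> \<delta> q a \<in> Q" "\<And>q a. \<kappa> q a \<le> b"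
    "\<And>X Y P. holds \<psi> X Y P \<longleftrightarrow>
       good (\<lambda>n. \<kappa> (foldl \<delta> q0 (map (play X Y P) [0..<n])) (play X Y P n))"
proof -
  obtain h where h: "fin_cong h" "recognizes h \<psi>" using recognizable by blast
  define tl where "tl = (\<lambda>(x, y, p). ({} :: nat set, {Z :: nat. Z = 0 \<and> x \<or> Z = 1 \<and> y}, p :: bool))"
  define g where "g u = h (map tl u)" for u
  define L where "L w \<longleftrightarrow> holds \<psi> {n. fst (w n)} {n. fst (snd (w n))} {n. snd (snd (w n))}" for w :: "move word"
  have fg: "fin_cong g"
  proof (rule fin_congI)
    show "finite (range g)"
      by (rule finite_subset[OF _ fin_cong_finite[OF h(1)]]) (auto simp: g_def)
    show "g (u @ v) = g (u' @ v')" if "g u = g u'" "g v = g v'" for u u' v v'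
      using fin_congD[OF h(1), of "map tl u" "map tl u'" "map tl v" "map tl v'"] that by (simp add: g_def)
  qed
  have cod: "codes \<psi> (\<lambda>n. tl (w n)) (\<lambda>_. 0) ((\<lambda>_. {})(0 := {n. fst (w n)}, 1 := {n. fst (snd (w n))}))
      {n. snd (snd (w n))}" for w
    using assms by (auto simp: codes_def specs_def tl_def split: prod.splits)
  have sat: "L w'" if fe: "factor_eq g w c w' c'" and "L w" for w w' c c'
  proof -
    have "factor_eq h (\<lambda>n. tl (w n)) c (\<lambda>n. tl (w' n)) c'"
      using fe by (simp add: factor_eq_def g_def comp_def del: upt_Suc)
    from recognizes_swap[OF h(2) cod cod this] show ?thesis using \<open>L w\<close> unfolding L_def holds_def by blast
  qed
  have ex: "\<exists>(st :: move list \<Rightarrow> (nat \<times> nat \<times> nat list) list) pr b. finite (range st) \<and>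
     (\<forall>u v a. st u = st v \<longrightarrow> st (u @ [a]) = st (v @ [a]) \<and> pr u a = pr v a) \<and>
     (\<forall>u a. pr u a \<le> b) \<and> (\<forall>w. L w \<longleftrightarrow> good (\<lambda>k. pr (map w [0..<k]) (w k)))"
    by (rule determinization[OF fg]) (rule sat)
  obtain st :: "move list \<Rightarrow> (nat \<times> nat \<times> nat list) list" and pr b where D: "finite (range st)"
     "\<And>u v a. st u = st v \<Longrightarrow> st (u @ [a]) = st (v @ [a]) \<and> pr u a = pr v a"
     "\<And>u a. pr u a \<le> b" "\<And>w. L w \<longleftrightarrow> good (\<lambda>k. pr (map w [0..<k]) (w k))"
    using ex by blast
  define rep where "rep q = (SOME u. st u = q)" for q
  have rep: "st (rep (st u)) = st u" for u unfolding rep_def by (rule someI[of _ u]) simp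
  define \<delta> where "\<delta> q a = st (rep q @ [a])" for q a
  define \<kappa> where "\<kappa> q a = pr (rep q) a" for q a
  have d: "\<delta> (st u) a = st (u @ [a])" "\<kappa> (st u) a = pr u a" for u a
    using D(2)[OF rep] by (simp_all add: \<delta>_def \<kappa>_def)
  have run: "foldl \<delta> (st []) u = st u" for u
    by (induction u rule: rev_induct) (simp_all add: d)
  show ?thesis
  proof (rule that[of "range st" "st []" \<delta> \<kappa> b])
    fix X Y P
    have "holds \<psi> X Y P \<longleftrightarrow> L (play X Y P)" by (simp add: L_def play_def)
    then show "holds \<psi> X Y P \<longleftrightarrow>
       good (\<lambda>n. \<kappa> (foldl \<delta> (st []) (map (play X Y P) [0..<n])) (play X Y P n))"
      by (simp add: D(4) run d(2))
  qed (use D(1,3) in \<open>auto simp: \<delta>_def \<kappa>_def\<close>)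
qed

lemma INFM_Suc: "(\<exists>\<^sub>\<infinity>n. P (Suc n)) \<longleftrightarrow> (\<exists>\<^sub>\<infinity>n::nat. P n)"
  using INFM_shift[of P 1] by simp

text \<open>Passing from segment minima to all priorities keeps the limit. The shift to
  \<open>c (Suc i)\<close> reflects the finite game, in which the vertex at the end of a segment
  carries the minimum of that segment.\<close>

lemma segment_limits:
  assumes h: "strict_mono (h :: nat \<Rightarrow> nat)"
    and c: "\<And>i. \<exists>n. h i \<le> n \<and> n < h (Suc i) \<and> \<kappa> n = c (Suc i)"
    and le: "\<And>i n. h i \<le> n \<Longrightarrow> n < h (Suc i) \<Longrightarrow> c (Suc i) \<le> \<kappa> n"
  shows "good c \<Longrightarrow> good \<kappa>" "bad c \<Longrightarrow> bad \<kappa>"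
proof -
  have inc: "i \<le> h i" for i using strict_mono_imp_increasing[OF h] .
  have 1: "\<exists>\<^sub>\<infinity>n. \<kappa> n = k" if "\<exists>\<^sub>\<infinity>i. c i = k" for k
    unfolding INFM_nat_le
  proof
    fix m
    have "\<exists>\<^sub>\<infinity>i. c (Suc i) = k" using that INFM_Suc[of "\<lambda>i. c i = k"] by blast
    then obtain i where i: "m \<le> i" "c (Suc i) = k" unfolding INFM_nat_le by blast
    obtain n where "h i \<le> n" "\<kappa> n = c (Suc i)" using c by blast
    then show "\<exists>n\<ge>m. \<kappa> n = k" using i inc[of i] by (intro exI[of _ n]) auto
  qed
  have 2: "\<forall>\<^sub>\<infinity>n. k \<le> \<kappa> n" if k: "\<forall>\<^sub>\<infinity>i. k \<le> c i" for k
  proof -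
    obtain I where I: "\<And>i. i \<ge> I \<Longrightarrow> k \<le> c i" using k unfolding MOST_nat_le by blast
    have "k \<le> \<kappa> n" if n: "h I \<le> n" for n
    proof -
      define i where "i = (GREATEST i. h i \<le> n)"
      have b: "\<And>j. h j \<le> n \<Longrightarrow> j \<le> n" using inc le_trans by blast
      have i: "h i \<le> n" unfolding i_def by (rule GreatestI_nat[where P = "\<lambda>i. h i \<le> n", OF n b])
      have "I \<le> i" unfolding i_def by (rule Greatest_le_nat[where P = "\<lambda>i. h i \<le> n", OF n b])
      have "n < h (Suc i)"
      proof (rule ccontr)
        assume "\<not> n < h (Suc i)"
        then have "h (Suc i) \<le> n" by simp
        from Greatest_le_nat[where P = "\<lambda>i. h i \<le> n", OF this b] show False unfolding i_def by simp
      qed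
      with i have "c (Suc i) \<le> \<kappa> n" by (rule le)
      moreover have "k \<le> c (Suc i)" using I \<open>I \<le> i\<close> by simp
      ultimately show ?thesis by simp
    qed
    then show ?thesis unfolding MOST_nat_le by blast
  qed
  show "good c \<Longrightarrow> good \<kappa>" "bad c \<Longrightarrow> bad \<kappa>" using 1 2 unfolding good_def bad_def by blast+
qed

text \<open>Fresh variables serve as intermediate names, since x and y may themselves be 0 or 1 in
  any combination.\<close>

lemma definable_subst_binary:
  assumes "definable P (\<lambda>u V. D (u 0) (u 1) (V 0))"
  shows "definable P (\<lambda>u V. D (u x) (u y) (V 0))"
proof -
  define a where "a = x + y + 2"
  have a: "a \<noteq> 0" "a \<noteq> 1" "a \<noteq> x" "a \<noteq> y" "Suc a \<noteq> 0" "Suc a \<noteq> 1" "Suc a \<noteq> x" "Suc a \<noteq> y"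
    by (auto simp: a_def)
  have "definable P (\<lambda>u V. D (u 0) (u a) (V 0))" using definable_subst[OF assms, of 1 a] by simp
  then have "definable P (\<lambda>u V. D (u (Suc a)) (u a) (V 0))" using definable_subst[of P "\<lambda>u V. D (u 0) (u a) (V 0)" 0 "Suc a"] a by simp
  then have "definable P (\<lambda>u V. D (u (Suc a)) (u y) (V 0))" using definable_subst[of P "\<lambda>u V. D (u (Suc a)) (u a) (V 0)" a y] a by simp
  then show ?thesis using definable_subst[of P "\<lambda>u V. D (u (Suc a)) (u y) (V 0)" "Suc a" x] a by simp
qed

lemma foldl_run_definable:
  fixes a :: "nat set \<Rightarrow> nat \<Rightarrow> 'l" and \<delta> :: "'q \<Rightarrow> 'l \<Rightarrow> 'q"
  assumes L: "finite L" "\<And>X n. a X n \<in> L"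
    and a: "\<And>l. l \<in> L \<Longrightarrow> definable P (\<lambda>u V. a (V 0) (u 0) = l)"
    and Q: "finite Q" "q0 \<in> Q" "\<And>q l. q \<in> Q \<Longrightarrow> l \<in> L \<Longrightarrow> \<delta> q l \<in> Q" "q \<in> Q"
  shows "definable P (\<lambda>u V. u x \<le> u y \<and> foldl \<delta> q0 (map (a (V 0)) [u x..<u y]) = q)"
  using definable_subst_binary[of P "\<lambda>m n X. m \<le> n \<and> foldl \<delta> q0 (map (a X) [m..<n]) = q" x y]
    definable_run[OF L a Q] by simp


section \<open>The finite game induced by segments of the parameter\<close>

locale parity_automaton =
  fixes Q :: "'q set" and q0 :: 'q and \<delta> :: "'q \<Rightarrow> move \<Rightarrow> 'q" and \<kappa> :: "'q \<Rightarrow> move \<Rightarrow> nat" and b :: nat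
  assumes finQ: "finite Q" and q0Q: "q0 \<in> Q" and \<delta>Q: "\<And>q a. q \<in> Q \<Longrightarrow> \<delta> q a \<in> Q"
    and \<kappa>b: "\<And>q a. \<kappa> q a \<le> b"
begin

text \<open>While a segment is being played, the state records the automaton state and the least priority
  seen in the segment.\<close>

definition V :: "('q \<times> nat) set" where "V = Q \<times> {..b}"

definition step :: "'q \<times> nat \<Rightarrow> move \<Rightarrow> 'q \<times> nat" where
  "step s a = (\<delta> (fst s) a, min (snd s) (\<kappa> (fst s) a))"

text \<open>At each position the player of X moves, the player of Y answers, and the parameter bit
  is given; U is a target that the player of Y sets for the state after the whole word.\<close>

primrec forces :: "bool list \<Rightarrow> 'q \<times> nat \<Rightarrow> ('q \<times> nat) set \<Rightarrow> bool" where
  "forces [] s U \<longleftrightarrow> s \<in> U"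
| "forces (p # \<pi>) s U \<longleftrightarrow> (\<forall>x. \<exists>y. forces \<pi> (step s (x, y, p)) U)"

definition F :: "bool list \<Rightarrow> (('q \<times> nat) \<times> ('q \<times> nat) set) set" where
  "F \<pi> = {(s, U). s \<in> V \<and> U \<subseteq> V \<and> forces \<pi> s U}"

lemma finV: "finite V"
  using finQ by (simp add: V_def)

lemma step_V: "s \<in> V \<Longrightarrow> step s a \<in> V"
  using \<delta>Q[of "fst s" a] by (auto simp: V_def step_def)

lemma forces_mono: "forces \<pi> s U \<Longrightarrow> U \<subseteq> U' \<Longrightarrow> forces \<pi> s U'"
proof (induction \<pi> arbitrary: s)
  case (Cons p \<pi>)
  then show ?case unfolding forces.simps by metis
qed auto

lemma forces_append: "s \<in> V \<Longrightarrow> forces (\<pi> @ \<rho>) s U \<longleftrightarrow> forces \<pi> s {s' \<in> V. forces \<rho> s' U}"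
  by (induction \<pi> arbitrary: s) (auto simp: step_V)

text \<open>To force U along a concatenation is to force, along the first word, the set of states
  from which U is forced along the second. Hence the value of a concatenation is determined by the
  two values.\<close>

lemma fin_cong_F: "fin_cong F"
proof (rule fin_congI)
  have "range F \<subseteq> Pow (V \<times> Pow V)" by (auto simp: F_def)
  then show "finite (range F)" using finV by (simp add: finite_subset)
  have *: "F (\<pi> @ \<rho>) \<subseteq> F (\<pi>' @ \<rho>')" if "F \<pi> = F \<pi>'" "F \<rho> = F \<rho>'" for \<pi> \<rho> \<pi>' \<rho>'
  proof
    fix z assume "z \<in> F (\<pi> @ \<rho>)"
    then obtain s U where z: "z = (s, U)" "s \<in> V" "U \<subseteq> V" "forces (\<pi> @ \<rho>) s U" by (auto simp: F_def)
    have "forces \<rho> s' U \<longleftrightarrow> forces \<rho>' s' U" if "s' \<in> V" for s'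
    proof -
      have "(s', U) \<in> F \<rho> \<longleftrightarrow> (s', U) \<in> F \<rho>'" using \<open>F \<rho> = F \<rho>'\<close> by simp
      then show ?thesis using that z by (simp add: F_def)
    qed
    then have "{s' \<in> V. forces \<rho> s' U} = {s' \<in> V. forces \<rho>' s' U}" by auto
    then have "(s, {s' \<in> V. forces \<rho>' s' U}) \<in> F \<pi>"
      using z forces_append[of s \<pi> \<rho> U] by (simp add: F_def)
    then have "(s, {s' \<in> V. forces \<rho>' s' U}) \<in> F \<pi>'" using that by simp
    then show "z \<in> F (\<pi>' @ \<rho>')" using z forces_append[of s \<pi>' \<rho>' U] by (simp add: F_def)
  qed
  show "F (\<pi> @ \<rho>) = F (\<pi>' @ \<rho>')" if "F \<pi> = F \<pi>'" "F \<rho> = F \<rho>'" for \<pi> \<rho> \<pi>' \<rho>'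
    using *[OF that] *[OF that[symmetric]] by (rule subset_antisym)
qed

text \<open>The sets forced by the player of X are defined by negation: the player of Y cannot force
  the complement. Duality then reduces to monotonicity of forcing. The component b bounds all
  priorities, so it is neutral for the minimum and opens a new segment.\<close>

lemma dual_families_forces:
  assumes "e = F \<pi>"
  shows "dual_families V (\<lambda>v. {U. U \<subseteq> V \<and> ((fst v, b), U) \<in> e}) (\<lambda>v. {U. U \<subseteq> V \<and> ((fst v, b), V - U) \<notin> e})"
  unfolding dual_families_def
proof (intro ballI conjI allI impI)
  fix v Z assume v: "v \<in> V" "Z \<subseteq> V"
  then have VZ: "V - (V - Z) = Z" by auto
  show "(\<exists>U\<in>{U. U \<subseteq> V \<and> ((fst v, b), U) \<in> e}. U \<subseteq> Z) \<or>
     (\<exists>U\<in>{U. U \<subseteq> V \<and> ((fst v, b), V - U) \<notin> e}. U \<subseteq> V - Z)"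
  proof (cases "((fst v, b), Z) \<in> e")
    case False
    then have "V - Z \<in> {U. U \<subseteq> V \<and> ((fst v, b), V - U) \<notin> e}" by (simp add: VZ)
    then show ?thesis by blast
  qed (use v in blast)
next
  fix v U U' assume v: "v \<in> V" and U: "U \<in> {U. U \<subseteq> V \<and> ((fst v, b), U) \<in> e}"
    and U': "U' \<in> {U. U \<subseteq> V \<and> ((fst v, b), V - U) \<notin> e}"
  show "U \<inter> U' \<noteq> {}"
  proof
    assume "U \<inter> U' = {}"
    then have "U \<subseteq> V - U'" using U by auto
    then have "((fst v, b), V - U') \<in> e" using U forces_mono unfolding assms F_def by auto
    then show False using U' by simp
  qed
qed

end

text \<open>The parameter \<open>P\<close> is cut into segments with the same value \<open>e\<close> under \<open>F\<close>. A homogeneous set \<open>Y\<close>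
  is given by Ramsey's theorem; the cut points \<open>hs i\<close> are chosen so as to be definable.\<close>

locale homogeneous = parity_automaton Q q0 \<delta> \<kappa> b
  for Q :: "'q set" and q0 :: 'q and \<delta> :: "'q \<Rightarrow> move \<Rightarrow> 'q" and \<kappa> :: "'q \<Rightarrow> move \<Rightarrow> nat" and b :: nat +
  fixes P Y :: "nat set" and r0 :: nat and e :: "(('q \<times> nat) \<times> ('q \<times> nat) set) set"
  assumes r0: "0 < r0" "r0 \<in> Y" and Y: "infinite Y"
    and hom: "\<And>i j. i \<in> Y \<Longrightarrow> j \<in> Y \<Longrightarrow> i < j \<Longrightarrow> F (map (\<lambda>n. n \<in> P) [i..<j]) = e"
begin

definition sg :: "nat \<Rightarrow> nat \<Rightarrow> bool list" where
  "sg i j = map (\<lambda>n. n \<in> P) [i..<j]"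

text \<open>Merging with r0 replaces membership in the Ramsey set: it is definable, it holds for the
  elements of Y beyond r0, and a near position sees the value e at late elements of Y, just as r0
  does.\<close>

definition near :: "nat \<Rightarrow> bool" where
  "near n \<longleftrightarrow> (\<exists>k. n \<le> k \<and> r0 \<le> k \<and> F (sg n k) = F (sg r0 k))"

primrec hs :: "nat \<Rightarrow> nat" where
  "hs 0 = r0"
| "hs (Suc i) = (LEAST n. hs i < n \<and> near n \<and> F (sg (hs i) n) = e)"

declare hs.simps(2)[simp del]

definition nx :: "nat \<Rightarrow> nat" where
  "nx n = (LEAST k. n < k \<and> k \<in> range hs)"

text \<open>The strategy consults the value of the part of the current segment that is still to
  come. This concerns the future of P but not of the opponent's moves, so causality is
  unaffected.\<close>

definition adv :: "nat \<Rightarrow> (('q \<times> nat) \<times> ('q \<times> nat) set) set" where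
  "adv n = F (sg (Suc n) (nx n))"

lemma sg_append: "i \<le> j \<Longrightarrow> j \<le> k \<Longrightarrow> sg i j @ sg j k = sg i k"
  by (simp add: sg_def upt_append flip: map_append)

text \<open>An element y of Y after the merging time k works: the segment from m to y has the value
  of the one from r0 to y, which is e; and y is near because both y and r0 see e at any later
  element of Y.\<close>

lemma near_next:
  assumes "near m"
  shows "\<exists>n. m < n \<and> near n \<and> F (sg m n) = e"
proof -
  have ex: "\<exists>y\<in>Y. k < y" for k using Y infinite_nat_iff_unbounded by blast
  obtain k where k: "m \<le> k" "r0 \<le> k" "F (sg m k) = F (sg r0 k)" using assms near_def by blast
  obtain y where y: "y \<in> Y" "k < y" using ex by blast
  obtain z where z: "z \<in> Y" "y < z" using ex by blast
  have "F (sg m k @ sg k y) = F (sg r0 k @ sg k y)" by (rule fin_congD[OF fin_cong_F k(3) refl])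
  then have "F (sg m y) = F (sg r0 y)" using k y by (simp add: sg_append)
  also have "\<dots> = e" using hom[OF r0(2) y(1)] k y by (simp add: sg_def)
  finally have "F (sg m y) = e" .
  moreover have "F (sg y z) = F (sg r0 z)" 
    using hom[OF r0(2) z(1)] hom[OF y(1) z(1)] k y z by (simp add: sg_def)
  then have "near y" unfolding near_def using k y z by (intro exI[of _ z]) simp
  ultimately show ?thesis using k y by (intro exI[of _ y]) simp
qed

lemma near_hs: "near (hs i)"
  and hs_Suc: "hs i < hs (Suc i) \<and> near (hs (Suc i)) \<and> F (sg (hs i) (hs (Suc i))) = e"
proof -
  have *: "hs i < hs (Suc i) \<and> near (hs (Suc i)) \<and> F (sg (hs i) (hs (Suc i))) = e" if "near (hs i)" for i
    unfolding hs.simps(2) by (rule LeastI_ex[OF near_next[OF that]])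
  show n: "near (hs i)" for i
  proof (induction i)
    case 0
    show ?case by (auto simp: near_def)
  next
    case (Suc i)
    then show ?case using * by blast
  qed
  show "hs i < hs (Suc i) \<and> near (hs (Suc i)) \<and> F (sg (hs i) (hs (Suc i))) = e" by (rule *[OF n])
qed

lemma hs_mono: "strict_mono hs"
  using hs_Suc by (simp add: strict_mono_Suc_iff)

lemma nx: "n < nx n" "nx n \<in> range hs"
proof -
  have "\<exists>k. n < k \<and> k \<in> range hs"
    using strict_mono_imp_increasing[OF hs_mono, of "Suc n"] by (intro exI[of _ "hs (Suc n)"]) auto
  from LeastI_ex[OF this] show "n < nx n" "nx n \<in> range hs" unfolding nx_def by blast+
qed

lemma nx_le: "n < k \<Longrightarrow> k \<in> range hs \<Longrightarrow> nx n \<le> k"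
  unfolding nx_def by (rule Least_le) blast

lemma nx_Suc: "Suc n \<in> range hs \<Longrightarrow> nx n = Suc n" "Suc n \<notin> range hs \<Longrightarrow> nx (Suc n) = nx n"
proof -
  show "nx n = Suc n" if "Suc n \<in> range hs"
    using nx_le[OF _ that, of n] nx(1)[of n] by simp
  assume n: "Suc n \<notin> range hs"
  then have "nx n \<noteq> Suc n" using nx(2)[of n] by auto
  then have "Suc n < nx n" using nx(1)[of n] by simp
  then show "nx (Suc n) = nx n"
    using nx_le[of "Suc n" "nx n"] nx_le[of n "nx (Suc n)"] nx[of n] nx[of "Suc n"] by simp
qed

lemma nx_hs: "nx (hs i) = hs (Suc i)"
proof (rule antisym)
  show "nx (hs i) \<le> hs (Suc i)" using hs_Suc by (intro nx_le) auto
  obtain j where j: "nx (hs i) = hs j" using nx(2) by blast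
  then have "i < j" using nx(1)[of "hs i"] hs_mono by (simp add: strict_mono_less)
  then show "hs (Suc i) \<le> nx (hs i)" using hs_mono j by (simp add: strict_mono_less_eq)
qed

lemma nx_0: "nx 0 = r0"
proof (rule antisym)
  show "nx 0 \<le> r0" using r0 by (intro nx_le) (auto intro: range_eqI[of _ _ 0])
  obtain j where j: "nx 0 = hs j" using nx(2) by blast
  then show "r0 \<le> nx 0" using strict_mono_less_eq[OF hs_mono, of 0 j] by simp
qed

definition letter :: "nat set \<Rightarrow> nat \<Rightarrow> bool \<times> bool \<times> bool \<times> (('q \<times> nat) \<times> ('q \<times> nat) set) set" where
  "letter I n = (n \<in> I, n \<in> P, Suc n \<in> range hs, adv n)"

context
  fixes comb :: "bool \<Rightarrow> bool \<Rightarrow> bool \<Rightarrow> move"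
    and out :: "('q \<times> nat) set \<times> ('q \<times> nat) \<Rightarrow> bool \<Rightarrow> bool \<Rightarrow> (('q \<times> nat) \<times> ('q \<times> nat) set) set \<Rightarrow> bool"
    and \<sigma> :: "'q \<times> nat \<Rightarrow> ('q \<times> nat) set"
    and Z :: "('q \<times> nat) set"
begin

text \<open>The memory holds the target set that the player forces at the next cut point, and the state
  within the current segment.\<close>

definition upd where
  "upd m l = (case l of (i, p, r, g) \<Rightarrow>
     let s' = step (snd m) (comb i (out m i p g) p) in if r then (\<sigma> s', (fst s', b)) else (fst m, s'))"

definition mem where
  "mem I n = foldl upd (Z, (q0, b)) (map (letter I) [0..<n])"

definition reply :: "nat \<Rightarrow> nat set \<Rightarrow> bool" where
  "reply n I \<longleftrightarrow> out (mem I n) (n \<in> I) (n \<in> P) (adv n)"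

definition mv :: "nat set \<Rightarrow> nat \<Rightarrow> move" where
  "mv I n = comb (n \<in> I) (reply n I) (n \<in> P)"

text \<open>Written once for both players: \<open>comb\<close> arranges input, answer and parameter
  bit into a letter, \<open>out\<close> chooses the answer, and \<open>Inv s T g\<close> expresses
  that from state s the target T can still be forced along a remainder of value g. \<open>I1\<close>
  preserves this in each move, \<open>I2\<close> makes a segment end in its target, and
  \<open>I3\<close> starts the next segment with the target given by \<sigma>. The end states of the
  segments then form a play of the finite game.\<close>

lemma play_segments:
  assumes Z: "Z \<subseteq> V" and \<sigma>: "\<And>s. s \<in> Z \<Longrightarrow> \<sigma> s \<subseteq> Z"
    and I0: "Inv (q0, b) Z (F (sg 0 r0))"
    and I1: "\<And>s T p \<pi> i. s \<in> V \<Longrightarrow> T \<subseteq> V \<Longrightarrow> Inv s T (F (p # \<pi>)) \<Longrightarrow>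
       Inv (step s (comb i (out (T, s) i p (F \<pi>)) p)) T (F \<pi>)"
    and I2: "\<And>s T. s \<in> V \<Longrightarrow> T \<subseteq> V \<Longrightarrow> Inv s T (F []) \<Longrightarrow> s \<in> T"
    and I3: "\<And>s. s \<in> Z \<Longrightarrow> Inv (fst s, b) (\<sigma> s) e"
  obtains p where "\<And>i. p i \<in> Z \<and> p (Suc i) \<in> \<sigma> (p i)"
    "good (\<lambda>i. snd (p i)) \<Longrightarrow> good (\<lambda>n. \<kappa> (foldl \<delta> q0 (map (mv I) [0..<n])) (mv I n))"
    "bad (\<lambda>i. snd (p i)) \<Longrightarrow> bad (\<lambda>n. \<kappa> (foldl \<delta> q0 (map (mv I) [0..<n])) (mv I n))"
proof -
  define T where "T n = fst (mem I n)" for n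
  define s where "s n = snd (mem I n)" for n
  define s' where "s' n = step (s n) (mv I n)" for n
  define K where "K n = \<kappa> (foldl \<delta> q0 (map (mv I) [0..<n])) (mv I n)" for n
  have mem0: "T 0 = Z" "s 0 = (q0, b)" by (simp_all add: T_def s_def mem_def)
  have memS: "mem I (Suc n) = (if Suc n \<in> range hs then (\<sigma> (s' n), (fst (s' n), b)) else (T n, s' n))" for n
    by (simp add: mem_def upd_def letter_def Let_def s'_def s_def T_def mv_def reply_def)
  have memH: "T (Suc n) = \<sigma> (s' n)" "s (Suc n) = (fst (s' n), b)" if "Suc n \<in> range hs" for n
    using memS that by (simp_all add: T_def s_def)
  have memN: "T (Suc n) = T n" "s (Suc n) = s' n" if "Suc n \<notin> range hs" for n
    using memS that by (simp_all add: T_def s_def)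
  have run: "fst (s n) = foldl \<delta> q0 (map (mv I) [0..<n])" for n
  proof (induction n)
    case (Suc n)
    then show ?case using memH(2)[of n] memN(2)[of n] by (cases "Suc n \<in> range hs") (simp_all add: s'_def step_def)
  qed (simp add: mem0)
  have snds: "snd (s' n) = min (snd (s n)) (K n)" for n by (simp add: s'_def step_def run K_def)
  have Inv': "Inv (s' n) (T n) (F (sg (Suc n) (nx n)))" if "s n \<in> V" "T n \<subseteq> V" "Inv (s n) (T n) (F (sg n (nx n)))" for n
  proof -
    have "sg n (nx n) = (n \<in> P) # sg (Suc n) (nx n)" using nx(1)[of n] by (simp add: sg_def upt_conv_Cons)
    then have "Inv (step (s n) (comb (n \<in> I) (out (T n, s n) (n \<in> I) (n \<in> P) (F (sg (Suc n) (nx n)))) (n \<in> P))) (T n)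
        (F (sg (Suc n) (nx n)))" using I1 that by simp
    moreover have "mem I n = (T n, s n)" by (simp add: T_def s_def)
    ultimately show ?thesis by (simp add: s'_def mv_def reply_def adv_def)
  qed
  have end_seg: "s' n \<in> T n" if "s n \<in> V" "T n \<subseteq> V" "Inv (s n) (T n) (F (sg n (nx n)))" "Suc n \<in> range hs" for n
  proof -
    have "sg (Suc n) (nx n) = []" using nx_Suc(1)[OF that(4)] by (simp add: sg_def)
    then have "Inv (s' n) (T n) (F [])" using Inv'[OF that(1-3)] by simp
    then show ?thesis using I2 step_V that(1,2) by (simp add: s'_def)
  qed
  have inv: "T n \<subseteq> Z \<and> s n \<in> V \<and> Inv (s n) (T n) (F (sg n (nx n)))" for n
  proof (induction n)
    case 0
    show ?case using I0 q0Q by (simp add: mem0 nx_0 V_def)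
  next
    case (Suc n)
    then have V: "T n \<subseteq> V" "s n \<in> V" "Inv (s n) (T n) (F (sg n (nx n)))" using Z by auto
    show ?case
    proof (cases "Suc n \<in> range hs")
      case True
      have "s' n \<in> T n" using end_seg V True by blast
      then have sZ: "s' n \<in> Z" using Suc by blast
      then have "fst (s' n) \<in> Q" using Z by (auto simp: V_def)
      obtain i where i: "Suc n = hs i" using True by blast
      have "F (sg (Suc n) (nx (Suc n))) = e" unfolding i nx_hs using hs_Suc by blast
      then show ?thesis using memH[OF True] I3[OF sZ] \<sigma>[OF sZ] \<open>fst (s' n) \<in> Q\<close> by (simp add: V_def)
    next
      case False
      then show ?thesis using memN[OF False] nx_Suc(2)[OF False] Inv'[OF V(2,1,3)] Suc step_V V(2)
        by (simp add: s'_def)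
    qed
  qed
  have V: "T n \<subseteq> V" "s n \<in> V" "Inv (s n) (T n) (F (sg n (nx n)))" for n using inv Z by blast+
  \<comment> \<open>The state at the cut \<open>hs i\<close> before its second component is reset to
    b, so it still carries the minimum of the segment that has just ended. The subtraction is
    genuine because \<open>r0\<close> is positive.\<close>
  define p where "p i = s' (hs i - 1)" for i
  have hpos: "0 < hs i" for i using r0 strict_mono_less_eq[OF hs_mono, of 0 i] by simp
  then have hSuc: "Suc (hs i - 1) = hs i" for i by simp
  have p: "p i \<in> T (hs i - 1)" for i
    unfolding p_def by (rule end_seg[OF V(2,1,3)]) (simp only: hSuc rangeI)
  have pZ: "p i \<in> Z" for i using p inv by blast
  \<comment> \<open>Between two cuts the target stays fixed, and the second component is the least
    priority seen since the last cut.\<close>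
  have seg: "T n = \<sigma> (p i) \<and> (\<forall>m. hs i \<le> m \<and> m \<le> n \<longrightarrow> snd (s' n) \<le> K m) \<and>
      (\<exists>m. hs i \<le> m \<and> m \<le> n \<and> K m = snd (s' n))" if "hs i \<le> n" "n < hs (Suc i)" for i n
    using that
  proof (induction n rule: dec_induct)
    case base
    have "Suc (hs i - 1) \<in> range hs" by (simp only: hSuc rangeI)
    from memH[OF this] have "T (hs i) = \<sigma> (p i)" "s (hs i) = (fst (p i), b)" by (simp_all only: hSuc p_def)
    moreover then have "snd (s' (hs i)) = K (hs i)" using \<kappa>b by (simp add: snds K_def)
    ultimately show ?case by auto
  next
    case (step n)
    have "Suc n \<notin> range hs"
    proof
      assume "Suc n \<in> range hs"
      then have "hs (Suc i) \<le> Suc n" using nx_le[of "hs i" "Suc n"] step.hyps nx_hs by simp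
      then show False using step.prems by simp
    qed
    from memN[OF this] have "T (Suc n) = T n" "snd (s' (Suc n)) = min (snd (s' n)) (K (Suc n))" by (simp_all add: snds)
    moreover have IH: "T n = \<sigma> (p i) \<and> (\<forall>m. hs i \<le> m \<and> m \<le> n \<longrightarrow> snd (s' n) \<le> K m) \<and>
      (\<exists>m. hs i \<le> m \<and> m \<le> n \<and> K m = snd (s' n))" using step by simp
    moreover have "\<exists>m. hs i \<le> m \<and> m \<le> Suc n \<and> K m = min (snd (s' n)) (K (Suc n))"
    proof (cases "snd (s' n) \<le> K (Suc n)")
      case True
      then show ?thesis using IH le_SucI by (metis min_absorb1)
    next
      case False
      then show ?thesis using step.hyps by (intro exI[of _ "Suc n"]) auto
    qed
    ultimately show ?case by (auto simp: le_Suc_eq min_le_iff_disj)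
  qed
  have last: "hs i \<le> hs (Suc i) - 1" "hs (Suc i) - 1 < hs (Suc i)" for i using hs_Suc[of i] hpos[of "Suc i"] by auto
  have pS: "p (Suc i) \<in> \<sigma> (p i)" for i using seg[OF last] p[of "Suc i"] by simp
  have c1: "\<exists>n. hs i \<le> n \<and> n < hs (Suc i) \<and> K n = snd (p (Suc i))" for i
  proof -
    obtain m where "hs i \<le> m" "m \<le> hs (Suc i) - 1" "K m = snd (p (Suc i))"
      using seg[OF last, of i] unfolding p_def by blast
    then show ?thesis using last(2)[of i] by (intro exI[of _ m]) linarith
  qed
  have c2: "snd (p (Suc i)) \<le> K n" if "hs i \<le> n" "n < hs (Suc i)" for i n
  proof -
    have "n \<le> hs (Suc i) - 1" using that by simp
    then show ?thesis using seg[OF last, of i] that unfolding p_def by blast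
  qed
  note lim = segment_limits[of hs K "\<lambda>i. snd (p i)", OF hs_mono c1 c2]
  show ?thesis
    by (rule that[of p]) (use pZ pS lim in \<open>simp_all flip: K_def\<close>)
qed

end

end


lemma definable_iff_bool:
  assumes "definable P R"
  shows "definable P (\<lambda>u V. R u V = l)"
  using assms definable_not[OF assms] by (cases l) simp_all

section \<open>Definability of the cuts and of the strategy\<close>

context homogeneous
begin

text \<open>Right multiplication by a letter in the quotient by \<open>F\<close>, computed on a
  chosen representative. It makes the values of \<open>F\<close> the states of a deterministic
  automaton, whose runs are definable.\<close>

definition ext :: "(('q \<times> nat) \<times> ('q \<times> nat) set) set \<Rightarrow> bool \<Rightarrow> (('q \<times> nat) \<times> ('q \<times> nat) set) set" where
  "ext g p = F ((SOME \<pi>. F \<pi> = g) @ [p])"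

lemma ext: "ext (F \<pi>) p = F (\<pi> @ [p])"
proof -
  have "F (SOME \<rho>. F \<rho> = F \<pi>) = F \<pi>" by (rule someI[of _ \<pi>]) simp
  then show ?thesis unfolding ext_def by (rule fin_congD[OF fin_cong_F]) simp
qed

lemma foldl_ext: "foldl ext (F []) \<pi> = F \<pi>"
  by (induction \<pi> rule: rev_induct) (simp_all add: ext)

lemma finF: "finite (range F)"
  by (rule fin_cong_finite[OF fin_cong_F])

lemma definable_value:
  assumes "g \<in> range F"
  shows "definable P (\<lambda>u V. u x \<le> u y \<and> F (sg (u x) (u y)) = g)"
proof -
  have "definable P (\<lambda>u V. u x \<le> u y \<and> foldl ext (F []) (map ((\<lambda>X n. n \<in> P) (V 0)) [u x..<u y]) = g)"
  proof (rule foldl_run_definable[where L = UNIV and Q = "range F"])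
    show "ext q l \<in> range F" for q l by (simp add: ext_def)
    show "definable P (\<lambda>u V. (u 0 \<in> P) = l)" for l
      by (intro definable_iff_bool definable_pred)
  qed (use finF assms in auto)
  then show ?thesis by (simp add: foldl_ext sg_def)
qed

lemma definable_near: "definable P (\<lambda>u V. near (u x))"
proof -
  define y where "y = Suc x"
  define z where "z = Suc y"
  have d: "x \<noteq> y" "x \<noteq> z" "y \<noteq> z" by (auto simp: y_def z_def)
  have "definable P (\<lambda>u V. \<exists>r. (u(z := r)) z = r0 \<and> (u(z := r)) z \<le> (u(z := r)) y \<and>
      F (sg ((u(z := r)) z) ((u(z := r)) y)) = g)" if "g \<in> range F" for g
    by (intro definable_ex1 definable_and[OF definable_number definable_value[OF that]])
  then have 1: "definable P (\<lambda>u V. r0 \<le> u y \<and> F (sg r0 (u y)) = g)" if "g \<in> range F" for g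
    using that d by simp
  have "definable P (\<lambda>u V. \<exists>g\<in>range F. (u x \<le> u y \<and> F (sg (u x) (u y)) = g) \<and>
      (r0 \<le> u y \<and> F (sg r0 (u y)) = g))"
    by (intro definable_finite_ex finF definable_and definable_value 1)
  from definable_ex1[OF this, of y]
  have "definable P (\<lambda>u V. \<exists>k. \<exists>g\<in>range F. (u x \<le> k \<and> F (sg (u x) k) = g) \<and>
      (r0 \<le> k \<and> F (sg r0 k) = g))" using d by simp
  moreover have "near n \<longleftrightarrow> (\<exists>k. \<exists>g\<in>range F. (n \<le> k \<and> F (sg n k) = g) \<and>
      (r0 \<le> k \<and> F (sg r0 k) = g))" for n by (auto simp: near_def)
  ultimately show ?thesis by simp
qed

lemma definable_near_Suc: "definable P (\<lambda>u V. near (Suc (u x)))"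
proof -
  have "definable P (\<lambda>u V. \<exists>n. (u(Suc x := n)) (Suc x) = Suc ((u(Suc x := n)) x) \<and> near ((u(Suc x := n)) (Suc x)))"
    by (intro definable_ex1 definable_and definable_suc definable_near)
  then show ?thesis by simp
qed

text \<open>Transition function of an automaton that retraces the greedy cuts: \<open>None\<close>
  at a cut, otherwise the value read since the last one. Nearness of the next position is supplied
  with the letter, because it looks ahead and has its own definition.\<close>

definition cut :: "(('q \<times> nat) \<times> ('q \<times> nat) set) set option \<Rightarrow> bool \<times> bool \<Rightarrow>
    (('q \<times> nat) \<times> ('q \<times> nat) set) set option" where
  "cut t l = (let v = ext (case t of None \<Rightarrow> F [] | Some g \<Rightarrow> g) (fst l) in
     if v = e \<and> snd l then None else Some v)"

lemma cut_run:
  assumes "r0 \<le> n"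
  shows "foldl cut None (map (\<lambda>n. (n \<in> P, near (Suc n))) [r0..<n]) = None \<longleftrightarrow> n \<in> range hs"
proof -
  let ?st = "\<lambda>n. foldl cut None (map (\<lambda>n. (n \<in> P, near (Suc n))) [r0..<n])"
  have "\<exists>i. hs i \<le> n \<and> n < hs (Suc i) \<and> ?st n = (if n = hs i then None else Some (F (sg (hs i) n)))"
    using assms
  proof (induction n rule: dec_induct)
    case base
    show ?case using hs_Suc[of 0] by (intro exI[of _ 0]) simp
  next
    case (step n)
    then obtain i where i: "hs i \<le> n" "n < hs (Suc i)" 
      "?st n = (if n = hs i then None else Some (F (sg (hs i) n)))" by blast
    have "ext (case ?st n of None \<Rightarrow> F [] | Some g \<Rightarrow> g) (n \<in> P) = F (sg (hs i) n @ [n \<in> P])"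
      unfolding i(3) by (simp add: ext[symmetric] sg_def)
    also have "sg (hs i) n @ [n \<in> P] = sg (hs i) (Suc n)" using i(1) by (simp add: sg_def)
    finally have x: "ext (case ?st n of None \<Rightarrow> F [] | Some g \<Rightarrow> g) (n \<in> P) = F (sg (hs i) (Suc n))" .
    have "?st (Suc n) = cut (?st n) (n \<in> P, near (Suc n))" using step.hyps by simp
    then have v: "?st (Suc n) = (if F (sg (hs i) (Suc n)) = e \<and> near (Suc n) then None else Some (F (sg (hs i) (Suc n))))"
      unfolding cut_def[of "?st n"] Let_def fst_conv snd_conv x .
    show ?case
    proof (cases "F (sg (hs i) (Suc n)) = e \<and> near (Suc n)")
      case True
      then have "hs (Suc i) \<le> Suc n" unfolding hs.simps(2) using i(1) by (intro Least_le) auto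
      then have "hs (Suc i) = Suc n" using i(2) by simp
      then show ?thesis using v True hs_Suc[of "Suc i"] by (intro exI[of _ "Suc i"]) simp
    next
      case False
      then have "Suc n \<noteq> hs (Suc i)" using hs_Suc[of i] by metis
      then show ?thesis using v False i by (intro exI[of _ i]) auto
    qed
  qed
  then obtain i where i: "hs i \<le> n" "n < hs (Suc i)" 
      "?st n = (if n = hs i then None else Some (F (sg (hs i) n)))" by blast
  have "n = hs i" if n: "n \<in> range hs"
  proof -
    obtain j where j: "n = hs j" using n by blast
    then have "i \<le> j" "j < Suc i" using i(1,2) hs_mono strict_mono_less_eq strict_mono_less by blast+
    then have "j = i" by simp
    then show ?thesis using j by simp
  qed
  then have "n \<in> range hs \<longleftrightarrow> n = hs i" by blast
  moreover have "?st n = None \<longleftrightarrow> n = hs i" unfolding i(3) by simp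
  ultimately show ?thesis by (simp only:)
qed

lemma definable_hs: "definable P (\<lambda>u V. u x \<in> range hs)"
proof -
  let ?a = "\<lambda>(X :: nat set) n. (n \<in> P, near (Suc n))"
  have 1: "definable P (\<lambda>u V. u y \<le> u x \<and> foldl cut None (map (?a (V 0)) [u y..<u x]) = None)" for y
  proof (rule foldl_run_definable[where L = UNIV and Q = "insert None (Some ` range F)"])
    show "definable P (\<lambda>u V. (u 0 \<in> P, near (Suc (u 0))) = l)" for l
    proof (cases l)
      case (Pair l1 l2)
      have "definable P (\<lambda>u V. (u 0 \<in> P) = l1 \<and> near (Suc (u 0)) = l2)"
        by (intro definable_and definable_iff_bool definable_pred definable_near_Suc)
      then show ?thesis by (simp add: Pair)
    qed
    show "cut q l \<in> insert None (Some ` range F)" for q l by (auto simp: cut_def Let_def ext_def)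
  qed (use finF in auto)
  have "definable P (\<lambda>u V. \<exists>r. (u(Suc x := r)) (Suc x) = r0 \<and> (u(Suc x := r)) (Suc x) \<le> (u(Suc x := r)) x \<and>
     foldl cut None (map (?a (V 0)) [(u(Suc x := r)) (Suc x)..<(u(Suc x := r)) x]) = None)"
    by (intro definable_ex1 definable_and[OF definable_number 1])
  then have "definable P (\<lambda>u V. r0 \<le> u x \<and> foldl cut None (map (?a (V 0)) [r0..<u x]) = None)" by simp
  moreover have "r0 \<le> n \<and> foldl cut None (map (\<lambda>n. (n \<in> P, near (Suc n))) [r0..<n]) = None \<longleftrightarrow> n \<in> range hs" for n
    using cut_run[of n] strict_mono_less_eq[OF hs_mono, of 0] by auto
  ultimately show ?thesis by simp
qed

lemma definable_hs_Suc: "definable P (\<lambda>u V. Suc (u x) \<in> range hs)"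
proof -
  have "definable P (\<lambda>u V. \<exists>n. (u(Suc x := n)) (Suc x) = Suc ((u(Suc x := n)) x) \<and> (u(Suc x := n)) (Suc x) \<in> range hs)"
    by (intro definable_ex1 definable_and definable_suc definable_hs)
  then show ?thesis by simp
qed

lemma nx_eq: "nx n = k \<longleftrightarrow> n < k \<and> k \<in> range hs \<and> (\<forall>j. n < j \<and> j < k \<longrightarrow> j \<notin> range hs)"
proof
  assume "nx n = k"
  then show "n < k \<and> k \<in> range hs \<and> (\<forall>j. n < j \<and> j < k \<longrightarrow> j \<notin> range hs)"
    using nx[of n] nx_le[of n] not_le by blast
next
  assume k: "n < k \<and> k \<in> range hs \<and> (\<forall>j. n < j \<and> j < k \<longrightarrow> j \<notin> range hs)"
  then have "nx n \<le> k" using nx_le by blast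
  moreover have "\<not> nx n < k" using k nx[of n] by blast
  ultimately show "nx n = k" by simp
qed

lemma definable_adv:
  assumes "g \<in> range F"
  shows "definable P (\<lambda>u V. adv (u 0) = g)"
proof -
  have 1: "definable P (\<lambda>u V. \<forall>j. \<not> ((u(3 := j)) 0 < (u(3 := j)) 3 \<and> (u(3 := j)) 3 < (u(3 := j)) 2 \<and> (u(3 := j)) 3 \<in> range hs))"
    by (intro definable_all1 defin definable_hs)
  have 2: "definable P (\<lambda>u V. \<exists>m. (u(1 := m)) 1 = Suc ((u(1 := m)) 0) \<and>
       (u(1 := m)) 1 \<le> (u(1 := m)) 2 \<and> F (sg ((u(1 := m)) 1) ((u(1 := m)) 2)) = g)"
    by (intro definable_ex1 definable_and[OF definable_suc definable_value[OF assms]])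
  have "definable P (\<lambda>u V. u 0 < u 2 \<and> u 2 \<in> range hs \<and>
     (\<forall>j. \<not> (u 0 < j \<and> j < u 2 \<and> j \<in> range hs)) \<and> Suc (u 0) \<le> u 2 \<and> F (sg (Suc (u 0)) (u 2)) = g)"
    by (intro definable_and[OF definable_less definable_and[OF definable_hs definable_and]])
      (use 1 2 in simp_all)
  from definable_ex1[OF this, of 2]
  have 3: "definable P (\<lambda>u V. \<exists>k. u 0 < k \<and> k \<in> range hs \<and>
     (\<forall>j. \<not> (u 0 < j \<and> j < k \<and> j \<in> range hs)) \<and> Suc (u 0) \<le> k \<and> F (sg (Suc (u 0)) k) = g)" by simp
  have "adv n = g \<longleftrightarrow> (\<exists>k. nx n = k \<and> F (sg (Suc n) k) = g)" for n by (simp add: adv_def)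
  also have "\<dots> n \<longleftrightarrow> (\<exists>k. n < k \<and> k \<in> range hs \<and>
     (\<forall>j. \<not> (n < j \<and> j < k \<and> j \<in> range hs)) \<and> Suc n \<le> k \<and> F (sg (Suc n) k) = g)" for n
    unfolding nx_eq by (auto simp: Suc_le_eq)
  finally show ?thesis using 3 by simp
qed

lemma definable_letter:
  assumes "l \<in> UNIV \<times> UNIV \<times> UNIV \<times> range F"
  shows "definable P (\<lambda>u V. letter (V 0) (u 0) = l)"
proof -
  obtain i p r g where l: "l = (i, p, r, g)" "g \<in> range F" using assms by auto
  have "definable P (\<lambda>u V. (u 0 \<in> V 0) = i \<and> (u 0 \<in> P) = p \<and> (Suc (u 0) \<in> range hs) = r \<and> adv (u 0) = g)"
    by (intro definable_and definable_iff_bool definable_mem definable_pred definable_hs_Suc definable_adv l(2))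
  then show ?thesis by (simp add: letter_def l)
qed

text \<open>The memory is the state of a finite automaton reading \<open>letter\<close>, hence
  definable, and the answer is a function of memory and current letter; a finite disjunction over
  both describes it. The arbitrary choices in \<open>out\<close> and \<sigma> are thereby frozen as
  finite tables.\<close>

lemma definable_reply:
  assumes "Z \<subseteq> V" "\<And>s. \<sigma> s \<subseteq> V"
  shows "definable P (\<lambda>u A. reply comb out \<sigma> Z (u 0) (A 0))"
proof -
  let ?L = "UNIV \<times> UNIV \<times> UNIV \<times> range F :: (bool \<times> bool \<times> bool \<times> (('q \<times> nat) \<times> ('q \<times> nat) set) set) set"
  let ?M = "Pow V \<times> V"
  have L: "finite ?L" "letter I n \<in> ?L" for I n using finF by (simp_all add: letter_def adv_def)
  have M: "finite ?M" "(Z, (q0, b)) \<in> ?M" using finV assms(1) q0Q by (auto simp: V_def)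
  have cl: "upd comb out \<sigma> m l \<in> ?M" if "m \<in> ?M" "l \<in> ?L" for m l
  proof -
    obtain i p r g where l: "l = (i, p, r, g)" by (cases l) auto
    have s: "step (snd m) (comb i (out m i p g) p) \<in> V" using that(1) by (intro step_V) auto
    then show ?thesis using that(1) assms(2) by (auto simp: l upd_def Let_def V_def)
  qed
  have 1: "definable P (\<lambda>u A. u 1 \<le> u 0 \<and> foldl (upd comb out \<sigma>) (Z, (q0, b)) (map (letter (A 0)) [u 1..<u 0]) = m)"
    if "m \<in> ?M" for m
    by (rule foldl_run_definable[OF L definable_letter M cl that])
  have "definable P (\<lambda>u A. \<exists>z. (u(1 := z)) 1 = 0 \<and> (u(1 := z)) 1 \<le> (u(1 := z)) 0 \<and>
      foldl (upd comb out \<sigma>) (Z, (q0, b)) (map (letter (A 0)) [(u(1 := z)) 1..<(u(1 := z)) 0]) = m)" if "m \<in> ?M" for m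
    by (intro definable_ex1 definable_and[OF definable_number 1[OF that]])
  then have 2: "definable P (\<lambda>u A. mem comb out \<sigma> Z (A 0) (u 0) = m)" if "m \<in> ?M" for m
    using that by (simp add: mem_def)
  have memM: "mem comb out \<sigma> Z I n \<in> ?M" for I n
    unfolding mem_def by (induction n) (use M L cl in auto)
  have "definable P (\<lambda>u A. \<exists>m\<in>?M. \<exists>l\<in>?L. mem comb out \<sigma> Z (A 0) (u 0) = m \<and> letter (A 0) (u 0) = l \<and>
      (case l of (i, p, r, g) \<Rightarrow> out m i p g))"
    by (intro definable_finite_ex definable_and M(1) L(1) 2 definable_letter definable_const)
  moreover have "reply comb out \<sigma> Z n I \<longleftrightarrow> (\<exists>m\<in>?M. \<exists>l\<in>?L. mem comb out \<sigma> Z I n = m \<and> letter I n = l \<and>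
      (case l of (i, p, r, g) \<Rightarrow> out m i p g))" for n I
    using memM[of I n] L(2)[of I n] by (auto simp: reply_def letter_def)
  ultimately show ?thesis by simp
qed

lemma mem_causal: "(\<And>i. i < n \<Longrightarrow> i \<in> I \<longleftrightarrow> i \<in> J) \<Longrightarrow> mem comb out \<sigma> Z I n = mem comb out \<sigma> Z J n"
  unfolding mem_def by (intro arg_cong[where f = "foldl (upd comb out \<sigma>) (Z, (q0, b))"] map_cong refl)
    (simp add: letter_def)

end

context parity_automaton
begin

lemma ex_homogeneous: "\<exists>Y r0 e. homogeneous Q q0 \<delta> \<kappa> b P Y r0 e"
proof -
  have "finite (range (\<lambda>(i, j). F (map (\<lambda>n. n \<in> P) [i..<j])))"
    by (rule finite_subset[OF _ fin_cong_finite[OF fin_cong_F]]) auto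
  from ramsey_pairs[OF this] obtain Y e where Y: "infinite Y"
    "\<forall>i\<in>Y. \<forall>j\<in>Y. i < j \<longrightarrow> F (map (\<lambda>n. n \<in> P) [i..<j]) = e" by (elim exE conjE)
  obtain r0 where "r0 \<in> Y" "0 < r0" using Y(1) infinite_nat_iff_unbounded by blast
  then show ?thesis using Y
    by (intro exI[of _ Y] exI[of _ r0] exI[of _ e] homogeneous.intro homogeneous_axioms.intro parity_automaton_axioms) auto
qed

definition run_good :: "move word \<Rightarrow> bool" where
  "run_good w \<longleftrightarrow> good (\<lambda>n. \<kappa> (foldl \<delta> q0 (map w [0..<n])) (w n))"

text \<open>The initial segment before r0 decides the winner: either the player of Y can force the
  winning region W of the finite game along it, or the player of X can force the complement. The
  winner then follows the positional strategy from cut to cut.\<close>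

theorem definable_determinacy:
  "(\<exists>D. definable P (\<lambda>u A. D (u 0) (A 0)) \<and> (\<forall>n I. D n I \<longleftrightarrow> D n (I \<inter> {..n})) \<and>
      (\<forall>X. run_good (play X {n. D n X} P))) \<or>
   (\<exists>D. definable P (\<lambda>u A. D (u 0) (A 0)) \<and> (\<forall>n I. D n I \<longleftrightarrow> D n (I \<inter> {..<n})) \<and>
      (\<forall>Y. \<not> run_good (play {n. D n Y} Y P)))"
proof -
  obtain Y r0 e where "homogeneous Q q0 \<delta> \<kappa> b P Y r0 e" using ex_homogeneous by blast
  then interpret homogeneous Q q0 \<delta> \<kappa> b P Y r0 e .
  have e: "e = F (sg (hs 0) (hs (Suc 0)))" using hs_Suc by blast
  obtain W \<sigma> \<tau> where W: "W \<subseteq> V"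
    and \<sigma>: "\<And>v. v \<in> W \<Longrightarrow> \<sigma> v \<in> {U. U \<subseteq> V \<and> ((fst v, b), U) \<in> e} \<and> \<sigma> v \<subseteq> W"
    and \<tau>: "\<And>v. v \<in> V - W \<Longrightarrow> \<tau> v \<in> {U. U \<subseteq> V \<and> ((fst v, b), V - U) \<notin> e} \<and> \<tau> v \<subseteq> V - W"
    and gd: "\<And>p. (\<And>i. p i \<in> W \<and> p (Suc i) \<in> \<sigma> (p i)) \<Longrightarrow> good (\<lambda>i. snd (p i))"
    and bd: "\<And>p. (\<And>i. p i \<in> V - W \<and> p (Suc i) \<in> \<tau> (p i)) \<Longrightarrow> bad (\<lambda>i. snd (p i))"
    by (rule parity_determinacy[OF finV dual_families_forces[OF e], of snd]) blast
  have q0V: "(q0, b) \<in> V" using q0Q by (simp add: V_def)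
  show ?thesis
  proof (cases "((q0, b), W) \<in> F (sg 0 r0)")
    case True
    define comb where "comb i o' p = (i, o', p)" for i o' p :: bool
    define out where "out m i p g = (SOME y. (step (snd m) (i, y, p), fst m) \<in> g)"
      for m :: "('q \<times> nat) set \<times> 'q \<times> nat" and i p :: bool and g :: "(('q \<times> nat) \<times> ('q \<times> nat) set) set"
    \<comment> \<open>Made total with subsets of V as values, so that the memory ranges over a
      finite set.\<close>
    define \<sigma>' where "\<sigma>' v = (if v \<in> W then \<sigma> v else {})" for v
    let ?D = "reply comb out \<sigma>' W"
    have "definable P (\<lambda>u A. ?D (u 0) (A 0))"
      by (rule definable_reply[OF W]) (use \<sigma> in \<open>auto simp: \<sigma>'_def\<close>)
    moreover have "?D n I \<longleftrightarrow> ?D n (I \<inter> {..n})" for n I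
      using mem_causal[of n I "I \<inter> {..n}"] by (simp add: reply_def)
    moreover have "run_good (play X {n. ?D n X} P)" for X
    proof -
      have one: "(step s (comb i (out (T, s) i p (F \<pi>)) p), T) \<in> F \<pi>"
        if "s \<in> V" "T \<subseteq> V" "(s, T) \<in> F (p # \<pi>)" for s T p \<pi> i
      proof -
        have "\<exists>y. forces \<pi> (step s (i, y, p)) T" using that by (auto simp: F_def)
        then have "\<exists>y. (step s (i, y, p), T) \<in> F \<pi>" using that step_V by (auto simp: F_def)
        from someI_ex[OF this] show ?thesis by (simp add: comb_def out_def)
      qed
      obtain p where p: "\<And>i. p i \<in> W \<and> p (Suc i) \<in> \<sigma>' (p i)"
        "good (\<lambda>i. snd (p i)) \<Longrightarrow> good (\<lambda>n. \<kappa> (foldl \<delta> q0 (map (mv comb out \<sigma>' W X) [0..<n])) (mv comb out \<sigma>' W X n))"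
        by (rule play_segments[where Inv = "\<lambda>s T g. (s, T) \<in> g" and Z = W and \<sigma> = \<sigma>' and comb = comb and out = out and I = X])
          (use W \<sigma> True one in \<open>auto simp: \<sigma>'_def F_def\<close>)
      have "good (\<lambda>i. snd (p i))" 
      proof (rule gd)
        show "p i \<in> W \<and> p (Suc i) \<in> \<sigma> (p i)" for i using p(1)[of i] unfolding \<sigma>'_def by (metis empty_iff)
      qed
      moreover have "mv comb out \<sigma>' W X = play X {n. ?D n X} P" by (auto simp: mv_def play_def comb_def fun_eq_iff)
      ultimately show ?thesis using p(2) by (simp add: run_good_def)
    qed
    ultimately show ?thesis by blast
  next
    case False
    define comb where "comb i o' p = (o', i, p)" for i o' p :: bool
    \<comment> \<open>The chosen x has to work against every y, so the current input bit i does not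
      enter; this yields a strongly causal operator.\<close>
    define out where "out m i p g = (SOME x. \<forall>y. (step (snd m) (x, y, p), V - fst m) \<notin> g)"
      for m :: "('q \<times> nat) set \<times> 'q \<times> nat" and i p :: bool and g :: "(('q \<times> nat) \<times> ('q \<times> nat) set) set"
    define \<tau>' where "\<tau>' v = (if v \<in> V - W then \<tau> v else {})" for v
    let ?D = "reply comb out \<tau>' (V - W)"
    have "definable P (\<lambda>u A. ?D (u 0) (A 0))"
      by (rule definable_reply) (use \<tau> in \<open>auto simp: \<tau>'_def\<close>)
    moreover have "?D n I \<longleftrightarrow> ?D n (I \<inter> {..<n})" for n I
      using mem_causal[of n I "I \<inter> {..<n}"] by (simp add: reply_def out_def)
    moreover have "\<not> run_good (play {n. ?D n X} X P)" for X
    proof -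
      have one: "(step s (comb i (out (T, s) i p (F \<pi>)) p), V - T) \<notin> F \<pi>"
        if "s \<in> V" "T \<subseteq> V" "(s, V - T) \<notin> F (p # \<pi>)" for s T p \<pi> i
      proof -
        have "\<exists>x. \<forall>y. \<not> forces \<pi> (step s (x, y, p)) (V - T)" using that by (auto simp: F_def)
        then have "\<exists>x. \<forall>y. (step s (x, y, p), V - T) \<notin> F \<pi>" by (auto simp: F_def)
        from someI_ex[OF this] show ?thesis by (simp add: comb_def out_def)
      qed
      have "V - (V - W) = W" using W by auto
      obtain p where p: "\<And>i. p i \<in> V - W \<and> p (Suc i) \<in> \<tau>' (p i)"
        "bad (\<lambda>i. snd (p i)) \<Longrightarrow> bad (\<lambda>n. \<kappa> (foldl \<delta> q0 (map (mv comb out \<tau>' (V - W) X) [0..<n])) (mv comb out \<tau>' (V - W) X n))"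
        by (rule play_segments[where Inv = "\<lambda>s T g. (s, V - T) \<notin> g" and Z = "V - W" and \<sigma> = \<tau>' and comb = comb and out = out and I = X])
          (use W \<tau> False one \<open>V - (V - W) = W\<close> in \<open>auto simp: \<tau>'_def F_def\<close>)
      have "bad (\<lambda>i. snd (p i))" 
      proof (rule bd)
        show "p i \<in> V - W \<and> p (Suc i) \<in> \<tau> (p i)" for i using p(1)[of i] unfolding \<tau>'_def by (metis empty_iff)
      qed
      moreover have "mv comb out \<tau>' (V - W) X = play {n. ?D n X} X P" by (auto simp: mv_def play_def comb_def fun_eq_iff)
      ultimately show ?thesis using p(2) not_good_and_bad unfolding run_good_def by auto
    qed
    ultimately show ?thesis by blast
  qed
qed

end

text \<open>Truncating the input makes every formula \<beta> describe a causal or strongly causal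
  operator, so that the search only has to test whether it wins.\<close>

definition strategy :: "bool \<Rightarrow> nat set \<Rightarrow> mlo \<Rightarrow> nat set \<Rightarrow> nat set" where
  "strategy strict P \<beta> A =
     {n. sat P (\<lambda>_. n) ((\<lambda>_. {})(0 := A \<inter> (if strict then {..<n} else {..n}))) \<beta>}"

theorem strategy_determinacy:
  assumes "\<psi> \<in> specs"
  shows "(\<exists>\<beta>. free1 \<beta> \<subseteq> {0} \<and> free2 \<beta> \<subseteq> {0} \<and> (\<forall>X. holds \<psi> X (strategy False P \<beta> X) P)) \<or>
    (\<exists>\<beta>. free1 \<beta> \<subseteq> {0} \<and> free2 \<beta> \<subseteq> {0} \<and> (\<forall>Y. \<not> holds \<psi> (strategy True P \<beta> Y) Y P))"
proof -
  obtain Q :: "(nat \<times> nat \<times> nat list) list set" and q0 \<delta> \<kappa> b where A: "finite Q" "q0 \<in> Q"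
    "\<And>q a. q \<in> Q \<Longrightarrow> \<delta> q a \<in> Q" "\<And>q a. \<kappa> q a \<le> b"
    "\<And>X Y P. holds \<psi> X Y P \<longleftrightarrow>
       good (\<lambda>n. \<kappa> (foldl \<delta> q0 (map (play X Y P) [0..<n])) (play X Y P n))"
    by (rule spec_automaton[OF assms]) blast
  interpret parity_automaton Q q0 \<delta> \<kappa> b by unfold_locales (use A in auto)
  have st: "\<exists>\<beta>. free1 \<beta> \<subseteq> {0} \<and> free2 \<beta> \<subseteq> {0} \<and> (\<forall>X. strategy strict P \<beta> X = {n. D n X})"
    if def: "definable P (\<lambda>u A. D (u 0) (A 0))" and D: "\<And>n I. D n I \<longleftrightarrow> D n (I \<inter> (if strict then {..<n} else {..n}))"
    for D strict
  proof -
    obtain \<beta> where "free1 \<beta> \<subseteq> {0}" "free2 \<beta> \<subseteq> {0}" "\<And>u V. sat P u V \<beta> \<longleftrightarrow> D (u 0) (V 0)"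
      using definable_formula[OF def] by blast
    then show ?thesis using D by (intro exI[of _ \<beta>]) (simp add: strategy_def)
  qed
  have hold: "holds \<psi> X Y P \<longleftrightarrow> run_good (play X Y P)" for X Y by (simp add: run_good_def A(5))
  from definable_determinacy[of P] show ?thesis
  proof (elim disjE exE conjE)
    fix D assume D: "definable P (\<lambda>u A. D (u 0) (A 0))" "\<forall>n I. D n I \<longleftrightarrow> D n (I \<inter> {..n})"
      "\<forall>X. run_good (play X {n. D n X} P)"
    obtain \<beta> where "free1 \<beta> \<subseteq> {0}" "free2 \<beta> \<subseteq> {0}" "\<forall>X. strategy False P \<beta> X = {n. D n X}"
      using st[OF D(1), of False] D(2) by auto
    then show ?thesis using D(3) hold by metis
  next
    fix D assume D: "definable P (\<lambda>u A. D (u 0) (A 0))" "\<forall>n I. D n I \<longleftrightarrow> D n (I \<inter> {..<n})"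
      "\<forall>Y. \<not> run_good (play {n. D n Y} Y P)"
    obtain \<beta> where "free1 \<beta> \<subseteq> {0}" "free2 \<beta> \<subseteq> {0}" "\<forall>X. strategy True P \<beta> X = {n. D n X}"
      using st[OF D(1), of True] D(2) by auto
    then show ?thesis using D(3) hold by metis
  qed
qed


section \<open>Recursive functions\<close>

definition recursive :: "nat \<Rightarrow> (nat list \<Rightarrow> nat) \<Rightarrow> bool" where
  "recursive n f \<longleftrightarrow> (\<exists>p. \<forall>xs. length xs = n \<longrightarrow> run p xs = Some (f xs))"

abbreviation recursive1 :: "(nat \<Rightarrow> nat) \<Rightarrow> bool" where
  "recursive1 f \<equiv> recursive 1 (\<lambda>xs. f (xs ! 0))"

abbreviation recursive2 :: "(nat \<Rightarrow> nat \<Rightarrow> nat) \<Rightarrow> bool" where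
  "recursive2 f \<equiv> recursive 2 (\<lambda>xs. f (xs ! 0) (xs ! 1))"

abbreviation recursive3 :: "(nat \<Rightarrow> nat \<Rightarrow> nat \<Rightarrow> nat) \<Rightarrow> bool" where
  "recursive3 f \<equiv> recursive 3 (\<lambda>xs. f (xs ! 0) (xs ! 1) (xs ! 2))"

named_theorems recur

lemma recursive_nth [recur]: "i < n \<Longrightarrow> recursive n (\<lambda>xs. xs ! i)"
  unfolding recursive_def by (rule exI[of _ "Proj i"]) simp

lemma recursive_comp1:
  assumes "recursive1 f" "recursive n g"
  shows "recursive n (\<lambda>xs. f (g xs))"
proof -
  obtain p q where "\<And>xs. length xs = 1 \<Longrightarrow> run p xs = Some (f (xs ! 0))"
    "\<And>xs. length xs = n \<Longrightarrow> run q xs = Some (g xs)"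
    using assms unfolding recursive_def by blast
  then show ?thesis unfolding recursive_def by (intro exI[of _ "Comp p [q]"]) simp
qed

lemma recursive_comp2:
  assumes "recursive2 f" "recursive n g" "recursive n h"
  shows "recursive n (\<lambda>xs. f (g xs) (h xs))"
proof -
  obtain p q r where "\<And>xs. length xs = 2 \<Longrightarrow> run p xs = Some (f (xs ! 0) (xs ! 1))"
    "\<And>xs. length xs = n \<Longrightarrow> run q xs = Some (g xs)"
    "\<And>xs. length xs = n \<Longrightarrow> run r xs = Some (h xs)"
    using assms unfolding recursive_def by blast
  then show ?thesis unfolding recursive_def by (intro exI[of _ "Comp p [q, r]"]) simp
qed

lemma recursive_comp3:
  assumes "recursive3 f" "recursive n g" "recursive n h" "recursive n k"
  shows "recursive n (\<lambda>xs. f (g xs) (h xs) (k xs))"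
proof -
  obtain p q r s where "\<And>xs. length xs = 3 \<Longrightarrow> run p xs = Some (f (xs ! 0) (xs ! 1) (xs ! 2))"
    "\<And>xs. length xs = n \<Longrightarrow> run q xs = Some (g xs)"
    "\<And>xs. length xs = n \<Longrightarrow> run r xs = Some (h xs)"
    "\<And>xs. length xs = n \<Longrightarrow> run s xs = Some (k xs)"
    using assms unfolding recursive_def by metis
  then show ?thesis unfolding recursive_def by (intro exI[of _ "Comp p [q, r, s]"]) simp
qed

lemma recursive_Suc [recur]:
  assumes "recursive n f" shows "recursive n (\<lambda>xs. Suc (f xs))"
proof (rule recursive_comp1[OF _ assms])
  show "recursive1 Suc" unfolding recursive_def
    by (rule exI[of _ Succ]) (auto simp: length_Suc_conv)
qed

lemma recursive_const [recur]: "recursive n (\<lambda>xs. c)"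
proof (induction c)
  case 0
  show ?case unfolding recursive_def by (rule exI[of _ Zero]) simp
qed (rule recursive_Suc)

lemma recursive1_primrec:
  assumes "recursive2 g" "f 0 = a" "\<And>k. f (Suc k) = g k (f k)"
  shows "recursive1 f"
proof -
  obtain p q where q: "\<And>xs. length xs = 2 \<Longrightarrow> run q xs = Some (g (xs ! 0) (xs ! 1))"
    and p: "run p [] = Some a"
    using assms(1) recursive_const[of 0 a] unfolding recursive_def by auto
  have "run (PrimRec p q) [n] = Some (f n)" for n
  proof -
    have "rec_nat (run p []) (\<lambda>k r. Option.bind r (\<lambda>y. run q [k, y])) n = Some (f n)"
      by (induction n) (simp_all add: p q assms)
    then show ?thesis by simp
  qed
  then show ?thesis unfolding recursive_def by (intro exI[of _ "PrimRec p q"]) (auto simp: length_Suc_conv)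
qed

lemma recursive2_primrec:
  assumes "recursive1 a" "recursive3 g" "\<And>x. f 0 x = a x" "\<And>k x. f (Suc k) x = g k (f k x) x"
  shows "recursive2 f"
proof -
  obtain p q where q: "\<And>xs. length xs = 3 \<Longrightarrow> run q xs = Some (g (xs ! 0) (xs ! 1) (xs ! 2))"
    and p: "\<And>xs. length xs = 1 \<Longrightarrow> run p xs = Some (a (xs ! 0))"
    using assms(1,2) unfolding recursive_def by blast
  have "run (PrimRec p q) [n, x] = Some (f n x)" for n x
  proof -
    have "rec_nat (run p [x]) (\<lambda>k r. Option.bind r (\<lambda>y. run q [k, y, x])) n = Some (f n x)"
      by (induction n) (simp_all add: p q assms)
    then show ?thesis by simp
  qed
  then show ?thesis unfolding recursive_def
    by (intro exI[of _ "PrimRec p q"]) (auto simp: length_Suc_conv numeral_2_eq_2)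
qed

lemma recursive1_Least:
  assumes "recursive2 f" "\<And>x. \<exists>n. f n x = 0"
  shows "recursive1 (\<lambda>x. LEAST n. f n x = 0)"
proof -
  obtain p where p: "\<And>xs. length xs = 2 \<Longrightarrow> run p xs = Some (f (xs ! 0) (xs ! 1))"
    using assms(1) unfolding recursive_def by blast
  have "run (Mu p) [x] = Some (LEAST n. f n x = 0)" for x
    using assms(2)[of x] by (simp add: p)
  then show ?thesis unfolding recursive_def
    by (intro exI[of _ "Mu p"]) (auto simp: length_Suc_conv simp del: run.simps)
qed

lemma recursive_add [recur]:
  assumes "recursive n f" "recursive n g" shows "recursive n (\<lambda>xs. f xs + g xs)"
  by (rule recursive_comp2[OF _ assms], rule recursive2_primrec[of "\<lambda>x. x" "\<lambda>k y x. Suc y"])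
    (intro recur | simp)+

lemma recursive_mult [recur]:
  assumes "recursive n f" "recursive n g" shows "recursive n (\<lambda>xs. f xs * g xs)"
  by (rule recursive_comp2[OF _ assms], rule recursive2_primrec[of "\<lambda>x. 0" "\<lambda>k y x. x + y"])
    (intro recur | simp)+

lemma recursive_pred [recur]:
  assumes "recursive n f" shows "recursive n (\<lambda>xs. f xs - Suc 0)"
  by (rule recursive_comp1[OF _ assms], rule recursive1_primrec[of "\<lambda>k y. k" _ 0])
    (intro recur | simp)+

lemma recursive_diff [recur]:
  assumes "recursive n f" "recursive n g" shows "recursive n (\<lambda>xs. f xs - g xs)"
  by (rule recursive_comp2[of "\<lambda>x y. y - x", OF _ assms(2,1)],
      rule recursive2_primrec[of "\<lambda>x. x" "\<lambda>k y x. y - Suc 0"])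
    (intro recur | simp)+

definition decidable_rel :: "nat \<Rightarrow> (nat list \<Rightarrow> bool) \<Rightarrow> bool" where
  "decidable_rel n Q \<longleftrightarrow> recursive n (\<lambda>xs. of_bool (Q xs))"

lemma recursive_of_bool [recur]: "decidable_rel n Q \<Longrightarrow> recursive n (\<lambda>xs. of_bool (Q xs))"
  by (simp add: decidable_rel_def)

lemma decidable_le [recur]:
  assumes "recursive n f" "recursive n g" shows "decidable_rel n (\<lambda>xs. f xs \<le> g xs)"
proof -
  have "of_bool (f xs \<le> g xs) = 1 - (f xs - g xs)" for xs by auto
  then show ?thesis unfolding decidable_rel_def by (simp only:) (intro recur assms)
qed

lemma decidable_not [recur]:
  assumes "decidable_rel n Q" shows "decidable_rel n (\<lambda>xs. \<not> Q xs)"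
proof -
  have "of_bool (\<not> Q xs) = 1 - (of_bool (Q xs) :: nat)" for xs by auto
  then show ?thesis unfolding decidable_rel_def by (simp only:) (intro recur assms)
qed

lemma decidable_conj [recur]:
  assumes "decidable_rel n Q" "decidable_rel n R" shows "decidable_rel n (\<lambda>xs. Q xs \<and> R xs)"
proof -
  have "of_bool (Q xs \<and> R xs) = of_bool (Q xs) * (of_bool (R xs) :: nat)" for xs by auto
  then show ?thesis unfolding decidable_rel_def by (simp only:) (intro recur assms)
qed

lemma decidable_disj [recur]:
  assumes "decidable_rel n Q" "decidable_rel n R" shows "decidable_rel n (\<lambda>xs. Q xs \<or> R xs)"
  using decidable_not[OF decidable_conj[OF assms[THEN decidable_not]]] by simp

lemma decidable_eq [recur]:
  fixes f g :: "nat list \<Rightarrow> nat"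
  assumes "recursive n f" "recursive n g" shows "decidable_rel n (\<lambda>xs. f xs = g xs)"
  unfolding eq_iff by (intro recur assms)

lemma recursive_if [recur]:
  assumes "decidable_rel n Q" "recursive n f" "recursive n g"
  shows "recursive n (\<lambda>xs. if Q xs then f xs else g xs)"
proof -
  have "(if Q xs then f xs else g xs) = of_bool (Q xs) * f xs + (1 - of_bool (Q xs)) * g xs" for xs
    by auto
  then show ?thesis by (simp only:) (intro recur assms)
qed

lemma recursive_mod [recur]:
  assumes "recursive n f" shows "recursive n (\<lambda>xs. f xs mod d)"
  by (rule recursive_comp1[OF _ assms],
      rule recursive1_primrec[of "\<lambda>k y. if Suc y = d then 0 else Suc y" _ 0])
    (intro recur | simp add: mod_Suc)+

lemma recursive_div [recur]:
  assumes "recursive n f" shows "recursive n (\<lambda>xs. f xs div d)"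
  by (rule recursive_comp1[OF _ assms],
      rule recursive1_primrec[of "\<lambda>k y. if Suc k mod d = 0 then Suc y else y" _ 0])
    (intro recur | simp add: div_Suc)+

section \<open>Pairing, lists and course-of-values recursion\<close>

lemma recursive_triangle [recur]:
  assumes "recursive n f" shows "recursive n (\<lambda>xs. triangle (f xs))"
  unfolding triangle_def by (intro recur assms)

lemma recursive_prod_encode [recur]:
  assumes "recursive n f" "recursive n g" shows "recursive n (\<lambda>xs. prod_encode (f xs, g xs))"
  unfolding prod_encode_def by (simp only: prod.case) (intro recur assms)

text \<open>Cantor's enumeration runs along the diagonals a + b = s. The diagonal number grows
  exactly when the next index is triangular, which is a primitive recursion, and both coordinates
  are differences computed from it.\<close>

lemma prod_decode_diagonal:
  fixes s defines "s \<equiv> \<lambda>z. fst (prod_decode z) + snd (prod_decode z)"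
  shows "fst (prod_decode z) = z - triangle (s z)" "snd (prod_decode z) = s z - fst (prod_decode z)"
    "s (Suc z) = (if triangle (Suc (s z)) = Suc z then Suc (s z) else s z)"
proof -
  obtain a b where d: "prod_decode z = (a, b)" by force
  have z: "z = triangle (a + b) + a" using prod_decode_inverse[of z] by (simp add: d prod_encode_def)
  show "fst (prod_decode z) = z - triangle (s z)" "snd (prod_decode z) = s z - fst (prod_decode z)"
    by (simp_all only: s_def d fst_conv snd_conv) (use z in simp_all)
  show "s (Suc z) = (if triangle (Suc (s z)) = Suc z then Suc (s z) else s z)"
  proof (cases b)
    case 0
    have "prod_encode (0, Suc a) = Suc z" by (simp add: prod_encode_def z 0)
    then have "prod_decode (Suc z) = (0, Suc a)" by (metis prod_encode_inverse)
    then show ?thesis by (simp only: s_def d fst_conv snd_conv) (use z 0 in simp)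
  next
    case (Suc b')
    have "prod_encode (Suc a, b') = Suc z" by (simp add: prod_encode_def z Suc)
    then have "prod_decode (Suc z) = (Suc a, b')" by (metis prod_encode_inverse)
    then show ?thesis by (simp only: s_def d fst_conv snd_conv) (use z Suc in simp)
  qed
qed

lemma recursive_diagonal: "recursive1 (\<lambda>z. fst (prod_decode z) + snd (prod_decode z))"
proof (rule recursive1_primrec)
  show "fst (prod_decode 0) + snd (prod_decode 0) = 0"
    using prod_encode_inverse[of "(0, 0)"] by (simp add: prod_encode_def)
  show "recursive2 (\<lambda>k y. if triangle (Suc y) = Suc k then Suc y else y)"
    by (intro recur) simp_all
qed (rule prod_decode_diagonal(3))

lemma recursive_fst [recur]:
  assumes "recursive n f" shows "recursive n (\<lambda>xs. fst (prod_decode (f xs)))"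
  by (rule recursive_comp1[OF _ assms], subst prod_decode_diagonal(1))
    (intro recur recursive_diagonal | simp)+

lemma recursive_snd [recur]:
  assumes "recursive n f" shows "recursive n (\<lambda>xs. snd (prod_decode (f xs)))"
  by (rule recursive_comp1[OF _ assms], subst prod_decode_diagonal(2))
    (intro recur recursive_diagonal | simp)+

lemma recursive2_iterate:
  assumes "recursive1 f" shows "recursive2 (\<lambda>k x. (f ^^ k) x)"
  by (rule recursive2_primrec[of "\<lambda>x. x" "\<lambda>k y x. f y"])
    (intro recur recursive_comp1[OF assms] | simp)+

text \<open>A pair of accumulator and remaining list code is iterated. The code l bounds the length
  of its list, and the step is idle once the remaining code is 0, so l steps are enough.\<close>

lemma recursive1_foldl:
  assumes "recursive2 g"
  shows "recursive1 (\<lambda>l. foldl g a (list_decode l))"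
proof -
  define f where "f z = (if snd (prod_decode z) = 0 then z else
    prod_encode (g (fst (prod_decode z)) (fst (prod_decode (snd (prod_decode z) - 1))),
      snd (prod_decode (snd (prod_decode z) - 1))))" for z
  have it: "(f ^^ k) (prod_encode (a, list_encode xs)) = prod_encode (foldl g a xs, 0)"
    if "length xs \<le> k" for k a xs
    using that
  proof (induction k arbitrary: a xs)
    case 0
    then show ?case by simp
  next
    case (Suc k)
    show ?case
    proof (cases xs)
      case Nil
      have "f (prod_encode (a, 0)) = prod_encode (a, 0)" for a by (simp add: f_def)
      then have "(f ^^ k) (prod_encode (a, 0)) = prod_encode (a, 0)" for k by (induction k) simp_all
      then show ?thesis using Nil by (metis foldl_Nil list_encode.simps(1))
    next
      case (Cons x ys)
      have "f (prod_encode (a, list_encode xs)) = prod_encode (g a x, list_encode ys)"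
        by (simp add: f_def Cons)
      then show ?thesis using Suc Cons by (simp add: funpow_Suc_right del: funpow.simps)
    qed
  qed
  have len: "length xs \<le> list_encode xs" for xs
    by (induction xs) (auto intro: order_trans[OF _ le_prod_encode_2])
  have eq: "foldl g a (list_decode l) = fst (prod_decode ((f ^^ l) (prod_encode (a, l))))" for l
    using it[of "list_decode l" l a] len[of "list_decode l"] by simp
  have f: "recursive1 f" unfolding f_def One_nat_def
    by (intro recur recursive_comp2[OF assms]) simp_all
  show ?thesis unfolding eq
    by (intro recur recursive_comp2[OF recursive2_iterate[OF f]]) simp_all
qed

text \<open>Course-of-values recursion: \<open>h\<close> receives the values below \<open>n\<close> as the nested pair
  \<open>(f (n - 1), (f (n - 2), \<dots>))\<close>.\<close>

primrec history :: "(nat \<Rightarrow> nat) \<Rightarrow> nat \<Rightarrow> nat" where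
  "history f 0 = 0"
| "history f (Suc n) = prod_encode (f n, history f n)"

definition recall :: "nat \<Rightarrow> nat \<Rightarrow> nat \<Rightarrow> nat" where
  "recall n h j = fst (prod_decode (((\<lambda>z. snd (prod_decode z)) ^^ (n - Suc j)) h))"

lemma recall_history: "j < n \<Longrightarrow> recall n (history f n) j = f j"
proof -
  have "((\<lambda>z. snd (prod_decode z)) ^^ k) (history f (k + m)) = history f m" for k m
    by (induction k) (simp_all add: funpow_Suc_right del: funpow.simps)
  from this[of "n - Suc j" "Suc j"] show "j < n \<Longrightarrow> ?thesis" by (simp add: recall_def)
qed

lemma recursive_recall [recur]:
  assumes "recursive n f" "recursive n g" "recursive n h"
  shows "recursive n (\<lambda>xs. recall (f xs) (g xs) (h xs))"
  unfolding recall_def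
  by (intro recur assms recursive_comp2[OF recursive2_iterate[where f = "\<lambda>z. snd (prod_decode z)"]]) simp_all

lemma recursive2_course:
  assumes "recursive3 h" "\<And>n x. f n x = h n (history (\<lambda>n. f n x) n) x"
  shows "recursive2 f"
proof -
  have "recursive2 (\<lambda>n x. history (\<lambda>n. f n x) n)"
    by (rule recursive2_primrec[where a = "\<lambda>x. 0" and g = "\<lambda>k y x. prod_encode (h k y x, y)"])
      (intro recur recursive_comp3[OF assms(1)] | simp add: assms(2)[symmetric])+
  then show ?thesis
    by (subst assms(2)) (intro recursive_comp3[OF assms(1)] recur; simp)
qed

lemma decidable_bounded_all:
  assumes "decidable_rel 2 (\<lambda>xs. Q (xs ! 0) (xs ! 1))"
  shows "decidable_rel 1 (\<lambda>xs. \<forall>i<xs ! 0. Q i (xs ! 0))"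
proof -
  have "recursive2 (\<lambda>n x. of_bool (\<forall>i<n. Q i x))"
    by (rule recursive2_primrec[where a = "\<lambda>x. 1" and g = "\<lambda>k y x. y * of_bool (Q k x)"])
      (intro recur recursive_comp2[where f = "\<lambda>x y. of_bool (Q x y)"] assms
        | auto simp: less_Suc_eq)+
  from recursive_comp2[OF this, of 1 "\<lambda>xs. xs ! 0" "\<lambda>xs. xs ! 0"] show ?thesis
    unfolding decidable_rel_def by (simp add: recursive_nth)
qed


section \<open>Codes of formulas\<close>

text \<open>Makes decoding total, so that functions on numbers can be read as functions on formulas.
  For the tags 4 to 7 the components are at most \<open>n div 8\<close>, hence smaller than
  n.\<close>

lemma mlo_code_surj: "\<exists>\<phi>. mlo_code \<phi> = n"
proof (induction n rule: less_induct)
  case (less n)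
  define m where "m = n div 8"
  obtain a b where ab: "prod_decode m = (a, b)" by force
  then have m: "m = prod_encode (a, b)" by (metis prod_decode_inverse)
  have le: "a \<le> m" "b \<le> m" using le_prod_encode_1[of a b] le_prod_encode_2[of b a] m by auto
  have n: "n = 8 * m + n mod 8" by (simp add: m_def)
  have "n mod 8 \<in> {..<8}" by simp
  also have "{..<8} = {0, 1, 2, 3, 4, 5, 6, 7 :: nat}" by auto
  finally have "n mod 8 \<in> {0, 1, 2, 3} \<or> n mod 8 \<in> {4, 5, 6, 7}" by auto
  then show ?case
  proof
    assume "n mod 8 \<in> {0, 1, 2, 3}"
    then consider "n = mlo_code (Less a b)" | "n = mlo_code (Eq a b)" | "n = mlo_code (Mem a b)"
      | "n = mlo_code (Pred m)"
      using n m by fastforce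
    then show ?thesis by metis
  next
    assume k: "n mod 8 \<in> {4, 5, 6, 7}"
    then have "4 \<le> n mod 8" by auto
    then have "m < n" using n by linarith
    then obtain \<phi> \<alpha> \<beta> where "mlo_code \<phi> = m" "mlo_code \<alpha> = a" "mlo_code \<beta> = b"
      using less le by (meson le_less_trans)
    then consider "n = mlo_code (Neg \<phi>)" | "n = mlo_code (And \<alpha> \<beta>)" | "n = mlo_code (Ex1 a \<beta>)"
      | "n = mlo_code (Ex2 a \<beta>)"
      using n m k by fastforce
    then show ?thesis by metis
  qed
qed

definition mlo_decode :: "nat \<Rightarrow> mlo" where "mlo_decode = inv mlo_code"

lemma mlo_code_decode [simp]: "mlo_code (mlo_decode n) = n"
  unfolding mlo_decode_def by (rule f_inv_into_f) (metis mlo_code_surj rangeI)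

lemma mlo_decode_code [simp]: "mlo_decode (mlo_code \<phi>) = \<phi>"
  by (rule mlo_code_inject) simp

lemmas mlo_decode_simps = mlo_decode_code[of "Less x y" for x y, unfolded mlo_code.simps]
  mlo_decode_code[of "Eq x y" for x y, unfolded mlo_code.simps]
  mlo_decode_code[of "Mem x Z" for x Z, unfolded mlo_code.simps]
  mlo_decode_code[of "Pred x" for x, unfolded mlo_code.simps]
  mlo_decode_code[of "Neg \<phi>" for \<phi>, unfolded mlo_code.simps]
  mlo_decode_code[of "And \<phi> \<psi>" for \<phi> \<psi>, unfolded mlo_code.simps]
  mlo_decode_code[of "Ex1 x \<phi>" for x \<phi>, unfolded mlo_code.simps]
  mlo_decode_code[of "Ex2 Z \<phi>" for Z \<phi>, unfolded mlo_code.simps]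

lemma subformula_less:
  "mlo_code \<phi> < mlo_code (Neg \<phi>)" "mlo_code \<phi> < mlo_code (And \<phi> \<psi>)" "mlo_code \<psi> < mlo_code (And \<phi> \<psi>)"
  "mlo_code \<phi> < mlo_code (Ex1 x \<phi>)" "mlo_code \<phi> < mlo_code (Ex2 x \<phi>)"
  using le_prod_encode_1[of "mlo_code \<phi>" "mlo_code \<psi>"] le_prod_encode_2[of "mlo_code \<psi>" "mlo_code \<phi>"]
    le_prod_encode_2[of "mlo_code \<phi>" x]
  by simp_all

lemma free_le_code: "v \<in> free1 \<phi> \<Longrightarrow> v \<le> mlo_code \<phi>" "v \<in> free2 \<phi> \<Longrightarrow> v \<le> mlo_code \<phi>"
proof (induction \<phi>)
  case (Less x y)
  { case 1 show ?case using 1 le_prod_encode_1[of x y] le_prod_encode_2[of y x] by auto }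
  { case 2 then show ?case by simp }
next
  case (Eq x y)
  { case 1 show ?case using 1 le_prod_encode_1[of x y] le_prod_encode_2[of y x] by auto }
  { case 2 then show ?case by simp }
next
  case (Mem x y)
  { case 1 show ?case using 1 le_prod_encode_1[of x y] by auto }
  { case 2 show ?case using 2 le_prod_encode_2[of y x] by auto }
next
  case (Pred x)
  { case 1 then show ?case by simp }
  { case 2 then show ?case by simp }
next
  case (Neg \<phi>)
  { case 1 then show ?case using Neg(1) by fastforce }
  { case 2 then show ?case using Neg(2) by fastforce }
next
  case (And \<phi> \<psi>)
  { case 1 then show ?case using And(1,3) subformula_less(2,3)[where \<phi> = \<phi> and \<psi> = \<psi>]
      by (auto simp del: mlo_code.simps) }
  { case 2 then show ?case using And(2,4) subformula_less(2,3)[where \<phi> = \<phi> and \<psi> = \<psi>]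
      by (auto simp del: mlo_code.simps) }
next
  case (Ex1 x \<phi>)
  { case 1 then show ?case using Ex1(1) subformula_less(4)[of \<phi> x] by (auto simp del: mlo_code.simps) }
  { case 2 then show ?case using Ex1(2) subformula_less(4)[of \<phi> x] by (auto simp del: mlo_code.simps) }
next
  case (Ex2 x \<phi>)
  { case 1 then show ?case using Ex2(1) subformula_less(5)[of \<phi> x] by (auto simp del: mlo_code.simps) }
  { case 2 then show ?case using Ex2(2) subformula_less(5)[of \<phi> x] by (auto simp del: mlo_code.simps) }
qed

definition sentence :: "mlo \<Rightarrow> bool" where
  "sentence \<phi> \<longleftrightarrow> free1 \<phi> = {} \<and> free2 \<phi> = {}"

text \<open>Course-of-values recursion on the code: the tag is \<open>c mod 8\<close>, the
  components lie in \<open>c div 8\<close>, and subformulas have smaller codes.\<close>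

lemma recursive_free1: "recursive2 (\<lambda>c v. of_bool (v \<in> free1 (mlo_decode c)))"
proof -
  let ?a = "\<lambda>c. fst (prod_decode (c div 8))" and ?b = "\<lambda>c. snd (prod_decode (c div 8))"
  let ?h = "\<lambda>c h v. if c mod 8 \<le> 1 then of_bool (v = ?a c \<or> v = ?b c) else
    if c mod 8 = 2 then of_bool (v = ?a c) else if c mod 8 = 3 then of_bool (v = c div 8) else
    if c mod 8 = 4 then recall c h (c div 8) else
    if c mod 8 = 5 then of_bool (recall c h (?a c) = 1 \<or> recall c h (?b c) = 1) else
    if c mod 8 = 6 then of_bool (recall c h (?b c) = 1 \<and> v \<noteq> ?a c) else recall c h (?b c)"
  have h: "recursive3 ?h" by (intro recur) simp_all
  have "of_bool (v \<in> free1 (mlo_decode c)) =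
      ?h c (history (\<lambda>c. of_bool (v \<in> free1 (mlo_decode c))) c) v" for c v
  proof -
  obtain \<phi> where c: "c = mlo_code \<phi>" using mlo_code_surj by metis
  define f where "f = (\<lambda>c. of_bool (v \<in> free1 (mlo_decode c)) :: nat)"
  have "f (mlo_code \<phi>) = ?h (mlo_code \<phi>) (history f (mlo_code \<phi>)) v"
  proof (cases \<phi>)
    case (Neg \<psi>)
    show ?thesis using subformula_less(1)[of \<psi>] by (simp add: Neg recall_history f_def mlo_decode_simps)
  next
    case (And \<psi> \<chi>)
    show ?thesis using subformula_less(2,3)[where \<phi> = \<psi> and \<psi> = \<chi>]
      by (simp add: And recall_history f_def mlo_decode_simps)
  next
    case (Ex1 x \<psi>)
    show ?thesis using subformula_less(4)[of \<psi> x]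
      by (simp add: Ex1 recall_history f_def mlo_decode_simps)
  next
    case (Ex2 x \<psi>)
    show ?thesis using subformula_less(5)[of \<psi> x]
      by (simp add: Ex2 recall_history f_def mlo_decode_simps)
  next
    case (Less x y)
    show ?thesis by (simp add: Less f_def mlo_decode_simps)
  next
    case (Eq x y)
    have "Suc (8 * prod_encode (x, y)) div 8 = prod_encode (x, y)" by presburger
    then show ?thesis using mlo_decode_simps(2)[of x y] by (simp add: Eq f_def)
  next
    case (Mem x y)
    have "Suc (Suc (8 * prod_encode (x, y))) div 8 = prod_encode (x, y)"
      "Suc (Suc (8 * prod_encode (x, y))) mod 8 = 2" by presburger+
    then show ?thesis using mlo_decode_simps(3)[of x y] by (simp add: Mem f_def)
  next
    case (Pred x)
    show ?thesis by (simp add: Pred f_def mlo_decode_simps)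
  qed
  then show ?thesis unfolding f_def c .
  qed
  then show ?thesis by (rule recursive2_course[OF h])
qed

lemma recursive_free2: "recursive2 (\<lambda>c v. of_bool (v \<in> free2 (mlo_decode c)))"
proof -
  let ?a = "\<lambda>c. fst (prod_decode (c div 8))" and ?b = "\<lambda>c. snd (prod_decode (c div 8))"
  let ?h = "\<lambda>c h v. if c mod 8 \<le> 1 then 0 else
    if c mod 8 = 2 then of_bool (v = ?b c) else if c mod 8 = 3 then 0 else
    if c mod 8 = 4 then recall c h (c div 8) else
    if c mod 8 = 5 then of_bool (recall c h (?a c) = 1 \<or> recall c h (?b c) = 1) else
    if c mod 8 = 6 then recall c h (?b c) else of_bool (recall c h (?b c) = 1 \<and> v \<noteq> ?a c)"
  have h: "recursive3 ?h" by (intro recur) simp_all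
  have "of_bool (v \<in> free2 (mlo_decode c)) =
      ?h c (history (\<lambda>c. of_bool (v \<in> free2 (mlo_decode c))) c) v" for c v
  proof -
  obtain \<phi> where c: "c = mlo_code \<phi>" using mlo_code_surj by metis
  define f where "f = (\<lambda>c. of_bool (v \<in> free2 (mlo_decode c)) :: nat)"
  have "f (mlo_code \<phi>) = ?h (mlo_code \<phi>) (history f (mlo_code \<phi>)) v"
  proof (cases \<phi>)
    case (Neg \<psi>)
    show ?thesis using subformula_less(1)[of \<psi>] by (simp add: Neg recall_history f_def mlo_decode_simps)
  next
    case (And \<psi> \<chi>)
    show ?thesis using subformula_less(2,3)[where \<phi> = \<psi> and \<psi> = \<chi>]
      by (simp add: And recall_history f_def mlo_decode_simps)
  next
    case (Ex1 x \<psi>)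
    show ?thesis using subformula_less(4)[of \<psi> x]
      by (simp add: Ex1 recall_history f_def mlo_decode_simps)
  next
    case (Ex2 x \<psi>)
    show ?thesis using subformula_less(5)[of \<psi> x]
      by (simp add: Ex2 recall_history f_def mlo_decode_simps)
  next
    case (Less x y)
    show ?thesis by (simp add: Less f_def mlo_decode_simps)
  next
    case (Eq x y)
    have "Suc (8 * prod_encode (x, y)) div 8 = prod_encode (x, y)" by presburger
    then show ?thesis using mlo_decode_simps(2)[of x y] by (simp add: Eq f_def)
  next
    case (Mem x y)
    have "Suc (Suc (8 * prod_encode (x, y))) div 8 = prod_encode (x, y)"
      "Suc (Suc (8 * prod_encode (x, y))) mod 8 = 2" by presburger+
    then show ?thesis using mlo_decode_simps(3)[of x y] by (simp add: Mem f_def)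
  next
    case (Pred x)
    show ?thesis by (simp add: Pred f_def mlo_decode_simps)
  qed
  then show ?thesis unfolding f_def c .
  qed
  then show ?thesis by (rule recursive2_course[OF h])
qed

lemma decidable_free [recur]:
  assumes "recursive n f" "recursive n g"
  shows "decidable_rel n (\<lambda>xs. f xs \<in> free1 (mlo_decode (g xs)))"
    "decidable_rel n (\<lambda>xs. f xs \<in> free2 (mlo_decode (g xs)))"
  unfolding decidable_rel_def
  by (rule recursive_comp2[OF recursive_free1 assms(2,1)], rule recursive_comp2[OF recursive_free2 assms(2,1)])

text \<open>Free variables are bounded by the code, so a bounded quantifier suffices; the shift by
  one adapts the inclusive bound to the strict one of \<open>decidable_bounded_all\<close>.\<close>

lemma decidable_sentence: "decidable_rel 1 (\<lambda>xs. sentence (mlo_decode (xs ! 0)))"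
proof -
  have *: "decidable_rel 1 (\<lambda>xs. \<forall>i<xs ! 0. i \<notin> free1 (mlo_decode (xs ! 0 - Suc 0)) \<and> i \<notin> free2 (mlo_decode (xs ! 0 - Suc 0)))"
    by (rule decidable_bounded_all[where Q = "\<lambda>i c. i \<notin> free1 (mlo_decode (c - Suc 0)) \<and> i \<notin> free2 (mlo_decode (c - Suc 0))"])
      (intro recur; simp)
  have "(\<forall>i<Suc c. i \<notin> free1 (mlo_decode c) \<and> i \<notin> free2 (mlo_decode c)) \<longleftrightarrow> sentence (mlo_decode c)" for c
    using free_le_code[of _ "mlo_decode c"] by (auto simp: sentence_def less_Suc_eq_le)
  with recursive_comp1[OF *[unfolded decidable_rel_def], OF recursive_Suc[OF recursive_nth[of 0 1]]]
  show ?thesis by (simp add: decidable_rel_def)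
qed

text \<open>The given program is known to answer on sentences and may diverge elsewhere. Other
  formulas are replaced by a fixed sentence before it is run, and its result is multiplied by the
  indicator of being a sentence.\<close>

lemma decidable_theory_of_sentences:
  assumes "\<And>\<phi>. sentence \<phi> \<Longrightarrow> run d [mlo_code \<phi>] = Some (of_bool (sat P (\<lambda>_. 0) (\<lambda>_. {}) \<phi>))"
  shows "monadic_theory_decidable P"
proof -
  let ?\<theta> = "Neg (Ex1 0 (Less 0 0))"
  obtain s where s: "\<And>xs. length xs = 1 \<Longrightarrow> run s xs = Some (of_bool (sentence (mlo_decode (xs ! 0))))"
    using decidable_sentence unfolding decidable_rel_def recursive_def by blast
  have "recursive1 (\<lambda>c. if sentence (mlo_decode c) then c else mlo_code ?\<theta>)"
    by (intro recur decidable_sentence) simp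
  then obtain r where r: "\<And>xs. length xs = 1 \<Longrightarrow> run r xs = Some (if sentence (mlo_decode (xs ! 0)) then xs ! 0 else mlo_code ?\<theta>)"
    unfolding recursive_def by blast
  have "recursive2 (\<lambda>x y. x * y)" by (intro recur) simp_all
  then obtain m where m: "\<And>xs. length xs = 2 \<Longrightarrow> run m xs = Some (xs ! 0 * xs ! 1)"
    unfolding recursive_def by blast
  have "sentence ?\<theta>" by (simp add: sentence_def)
  note d = assms[OF this] assms
  have "run (Comp m [s, Comp d [r]]) [mlo_code \<phi>] = Some (of_bool (\<phi> \<in> monadic_theory P))" for \<phi>
    using d by (auto simp: s r m monadic_theory_def sentence_def simp del: mlo_code.simps)
  then show ?thesis unfolding monadic_theory_decidable_def decidable_on_def by blast
qed


section \<open>Synthesis by search\<close>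

lemma sentence_in_specs: "sentence \<phi> \<Longrightarrow> \<phi> \<in> specs"
  by (simp add: sentence_def specs_def)

lemma holds_sentence: "sentence \<phi> \<Longrightarrow> holds \<phi> X Y P \<longleftrightarrow> sat P (\<lambda>_. 0) (\<lambda>_. {}) \<phi>"
  unfolding holds_def sentence_def by (rule sat_cong) auto

lemma holds_sat:
  assumes "\<psi> \<in> specs" "V 0 = X" "V 1 = Y"
  shows "sat P u V \<psi> \<longleftrightarrow> holds \<psi> X Y P"
  unfolding holds_def by (rule sat_cong) (use assms in \<open>auto simp: specs_def\<close>)

definition unary :: "mlo \<Rightarrow> bool" where
  "unary \<beta> \<longleftrightarrow> free1 \<beta> \<subseteq> {0} \<and> free2 \<beta> \<subseteq> {0}"

definition mlo_iff :: "mlo \<Rightarrow> mlo \<Rightarrow> mlo" where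
  "mlo_iff \<phi> \<psi> = And (Neg (And \<phi> (Neg \<psi>))) (Neg (And \<psi> (Neg \<phi>)))"

definition mlo_all :: "nat \<Rightarrow> mlo \<Rightarrow> mlo" where
  "mlo_all x \<phi> = Neg (Ex1 x (Neg \<phi>))"

definition mlo_same :: "nat \<Rightarrow> nat \<Rightarrow> mlo" where
  "mlo_same Z W = mlo_all 0 (mlo_iff (Mem 0 Z) (Mem 0 W))"

definition mlo_taut :: "mlo \<Rightarrow> mlo" where
  "mlo_taut \<phi> = Neg (And \<phi> (Neg \<phi>))"

definition mlo_suc :: mlo where
  "mlo_suc = And (Less 0 1) (Neg (Ex1 2 (And (Less 0 2) (Less 2 1))))"

lemma sat_mlo [simp]:
  "sat P u V (mlo_iff \<phi> \<psi>) \<longleftrightarrow> (sat P u V \<phi> \<longleftrightarrow> sat P u V \<psi>)"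
  "sat P u V (mlo_all x \<phi>) \<longleftrightarrow> (\<forall>n. sat P (u(x := n)) V \<phi>)"
  "sat P u V (mlo_same Z W) \<longleftrightarrow> V Z = V W"
  "sat P u V (mlo_taut \<phi>)"
  by (auto simp: mlo_iff_def mlo_all_def mlo_same_def mlo_taut_def)

lemma sat_mlo_suc [simp]: "sat P u V mlo_suc \<longleftrightarrow> u 1 = Suc (u 0)"
proof -
  have "sat P u V mlo_suc \<longleftrightarrow> u 0 < u 1 \<and> \<not> (\<exists>n. u 0 < n \<and> n < u 1)" by (simp add: mlo_suc_def)
  also have "\<dots> \<longleftrightarrow> u 1 = Suc (u 0)" by (metis Suc_lessI lessI not_less_eq)
  finally show ?thesis .
qed

lemma free_mlo [simp]:
  "free1 (mlo_iff \<phi> \<psi>) = free1 \<phi> \<union> free1 \<psi>" "free2 (mlo_iff \<phi> \<psi>) = free2 \<phi> \<union> free2 \<psi>"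
  "free1 (mlo_all x \<phi>) = free1 \<phi> - {x}" "free2 (mlo_all x \<phi>) = free2 \<phi>"
  "free1 (mlo_same Z W) = {}" "free2 (mlo_same Z W) = {Z, W}"
  "free1 (mlo_taut \<phi>) = free1 \<phi>" "free2 (mlo_taut \<phi>) = free2 \<phi>"
  "free1 mlo_suc = {0, 1}" "free2 mlo_suc = {}"
  by (auto simp: mlo_iff_def mlo_all_def mlo_same_def mlo_taut_def mlo_suc_def)

text \<open>Set variable 0 is rebound to the truncation of set variable 2 at the number in variable
  0, so \<beta> is inserted without substitution and codes are easy to compute.\<close>

definition restricted :: "bool \<Rightarrow> mlo \<Rightarrow> mlo" where
  "restricted s \<beta> = Ex2 0 (And (mlo_all 1 (mlo_iff (Mem 1 0)
     (And (Mem 1 2) (if s then Less 1 0 else Neg (Less 0 1))))) \<beta>)"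

lemma free_restricted [simp]:
  "free1 (restricted s \<beta>) = insert 0 (free1 \<beta>)" "free2 (restricted s \<beta>) = insert 2 (free2 \<beta> - {0})"
  by (auto simp: restricted_def)

lemma sat_restricted:
  assumes "unary \<beta>" shows "sat P u V (restricted s \<beta>) \<longleftrightarrow> u 0 \<in> strategy s P \<beta> (V 2)"
proof -
  define B where "B = V 2 \<inter> (if s then {..<u 0} else {..u 0})"
  have "sat P u V (restricted s \<beta>) \<longleftrightarrow> (\<exists>A. A = B \<and> sat P u (V(0 := A)) \<beta>)"
    unfolding restricted_def B_def by (auto simp: set_eq_iff not_less intro!: exI)
  also have "\<dots> \<longleftrightarrow> sat P u (V(0 := B)) \<beta>" by blast
  also have "\<dots> \<longleftrightarrow> sat P (\<lambda>_. u 0) ((\<lambda>_. {})(0 := B)) \<beta>"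
    by (rule sat_cong) (use assms in \<open>auto simp: unary_def\<close>)
  finally show ?thesis by (simp add: strategy_def B_def)
qed

text \<open>The tautological conjuncts make this a sentence only if \<open>\<beta>\<close> is unary and \<open>\<psi>\<close> is a
  specification.\<close>

definition wins :: "bool \<Rightarrow> mlo \<Rightarrow> mlo \<Rightarrow> mlo" where
  "wins s \<beta> \<psi> = And (Ex1 0 (Ex2 0 (mlo_taut \<beta>))) (And (Ex2 0 (Ex2 1 (mlo_taut \<psi>)))
     (Neg (Ex2 2 (Ex2 3 (And (mlo_all 0 (mlo_iff (Mem 0 3) (restricted s \<beta>)))
       (Ex2 0 (Ex2 1 (And (mlo_same 0 (if s then 3 else 2)) (And (mlo_same 1 (if s then 2 else 3))
         (if s then \<psi> else Neg \<psi>))))))))))"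

lemma sentence_wins: "sentence (wins s \<beta> \<psi>) \<longleftrightarrow> unary \<beta> \<and> \<psi> \<in> specs"
  by (auto simp: sentence_def wins_def unary_def specs_def)

text \<open>Set variable 2 holds the opponent's sequence and 3 the answer of the strategy. Variables
  0 and 1 are then bound anew as copies of them, in the order given by s, so that \<psi> too is used
  without substitution.\<close>

lemma sat_wins:
  assumes "unary \<beta>" "\<psi> \<in> specs"
  shows "sat P u V (wins s \<beta> \<psi>) \<longleftrightarrow>
    (\<forall>Z. if s then \<not> holds \<psi> (strategy True P \<beta> Z) Z P else holds \<psi> Z (strategy False P \<beta> Z) P)"
proof -
  have eq: "(\<forall>n. n \<in> A \<longleftrightarrow> n \<in> B) \<longleftrightarrow> A = B" for A B :: "nat set" by blast
  show ?thesis
    unfolding wins_def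
    by (cases s) (auto simp: sat_restricted[OF assms(1)] eq holds_sat[OF assms(2)] simp del: fun_upd_apply
        simp: fun_upd_same fun_upd_other)
qed

lemma wins_in_theory:
  "wins s \<beta> \<psi> \<in> monadic_theory P \<longleftrightarrow> unary \<beta> \<and> \<psi> \<in> specs \<and>
    (\<forall>Z. if s then \<not> holds \<psi> (strategy True P \<beta> Z) Z P else holds \<psi> Z (strategy False P \<beta> Z) P)"
  using sentence_wins[of s \<beta> \<psi>] sat_wins[of \<beta> \<psi> P _ _ s] by (auto simp: monadic_theory_def sentence_def)

text \<open>Two first-order variables are recycled: each step passes from the value of variable 1 to
  its predecessor and checks one letter there. The formula arises by a left fold over the list,
  whose code \<open>recursive1_foldl\<close> computes.\<close>

definition listed :: "bool list \<Rightarrow> mlo" where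
  "listed l = foldl (\<lambda>\<phi> a. Ex1 0 (And mlo_suc (And (if a then Mem 0 2 else Neg (Mem 0 2))
     (Ex1 1 (And (Eq 1 0) \<phi>))))) (Neg (Ex1 0 (Less 0 1))) l"

lemma sat_listed:
  "sat P u V (listed l) \<longleftrightarrow> u 1 = length l \<and> (\<forall>i<length l. i \<in> V 2 \<longleftrightarrow> l ! i)"
proof (induction l arbitrary: u rule: rev_induct)
  case Nil
  have "(\<forall>n. \<not> n < m) \<longleftrightarrow> m = 0" for m :: nat by (metis neq0_conv not_less0)
  then show ?case by (simp add: listed_def)
next
  case (snoc a l)
  have "listed (l @ [a]) = Ex1 0 (And mlo_suc (And (if a then Mem 0 2 else Neg (Mem 0 2))
     (Ex1 1 (And (Eq 1 0) (listed l)))))" by (simp add: listed_def)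
  then show ?case by (cases a) (auto simp: snoc nth_append less_Suc_eq)
qed

lemma free_listed: "free1 (listed l) \<subseteq> {1}" "free2 (listed l) \<subseteq> {2}"
  by (induction l rule: rev_induct) (auto simp: listed_def)

definition evaluation :: "bool \<Rightarrow> mlo \<Rightarrow> bool list \<Rightarrow> mlo" where
  "evaluation s \<beta> l = Ex2 2 (Ex1 0 (Ex1 1 (And mlo_suc (And (listed l) (restricted s \<beta>)))))"

lemma strategy_cong:
  "(\<And>i. i \<le> n \<Longrightarrow> (s \<longrightarrow> i < n) \<Longrightarrow> i \<in> X \<longleftrightarrow> i \<in> X') \<Longrightarrow> n \<in> strategy s P \<beta> X \<longleftrightarrow> n \<in> strategy s P \<beta> X'"
proof -
  assume "\<And>i. i \<le> n \<Longrightarrow> (s \<longrightarrow> i < n) \<Longrightarrow> i \<in> X \<longleftrightarrow> i \<in> X'"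
  then have "X \<inter> (if s then {..<n} else {..n}) = X' \<inter> (if s then {..<n} else {..n})" by auto
  then show ?thesis by (simp add: strategy_def)
qed

text \<open>By truncation all sets that begin with \<open>l\<close> give the same answer at its last
  position, so the existential sentence computes the strategy on the finite input.\<close>

lemma evaluation_in_theory:
  assumes "unary \<beta>" "l \<noteq> []" "\<And>i. i < length l \<Longrightarrow> i \<in> X \<longleftrightarrow> l ! i"
  shows "evaluation s \<beta> l \<in> monadic_theory P \<longleftrightarrow> length l - 1 \<in> strategy s P \<beta> X"
proof -
  have "free1 (evaluation s \<beta> l) = {}" "free2 (evaluation s \<beta> l) = {}"
    using free_listed[of l] assms(1) by (auto simp: evaluation_def unary_def)
  moreover have "sat P u V (evaluation s \<beta> l) \<longleftrightarrow>
      (\<exists>A. (\<forall>i<length l. i \<in> A \<longleftrightarrow> l ! i) \<and> length l - 1 \<in> strategy s P \<beta> A)" for u V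
  proof -
    have "sat P u V (evaluation s \<beta> l) \<longleftrightarrow> (\<exists>A n m. m = Suc n \<and> m = length l \<and>
        (\<forall>i<length l. i \<in> A \<longleftrightarrow> l ! i) \<and> n \<in> strategy s P \<beta> A)"
      by (simp add: evaluation_def sat_restricted[OF assms(1)] sat_listed)
    also have "\<dots> \<longleftrightarrow> (\<exists>A. (\<forall>i<length l. i \<in> A \<longleftrightarrow> l ! i) \<and> length l - 1 \<in> strategy s P \<beta> A)"
      using assms(2) by (cases l) auto
    finally show ?thesis .
  qed
  moreover have "length l - 1 \<in> strategy s P \<beta> A \<longleftrightarrow> length l - 1 \<in> strategy s P \<beta> X"
    if "\<forall>i<length l. i \<in> A \<longleftrightarrow> l ! i" for A
  proof (rule strategy_cong)
    fix i assume "i \<le> length l - 1"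
    then have "i < length l" using assms(2) by (cases l) auto
    then show "i \<in> A \<longleftrightarrow> i \<in> X" using that assms(3) by blast
  qed
  ultimately show ?thesis using assms(3) unfolding monadic_theory_def mem_Collect_eq by metis
qed

lemma recursive_mlo [recur]:
  assumes "recursive n (\<lambda>xs. mlo_code (A xs))"
  shows "recursive n (\<lambda>xs. mlo_code (Neg (A xs)))"
    "recursive n (\<lambda>xs. mlo_code (Ex1 x (A xs)))" "recursive n (\<lambda>xs. mlo_code (Ex2 x (A xs)))"
  unfolding mlo_code.simps by (intro recur assms)+

lemma recursive_And [recur]:
  assumes "recursive n (\<lambda>xs. mlo_code (A xs))" "recursive n (\<lambda>xs. mlo_code (B xs))"
  shows "recursive n (\<lambda>xs. mlo_code (And (A xs) (B xs)))"
  unfolding mlo_code.simps by (intro recur assms)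

lemma recursive_mlo_if [recur]:
  assumes "decidable_rel n Q" "recursive n (\<lambda>xs. mlo_code (A xs))" "recursive n (\<lambda>xs. mlo_code (B xs))"
  shows "recursive n (\<lambda>xs. mlo_code (if Q xs then A xs else B xs))"
  unfolding if_distrib[of mlo_code] by (intro recur assms)

lemma decidable_const [recur]: "decidable_rel n (\<lambda>xs. b)"
  unfolding decidable_rel_def by (rule recursive_const)

lemma recursive_decode [recur]:
  "recursive n f \<Longrightarrow> recursive n (\<lambda>xs. mlo_code (mlo_decode (f xs)))"
  by simp

lemma recursive_wins [recur]:
  assumes "recursive n (\<lambda>xs. mlo_code (A xs))" "recursive n (\<lambda>xs. mlo_code (B xs))"
  shows "recursive n (\<lambda>xs. mlo_code (wins s (A xs) (B xs)))"
  unfolding wins_def restricted_def mlo_all_def mlo_iff_def mlo_taut_def by (intro recur assms)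

lemma recursive_listed:
  assumes "decidable_rel 1 (\<lambda>xs. t (xs ! 0))"
  shows "recursive1 (\<lambda>l. mlo_code (listed (map t (list_decode l))))"
proof -
  let ?f = "\<lambda>\<phi> a. Ex1 0 (And mlo_suc (And (if t a then Mem 0 2 else Neg (Mem 0 2)) (Ex1 1 (And (Eq 1 0) \<phi>))))"
  have t: "decidable_rel 2 (\<lambda>xs. t (xs ! 1))"
    using recursive_comp1[OF assms[unfolded decidable_rel_def] recursive_nth[of 1 2]]
    by (simp add: decidable_rel_def)
  have "recursive2 (\<lambda>c a. mlo_code (?f (mlo_decode c) a))" by (intro recur t) simp_all
  note recursive1_foldl[OF this]
  moreover have "mlo_code (foldl ?f \<phi> l) = foldl (\<lambda>c a. mlo_code (?f (mlo_decode c) a)) (mlo_code \<phi>) l" for \<phi> l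
    by (induction l arbitrary: \<phi>) (simp_all del: mlo_code.simps)
  ultimately show ?thesis unfolding listed_def foldl_map by simp
qed

lemma recursive_evaluation:
  assumes "decidable_rel 1 (\<lambda>xs. t (xs ! 0))"
  shows "recursive2 (\<lambda>b l. mlo_code (evaluation s (mlo_decode b) (map t (list_decode l))))"
  unfolding evaluation_def restricted_def mlo_all_def mlo_iff_def
  by (intro recur recursive_comp1[OF recursive_listed[OF assms]]) simp_all

lemma decidable_theory [recur]:
  assumes "monadic_theory_decidable P" "recursive n (\<lambda>xs. mlo_code (A xs))"
  shows "decidable_rel n (\<lambda>xs. A xs \<in> monadic_theory P)"
proof -
  obtain d where d: "\<And>\<phi>. run d [mlo_code \<phi>] = Some (of_bool (\<phi> \<in> monadic_theory P))"
    using assms(1) unfolding monadic_theory_decidable_def decidable_on_def by blast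
  have "recursive1 (\<lambda>c. of_bool (mlo_decode c \<in> monadic_theory P))"
    unfolding recursive_def using d[of "mlo_decode _"] by (intro exI[of _ d]) (auto simp: length_Suc_conv)
  from recursive_comp1[OF this assms(2)] show ?thesis by (simp add: decidable_rel_def)
qed

primrec numeral_program :: "nat \<Rightarrow> recf" where
  "numeral_program 0 = Zero"
| "numeral_program (Suc n) = Comp Succ [numeral_program n]"

lemma run_numeral_program: "run (numeral_program n) xs = Some n"
  by (induction n) simp_all

lemma recursive_numeral_program: "recursive1 (\<lambda>n. recf_code (numeral_program n))"
  by (rule recursive1_primrec[where g = "\<lambda>k y. prod_encode (3, prod_encode (recf_code Succ, Suc (prod_encode (y, 0))))"])
    (intro recur | simp)+

text \<open>The s-m-n theorem for one parameter: the program composes \<open>p\<close> with a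
  program for the constant b, whose code is computable from b.\<close>

lemma parametrization:
  assumes "recursive2 f"
  obtains q where "recursive1 (\<lambda>b. recf_code (q b))" "\<And>b x. run (q b) [x] = Some (f b x)"
proof -
  obtain p where p: "\<And>xs. length xs = 2 \<Longrightarrow> run p xs = Some (f (xs ! 0) (xs ! 1))"
    using assms unfolding recursive_def by blast
  let ?q = "\<lambda>b. Comp p [numeral_program b, Proj 0]"
  have "recursive1 (\<lambda>b. prod_encode (3, prod_encode (recf_code p,
      Suc (prod_encode (recf_code (numeral_program b), Suc (prod_encode (recf_code (Proj 0), 0)))))))"
    by (intro recur recursive_comp1[OF recursive_numeral_program]) simp
  then have "recursive1 (\<lambda>b. recf_code (?q b))" by simp
  moreover have "run (?q b) [x] = Some (f b x)" for b x by (simp add: run_numeral_program p)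
  ultimately show ?thesis by (rule that)
qed

text \<open>The function t extracts from an input letter the bit that the strategy reads: the
  identity for operators of one argument, the first projection for F(X, P).\<close>

definition strategy_op :: "bool \<Rightarrow> nat set \<Rightarrow> mlo \<Rightarrow> ('a \<Rightarrow> bool) \<Rightarrow> 'a word \<Rightarrow> bool word" where
  "strategy_op s P \<beta> t w = (\<lambda>n. n \<in> strategy s P \<beta> {i. t (w i)})"

lemma strategy_op_causal: "causal (strategy_op False P \<beta> t)"
  unfolding causal_def strategy_op_def by (intro allI impI ballI strategy_cong) auto

lemma strategy_op_strongly_causal: "strongly_causal (strategy_op True P \<beta> t)"
  unfolding strongly_causal_def strategy_op_def by (intro allI impI ballI strategy_cong) auto

lemma apply_strategy_op:
  "apply1 (strategy_op s P \<beta> (\<lambda>x. x)) X = strategy s P \<beta> X"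
  "apply2 (strategy_op s P \<beta> fst) X P' = strategy s P \<beta> X"
  by (simp_all add: apply1_def apply2_def strategy_op_def char_word_def)

text \<open>Uniform in the code b, so that a program can be computed from whatever formula the
  search returns. The function \<open>t'\<close> reads the relevant bit from the code of a
  letter.\<close>

lemma strategy_programs:
  assumes "monadic_theory_decidable P" "\<And>x. t' (c x) = t x" "decidable_rel 1 (\<lambda>xs. t' (xs ! 0))"
  shows "\<exists>q. recursive1 (\<lambda>b. recf_code (q b)) \<and>
    (\<forall>b. unary (mlo_decode b) \<longrightarrow> program_for c (q b) (strategy_op s P (mlo_decode b) t))"
proof -
  have "recursive2 (\<lambda>b l. of_bool (evaluation s (mlo_decode b) (map t' (list_decode l)) \<in> monadic_theory P))"
    by (intro recur decidable_theory[OF assms(1)] recursive_evaluation[OF assms(3)])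
  then obtain q where q: "recursive1 (\<lambda>b. recf_code (q b))"
    "\<And>b l. run (q b) [l] = Some (of_bool (evaluation s (mlo_decode b) (map t' (list_decode l)) \<in> monadic_theory P))"
    by (rule parametrization) blast
  show ?thesis
  proof (intro exI[of _ q] conjI allI impI q(1))
    fix b assume b: "unary (mlo_decode b)"
    show "program_for c (q b) (strategy_op s P (mlo_decode b) t)"
      unfolding program_for_def
    proof (intro allI impI)
      fix a w assume "a \<noteq> ([] :: 'a list)"
      then have "evaluation s (mlo_decode b) (map t a) \<in> monadic_theory P \<longleftrightarrow>
          length a - 1 \<in> strategy s P (mlo_decode b) {i. t ((a \<frown> w) i)}"
        by (subst evaluation_in_theory[OF b]) (auto simp: conc_def)
      then show "run (q b) [list_encode (map c a)] =
          Some (of_bool (strategy_op s P (mlo_decode b) t (a \<frown> w) (length a - 1)))"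
        by (simp add: q(2) strategy_op_def assms(2) comp_def)
    qed
  qed
qed

text \<open>Position n of \<open>G (F X)\<close> depends only on the positions of X below n.
  Iterating from the empty set, k iterations therefore settle all positions below k.\<close>

lemma causal_fixpoint:
  fixes F G :: "nat set \<Rightarrow> nat set"
  assumes F: "\<And>n X X'. (\<And>i. i \<le> n \<Longrightarrow> i \<in> X \<longleftrightarrow> i \<in> X') \<Longrightarrow> n \<in> F X \<longleftrightarrow> n \<in> F X'"
    and G: "\<And>n X X'. (\<And>i. i < n \<Longrightarrow> i \<in> X \<longleftrightarrow> i \<in> X') \<Longrightarrow> n \<in> G X \<longleftrightarrow> n \<in> G X'"
  obtains X where "X = G (F X)"
proof -
  define S where "S k = ((\<lambda>X. G (F X)) ^^ k) {}" for k
  have GF: "n \<in> G (F X) \<longleftrightarrow> n \<in> G (F X')" if X: "\<And>i. i < n \<Longrightarrow> i \<in> X \<longleftrightarrow> i \<in> X'" for n X X'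
    by (intro G F X) (rule le_less_trans)
  have stable: "n \<in> S k \<longleftrightarrow> n \<in> S (Suc n)" if "n < k" for n k
    using that
  proof (induction n arbitrary: k rule: less_induct)
    case (less n)
    then obtain k' where k: "k = Suc k'" "n \<le> k'" by (cases k) auto
    have "m \<in> S k' \<longleftrightarrow> m \<in> S n" if "m < n" for m
      using less.IH[OF that, of k'] less.IH[OF that that] that k(2) by simp
    from GF[OF this] show ?case by (simp add: S_def k(1))
  qed
  define X where "X = {n. n \<in> S (Suc n)}"
  have "n \<in> X \<longleftrightarrow> n \<in> G (F X)" for n
  proof -
    have "m \<in> S n \<longleftrightarrow> m \<in> X" if "m < n" for m using stable[OF that] by (simp add: X_def)
    from GF[OF this] show ?thesis by (simp add: X_def S_def)
  qed
  then show ?thesis by (intro that[of X]) blast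
qed

lemma causal_at:
  assumes "causal F" "\<And>i. i \<le> n \<Longrightarrow> X i = X' i" shows "F X n = F X' n"
proof -
  have "\<forall>i\<in>{0..n}. X i = X' i" using assms(2) by simp
  with assms(1)[unfolded causal_def, THEN spec[of _ n], THEN spec[of _ X], THEN spec[of _ X']]
  show ?thesis by simp
qed

lemma strongly_causal_at:
  assumes "strongly_causal F" "\<And>i. i < n \<Longrightarrow> X i = X' i" shows "F X n = F X' n"
proof -
  have "\<forall>i\<in>{0..<n}. X i = X' i" using assms(2) by simp
  with assms(1)[unfolded strongly_causal_def, THEN spec[of _ n], THEN spec[of _ X], THEN spec[of _ X']]
  show ?thesis by simp
qed

text \<open>Here F may read the parameter and need not be recursive, while G sees only Y. A
  refutation thus excludes solutions in the sense of all three problems at once.\<close>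

lemma not_solves_and_refutes:
  assumes "solves2 P \<psi> F" "refutes1 P \<psi> G" shows False
proof -
  obtain X where X: "X = apply1 G (apply2 F X P)"
  proof (rule causal_fixpoint[of "\<lambda>X. apply2 F X P" "apply1 G"])
    fix n and X X' :: "nat set" assume X: "\<And>i. i \<le> n \<Longrightarrow> i \<in> X \<longleftrightarrow> i \<in> X'"
    have F: "causal F" using assms(1) by (simp add: solves2_def)
    show "n \<in> apply2 F X P \<longleftrightarrow> n \<in> apply2 F X' P"
      unfolding apply2_def mem_Collect_eq by (rule causal_at[OF F]) (simp add: char_word_def X)
  next
    fix n and X X' :: "nat set" assume X: "\<And>i. i < n \<Longrightarrow> i \<in> X \<longleftrightarrow> i \<in> X'"
    have G: "strongly_causal G" using assms(2) by (simp add: refutes1_def)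
    show "n \<in> apply1 G X \<longleftrightarrow> n \<in> apply1 G X'"
      unfolding apply1_def mem_Collect_eq by (rule strongly_causal_at[OF G]) (simp add: char_word_def X)
  qed
  have "holds \<psi> X (apply2 F X P) P" using assms(1) by (simp add: solves2_def)
  moreover have "\<not> holds \<psi> (apply1 G (apply2 F X P)) (apply2 F X P) P" using assms(2) by (simp add: refutes1_def)
  ultimately show False unfolding X[symmetric] by blast
qed

lemma solves1_solves2:
  assumes "solves1 P \<psi> F" shows "solves2 P \<psi> (\<lambda>w. F (\<lambda>i. fst (w i)))"
proof -
  have F: "causal F" using assms by (simp add: solves1_def)
  have "causal (\<lambda>w. F (\<lambda>i. fst (w i)) :: bool word)"
    unfolding causal_def by (intro allI impI ballI causal_at[OF F]) simp
  then show ?thesis using assms by (simp add: solves1_def solves2_def apply1_def apply2_def)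
qed

lemma wins_False:
  assumes "wins False \<beta> \<psi> \<in> monadic_theory P"
  shows "solves1 P \<psi> (strategy_op False P \<beta> (\<lambda>x. x))" "solves2 P \<psi> (strategy_op False P \<beta> fst)"
  using assms by (simp_all add: wins_in_theory solves1_def solves2_def strategy_op_causal apply_strategy_op)

lemma wins_True:
  assumes "wins True \<beta> \<psi> \<in> monadic_theory P"
  shows "refutes1 P \<psi> (strategy_op True P \<beta> (\<lambda>x. x))"
  using assms by (simp add: wins_in_theory refutes1_def strategy_op_strongly_causal apply_strategy_op)

text \<open>Unbounded search for a formula that wins for one of the players. On specifications it
  ends by \<open>strategy_determinacy\<close>; on other codes the test succeeds trivially, which
  makes the function total. Being a specification is tested by quantifying both set variables and
  asking for a sentence.\<close>

lemma strategy_search: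
  assumes "monadic_theory_decidable P"
  obtains f where "recursive1 f"
    "\<And>\<psi>. \<psi> \<in> specs \<Longrightarrow> wins False (mlo_decode (f (mlo_code \<psi>))) \<psi> \<in> monadic_theory P \<or>
       wins True (mlo_decode (f (mlo_code \<psi>))) \<psi> \<in> monadic_theory P"
proof -
  let ?W = "\<lambda>b c. sentence (Ex2 0 (Ex2 1 (mlo_decode c))) \<longrightarrow> wins False (mlo_decode b) (mlo_decode c) \<in> monadic_theory P \<or>
     wins True (mlo_decode b) (mlo_decode c) \<in> monadic_theory P"
  let ?g = "\<lambda>b c. of_bool (\<not> ?W b c) :: nat"
  have specs: "sentence (Ex2 0 (Ex2 1 \<psi>)) \<longleftrightarrow> \<psi> \<in> specs" for \<psi>
    by (auto simp: sentence_def specs_def)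
  have ex: "\<exists>b. ?W b c" for c
  proof (cases "mlo_decode c \<in> specs")
    case True
    from strategy_determinacy[OF this, of P] obtain \<beta> where
      "wins False \<beta> (mlo_decode c) \<in> monadic_theory P \<or> wins True \<beta> (mlo_decode c) \<in> monadic_theory P"
      using True unfolding wins_in_theory unary_def by (metis (full_types))
    then show ?thesis by (intro exI[of _ "mlo_code \<beta>"]) simp
  qed (use specs in blast)
  have s: "decidable_rel 2 (\<lambda>xs. sentence (Ex2 0 (Ex2 1 (mlo_decode (xs ! 1)))))"
  proof -
    have "recursive 2 (\<lambda>xs. mlo_code (Ex2 0 (Ex2 1 (mlo_decode (xs ! 1)))))" by (intro recur) simp
    from recursive_comp1[OF decidable_sentence[unfolded decidable_rel_def] this] show ?thesis
      by (simp add: decidable_rel_def del: mlo_code.simps)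
  qed
  define f where "f c = (LEAST b. ?g b c = 0)" for c
  have "recursive2 ?g" unfolding imp_conv_disj by (intro recur decidable_theory[OF assms] s) simp_all
  then have "recursive1 f" unfolding f_def by (rule recursive1_Least) (use ex in auto)
  then show ?thesis
  proof (rule that)
    fix \<psi> assume "\<psi> \<in> specs"
    moreover have "?W (f (mlo_code \<psi>)) (mlo_code \<psi>)"
      using LeastI_ex[of "\<lambda>b. ?g b (mlo_code \<psi>) = 0"] ex[of "mlo_code \<psi>"] unfolding f_def by auto
    ultimately show "wins False (mlo_decode (f (mlo_code \<psi>))) \<psi> \<in> monadic_theory P \<or>
        wins True (mlo_decode (f (mlo_code \<psi>))) \<psi> \<in> monadic_theory P"
      unfolding mlo_decode_code specs by blast
  qed
qed

lemma decidable_onI: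
  assumes "decidable_rel 1 (\<lambda>xs. R (xs ! 0))" "\<And>\<psi>. \<psi> \<in> D \<Longrightarrow> R (mlo_code \<psi>) \<longleftrightarrow> Q \<psi>"
  shows "decidable_on D Q"
proof -
  obtain p where "\<And>xs. length xs = 1 \<Longrightarrow> run p xs = Some (of_bool (R (xs ! 0)))"
    using assms(1) unfolding decidable_rel_def recursive_def by blast
  then show ?thesis unfolding decidable_on_def using assms(2) by (intro exI[of _ p]) simp
qed

lemma constructible_onI:
  assumes "recursive1 (\<lambda>b. recf_code (q b))" "recursive1 f"
    "\<And>\<psi> F. \<psi> \<in> D \<Longrightarrow> R \<psi> F \<Longrightarrow> \<exists>F. program_for c (q (f (mlo_code \<psi>))) F \<and> R \<psi> F"
  shows "constructible_on D c R"
proof -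
  obtain e where "\<And>xs. length xs = 1 \<Longrightarrow> run e xs = Some (recf_code (q (f (xs ! 0))))"
    using recursive_comp1[OF assms(1,2)] unfolding recursive_def by blast
  then show ?thesis unfolding constructible_on_def using assms(3) by (intro exI[of _ e]) force
qed

lemma synthesis:
  assumes "monadic_theory_decidable P"
  shows "problem1_computable P" "problem2_computable P" "problem3_computable P" "effectively_determined P"
proof -
  obtain f where f: "recursive1 f" and
    f_wins: "\<And>\<psi>. \<psi> \<in> specs \<Longrightarrow> wins False (mlo_decode (f (mlo_code \<psi>))) \<psi> \<in> monadic_theory P \<or>
       wins True (mlo_decode (f (mlo_code \<psi>))) \<psi> \<in> monadic_theory P"
    using strategy_search[OF assms] by blast
  have "\<forall>s. \<exists>q. recursive1 (\<lambda>b. recf_code (q b)) \<and>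
      (\<forall>b. unary (mlo_decode b) \<longrightarrow> program_for code1 (q b) (strategy_op s P (mlo_decode b) (\<lambda>x. x)))"
  proof
    have "decidable_rel 1 (\<lambda>xs. xs ! 0 = 1)" by (intro recur) simp
    then show "\<exists>q. recursive1 (\<lambda>b. recf_code (q b)) \<and>
      (\<forall>b. unary (mlo_decode b) \<longrightarrow> program_for code1 (q b) (strategy_op s P (mlo_decode b) (\<lambda>x. x)))" for s
      by (intro strategy_programs[OF assms, of "\<lambda>x. x = 1"]) (simp_all add: code1_def)
  qed
  then obtain q where "\<forall>s. recursive1 (\<lambda>b. recf_code (q s b)) \<and>
      (\<forall>b. unary (mlo_decode b) \<longrightarrow> program_for code1 (q s b) (strategy_op s P (mlo_decode b) (\<lambda>x. x)))"
    by (rule choice[THEN exE])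
  then have q: "\<And>s. recursive1 (\<lambda>b. recf_code (q s b))"
    "\<And>s b. unary (mlo_decode b) \<Longrightarrow> program_for code1 (q s b) (strategy_op s P (mlo_decode b) (\<lambda>x. x))"
    by blast+
  have code2: "fst (prod_decode (code2 x)) = 1 \<longleftrightarrow> fst x" for x
    by (cases x; cases "fst x") (simp_all add: code2_def)
  have "decidable_rel 1 (\<lambda>xs. fst (prod_decode (xs ! 0)) = 1)" by (intro recur) simp
  then have "\<exists>q. recursive1 (\<lambda>b. recf_code (q b)) \<and>
      (\<forall>b. unary (mlo_decode b) \<longrightarrow> program_for code2 (q b) (strategy_op False P (mlo_decode b) fst))"
    by (rule strategy_programs[OF assms, of "\<lambda>x. fst (prod_decode x) = 1", OF code2])
  then obtain q2 where q2: "recursive1 (\<lambda>b. recf_code (q2 b))"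
    "\<And>b. unary (mlo_decode b) \<Longrightarrow> program_for code2 (q2 b) (strategy_op False P (mlo_decode b) fst)"
    by blast
  define \<beta> where "\<beta> \<psi> = mlo_decode (f (mlo_code \<psi>))" for \<psi>
  have win: "wins False (\<beta> \<psi>) \<psi> \<in> monadic_theory P \<or> wins True (\<beta> \<psi>) \<psi> \<in> monadic_theory P" if "\<psi> \<in> specs" for \<psi>
    using f_wins[OF that] by (simp add: \<beta>_def)
  have unary: "unary (\<beta> \<psi>)" if "wins s (\<beta> \<psi>) \<psi> \<in> monadic_theory P" for s \<psi>
    using that by (simp add: wins_in_theory)
  have prog: "program_for code1 (q s (f (mlo_code \<psi>))) (strategy_op s P (\<beta> \<psi>) (\<lambda>x. x))"
    "program_for code2 (q2 (f (mlo_code \<psi>))) (strategy_op False P (\<beta> \<psi>) fst)"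
    if "unary (\<beta> \<psi>)" for s \<psi>
    using that q(2) q2(2) by (simp_all add: \<beta>_def)
  \<comment> \<open>The search returns a winning formula for one side, and any solution excludes the
    other side by the common fixpoint.\<close>
  have solvable: "wins False (\<beta> \<psi>) \<psi> \<in> monadic_theory P" if "\<psi> \<in> specs" "solves2 P \<psi> F" for \<psi> F
    using win[OF that(1)] wins_True not_solves_and_refutes[OF that(2)] by blast
  have refutable: "wins True (\<beta> \<psi>) \<psi> \<in> monadic_theory P" if "\<psi> \<in> specs" "refutes1 P \<psi> G" for \<psi> G
    using win[OF that(1)] wins_False(2) not_solves_and_refutes[OF _ that(2)] by blast
  have dec: "decidable_on specs Q" if "\<And>\<psi>. \<psi> \<in> specs \<Longrightarrow> wins s (\<beta> \<psi>) \<psi> \<in> monadic_theory P \<longleftrightarrow> Q \<psi>" for s Q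
  proof (rule decidable_onI)
    show "decidable_rel 1 (\<lambda>xs. wins s (mlo_decode (f (xs ! 0))) (mlo_decode (xs ! 0)) \<in> monadic_theory P)"
      by (intro decidable_theory[OF assms] recur f) simp
  qed (use that in \<open>simp add: \<beta>_def\<close>)
  have solves2: "constructible_on specs code2 (solves2 P)"
    by (rule constructible_onI[OF q2(1) f]) (use solvable unary prog(2) wins_False(2) in blast)
  have solves1: "constructible_on specs code1 (solves1 P)"
    by (rule constructible_onI[OF q(1)[of False] f])
      (use solvable solves1_solves2 unary prog(1) wins_False(1) in blast)
  have refutes1: "constructible_on specs code1 (refutes1 P)"
    by (rule constructible_onI[OF q(1)[of True] f]) (use refutable unary prog(1) wins_True in blast)
  have rec1: "recursive_op code1 (strategy_op s P (\<beta> \<psi>) (\<lambda>x. x))"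
    and rec2: "recursive_op code2 (strategy_op False P (\<beta> \<psi>) fst)"
    if "wins s' (\<beta> \<psi>) \<psi> \<in> monadic_theory P" for s s' \<psi>
    using prog[OF unary[OF that]] unfolding recursive_op_def by blast+
  have d3: "decidable_on specs (\<lambda>\<psi>. \<exists>F. recursive_op code1 F \<and> solves1 P \<psi> F)"
    by (rule dec[of False]) (use solvable solves1_solves2 rec1 wins_False(1) in blast)
  have d4: "decidable_on specs (\<lambda>\<psi>. \<exists>G. recursive_op code1 G \<and> refutes1 P \<psi> G)"
    by (rule dec[of True]) (use refutable rec1 wins_True in blast)
  show "problem1_computable P" unfolding problem1_computable_def
    using dec[of False "\<lambda>\<psi>. \<exists>F. solves2 P \<psi> F"] solvable wins_False(2) solves2 by blast
  show "problem2_computable P" unfolding problem2_computable_def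
    using dec[of False "\<lambda>\<psi>. \<exists>F. recursive_op code2 F \<and> solves2 P \<psi> F"] solvable wins_False(2) rec2 solves2 by blast
  show "problem3_computable P" unfolding problem3_computable_def using d3 solves1 by blast
  show "effectively_determined P" unfolding effectively_determined_def
    using d3 d4 solves1 refutes1 win wins_False(1) wins_True rec1 by blast
qed

section \<open>From the synthesis problems back to the theory\<close>

lemma theory_from_decision:
  assumes "decidable_on specs Q"
    "\<And>\<phi>. sentence \<phi> \<Longrightarrow> Q \<phi> \<longleftrightarrow> sat P (\<lambda>_. 0) (\<lambda>_. {}) \<phi>"
  shows "monadic_theory_decidable P"
proof -
  obtain d where d: "\<And>\<psi>. \<psi> \<in> specs \<Longrightarrow> run d [mlo_code \<psi>] = Some (of_bool (Q \<psi>))"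
    using assms(1) unfolding decidable_on_def by blast
  show ?thesis
    by (rule decidable_theory_of_sentences[of d]) (use assms(2) d sentence_in_specs in simp)
qed

lemma constant_op:
  "causal (\<lambda>w n. False :: bool)" "recursive_op c (\<lambda>w n. False)"
proof -
  show "recursive_op c (\<lambda>w n. False)" unfolding recursive_op_def program_for_def
    by (rule exI[of _ Zero]) simp
qed (simp add: causal_def)

text \<open>A sentence ignores X and Y, so all causal operators solve it or none does; the constant
  operator is causal, and it is recursive over both input alphabets.\<close>

lemma solves_sentence:
  assumes "sentence \<phi>"
  shows "(\<exists>F. solves2 P \<phi> F) \<longleftrightarrow> sat P (\<lambda>_. 0) (\<lambda>_. {}) \<phi>"
    "(\<exists>F. recursive_op code2 F \<and> solves2 P \<phi> F) \<longleftrightarrow> sat P (\<lambda>_. 0) (\<lambda>_. {}) \<phi>"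
    "(\<exists>F. recursive_op code1 F \<and> solves1 P \<phi> F) \<longleftrightarrow> sat P (\<lambda>_. 0) (\<lambda>_. {}) \<phi>"
  using constant_op by (auto simp: solves2_def solves1_def holds_sentence[OF assms])

theorem theorem1p2:
  fixes P :: "nat set"
  shows "(problem1_computable P \<longleftrightarrow> problem2_computable P) \<and>
         (problem2_computable P \<longleftrightarrow> problem3_computable P) \<and>
         (problem3_computable P \<longleftrightarrow> monadic_theory_decidable P) \<and>
         (monadic_theory_decidable P \<longleftrightarrow> effectively_determined P)"

proof -
  have "monadic_theory_decidable P" if "problem1_computable P"
    using that theory_from_decision solves_sentence(1) unfolding problem1_computable_def by blast
  moreover have "monadic_theory_decidable P" if "problem2_computable P"
    using that theory_from_decision solves_sentence(2) unfolding problem2_computable_def by blast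
  \<comment> \<open>The decision part of Problem 3 is also a conjunct of
    \<open>effectively_determined\<close>, so one argument serves both.\<close>
  moreover have "monadic_theory_decidable P" if "problem3_computable P \<or> effectively_determined P"
    using that theory_from_decision solves_sentence(3)
    unfolding problem3_computable_def effectively_determined_def by blast
  ultimately show ?thesis using synthesis[of P] by blast
qed

end
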